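(* Consider a system $\dot x(t) = Ax(t) + BL(t)u(t) + f(t,x(t),u(t))$, $x(0)=x^0$, $y(t)=Cx(t)$, satisfying (P1) and (P2), such that $U$ is a Lyapunov transformation. Then \[ (\hat A, \hat B, \hat C) := \big( (UA+\dot U)U^{-1},\ UBL,\ CU^{-1}\big) \] and $\hat f(t,z,u) := U(t) f\big(t,U(t)^{-1}z,u\big)$, $(t,z,u)\in\mathbb{R}^{1+n+m}$, satisfy \[ \hat A(t) = \begin{bmatrix} 0 & I_p & 0 & \cdots & 0 & 0\\ 0 & 0& I_p & & & 0\\ \vdots & \vdots & \ddots & \ddots & & \vdots\\ 0 & 0 & \cdots & 0 & I_p & 0\\ R_1(t) & R_2(t) & \cdots & R_{r-1}(t) & R_r(t) & S(t)\\ P_1(t) & P_2(t) & \cdots & P_{r-1}(t) & P_r(t) & Q(t)\end{bmatrix},\quad \hat B(t) = \begin{bmatrix} 0\\ \vdots\\ 0\\ \Gamma L(t)\\ N(t)\end{bmatrix}, \] \[ \hat C = \begin{bmatrix} I_p & 0 & \cdots & 0\end{bmatrix},\quad \hat f(t,z,u) = \big( 0, \ldots, 0, f_r(t,z,u), f_\eta(t,z,u)\big)^\top, \] where $R_i\in\mathcal{C}^\infty(\mathbb{R}\to\mathbb{R}^{p\times p})$, $P_i, S^\top\in\mathcal{C}^\infty(\mathbb{R}\to\mathbb{R}^{(n-pr)\times p})$, $Q\in\mathcal{C}^\infty(\mathbb{R}\to\mathbb{R}^{(n-pr)\times (n-pr)})$, $N\in\mathcal{C}^\infty(\mathbb{R}\to\mathbb{R}^{(n-pr)\times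 m})$, $f_r\in\mathcal{C}(\mathbb{R}\times\mathbb{R}^n\times\mathbb{R}^m\to\mathbb{R}^p)$, $f_\eta\in\mathcal{C}(\mathbb{R}\times\mathbb{R}^n\times\mathbb{R}^m\to\mathbb{R}^{n-pr})$ are all bounded. Furthermore: (i) There exists $K\in\mathcal{C}^\infty(\mathbb{R}\to\mathbb{R}^{m\times p})$ such that $\Gamma L(t) K(t) = I_p$ and $N(t) K(t) = 0$ for all $t\in\mathbb{R}$ if, and only if, \[ \forall\, t\in\mathbb{R}:\ \operatorname{im} \mathcal{B}(t) \big(\mathcal{C}\mathcal{B}(t)\big)^\dagger \begin{bmatrix} 0 \\ I_p\end{bmatrix} \subseteq \operatorname{im} BL(t); \] in this case one may choose $K(t) := \big(BL(t)\big)^\dagger \mathcal{B}(t) \big(\mathcal{C}\mathcal{B}(t)\big)^\dagger \begin{bmatrix} 0 \\ I_p\end{bmatrix}$. (ii) If $q=p$ for $q$ in (P1), then $P_2 = P_3 = \ldots = P_r = 0$ and $N=0$.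
   Context: System: $\dot x(t) = Ax(t) + BL(t)u(t) + f(t,x(t),u(t))$, $x(0)=x^0$, $y(t)=Cx(t)$ with $A\in\mathbb{R}^{n\times n}$, $B\in\mathbb{R}^{n\times m}$, $C\in\mathbb{R}^{p\times n}$, $m\ge p$, $f\in\mathcal{C}(\mathbb{R}\times\mathbb{R}^n\times\mathbb{R}^m\to\mathbb{R}^n)$ bounded. (P1): $L\in\mathcal{C}^\infty(\mathbb{R}\to\mathbb{R}^{m\times m})$ with $L,\dot L,\ldots,L^{(n)}$ bounded and there is $q\in\mathbb{N}$ with $\operatorname{rk} BL(t)=q\ge p$ for all $t$. (P2): relative degree $r\in\mathbb{N}$: $CA^kBL(\cdot)=0$ and $CA^kf(\cdot)=0$ for $k=0,\ldots,r-2$, and $\Gamma:=CA^{r-1}B\in\mathbb{R}^{p\times m}$ satisfies $\operatorname{rk}\Gamma L(t)=p$ for all $t$. Define $\mathcal{B}(t) := \big[BL(t),(\tfrac{d}{dt}-A)(BL(t)),\ldots,(\tfrac{d}{dt}-A)^{r-1}(BL(t))\big]\in\mathbb{R}^{n\times rm}$, $\mathcal{C} := [C^\top,(CA)^\top,\ldots,(CA^{r-1})^\top]^\top\in\mathbb{R}^{rp\times n}$, $\rho:=\operatorname{rk}\mathcal{C}$ (which equals $pr$ under (P1),(P2)), $V\in\mathbb{R}^{n\times(n-\rho)}$ with $\operatorname{im}V=\ker\mathcal{C}$, $\mathcal{N}(t):=V^\dagger[I_n-\mathcal{B}(t)(\mathcal{C}\mathcal{B}(t))^\dagger\mathcal{C}]$,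 and $U(t):=\begin{bmatrix}\mathcal{C}\\ \mathcal{N}(t)\end{bmatrix}$, which is invertible with $U(t)^{-1}=[\mathcal{B}(t)(\mathcal{C}\mathcal{B}(t))^\dagger, V]$. A Lyapunov transformation is $M\in\mathcal{C}^1(\mathbb{R}\to\mathbf{Gl}_n(\mathbb{R}))$ with $M$, $M^{-1}$, $\dot M$ bounded. $M^\dagger$ denotes the Moore–Penrose pseudoinverse. *)

theory Defs
  imports "HOL-Analysis.Derivative" "Jordan_Normal_Form.Matrix" "Jordan_Normal_Form.DL_Rank"
    "Jordan_Normal_Form.Matrix_Kernel"
begin

definition mrank :: "real mat \<Rightarrow> nat" where
  "mrank A = vec_space.rank (dim_row A) A"

definition mat_im :: "real mat \<Rightarrow> real vec set" where
  "mat_im A = {A *\<^sub>v v | v. v \<in> carrier_vec (dim_col A)}"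

definition pinv :: "real mat \<Rightarrow> real mat" where
  "pinv A = (THE X. X \<in> carrier_mat (dim_col A) (dim_row A) \<and>
      A * X * A = A \<and> X * A * X = X \<and>
      transpose_mat (A * X) = A * X \<and> transpose_mat (X * A) = X * A)"

definition minv :: "real mat \<Rightarrow> real mat" where
  "minv A = (THE X. X \<in> carrier_mat (dim_row A) (dim_row A) \<and>
      A * X = 1\<^sub>m (dim_row A) \<and> X * A = 1\<^sub>m (dim_row A))"

definition vstack :: "real mat \<Rightarrow> real mat \<Rightarrow> real mat" where
  "vstack A B = mat (dim_row A + dim_row B) (dim_col A)
     (\<lambda>(i,j). if i < dim_row A then A $$ (i,j) else B $$ (i - dim_row A, j))"

definition blk :: "real mat \<Rightarrow> nat \<Rightarrow> nat \<Rightarrow> nat \<Rightarrow> nat \<Rightarrow> real mat" where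
  "blk M r0 c0 nr nc = mat nr nc (\<lambda>(i,j). M $$ (r0 + i, c0 + j))"

definition vnorm :: "real vec \<Rightarrow> real" where
  "vnorm v = sqrt (v \<bullet> v)"

definition mat_deriv :: "(real \<Rightarrow> real mat) \<Rightarrow> real \<Rightarrow> real mat" where
  "mat_deriv F t = mat (dim_row (F t)) (dim_col (F t))
     (\<lambda>(i,j). deriv (\<lambda>s. F s $$ (i,j)) t)"

definition bounded_matfun :: "(real \<Rightarrow> real mat) \<Rightarrow> bool" where
  "bounded_matfun F \<longleftrightarrow> (\<exists>c. \<forall>t i j. i < dim_row (F t) \<longrightarrow> j < dim_col (F t)
      \<longrightarrow> \<bar>F t $$ (i,j)\<bar> \<le> c)"

definition smooth_matfun :: "nat \<Rightarrow> nat \<Rightarrow> (real \<Rightarrow> real mat) \<Rightarrow> bool" where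
  "smooth_matfun nr nc F \<longleftrightarrow> (\<forall>t. F t \<in> carrier_mat nr nc) \<and>
     (\<forall>i j k t. i < nr \<longrightarrow> j < nc \<longrightarrow>
        ((deriv ^^ k) (\<lambda>s. F s $$ (i,j))) differentiable (at t))"

definition C1_matfun :: "nat \<Rightarrow> nat \<Rightarrow> (real \<Rightarrow> real mat) \<Rightarrow> bool" where
  "C1_matfun nr nc F \<longleftrightarrow> (\<forall>t. F t \<in> carrier_mat nr nc) \<and>
     (\<forall>i j. i < nr \<longrightarrow> j < nc \<longrightarrow>
        (\<forall>t. (\<lambda>s. F s $$ (i,j)) differentiable (at t)) \<and>
        continuous_on UNIV (deriv (\<lambda>s. F s $$ (i,j))))"

definition lyapunov_transformation :: "nat \<Rightarrow> (real \<Rightarrow> real mat) \<Rightarrow> bool" where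
  "lyapunov_transformation n M \<longleftrightarrow> C1_matfun n n M \<and> (\<forall>t. invertible_mat (M t)) \<and>
     bounded_matfun M \<and> bounded_matfun (\<lambda>t. minv (M t)) \<and> bounded_matfun (mat_deriv M)"

definition cont_vecfun :: "nat \<Rightarrow> nat \<Rightarrow> nat \<Rightarrow>
    (real \<Rightarrow> real vec \<Rightarrow> real vec \<Rightarrow> real vec) \<Rightarrow> bool" where
  "cont_vecfun n m k F \<longleftrightarrow>
     (\<forall>t x u. x \<in> carrier_vec n \<longrightarrow> u \<in> carrier_vec m \<longrightarrow> F t x u \<in> carrier_vec k) \<and>
     (\<forall>t x u. x \<in> carrier_vec n \<longrightarrow> u \<in> carrier_vec m \<longrightarrow>
        (\<forall>\<epsilon>>0. \<exists>\<delta>>0. \<forall>t' x' u'. x' \<in> carrier_vec n \<longrightarrow> u' \<in> carrier_vec m \<longrightarrow>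
            \<bar>t' - t\<bar> < \<delta> \<longrightarrow> vnorm (x' - x) < \<delta> \<longrightarrow> vnorm (u' - u) < \<delta> \<longrightarrow>
            vnorm (F t' x' u' - F t x u) < \<epsilon>))"

definition bounded_vecfun :: "nat \<Rightarrow> nat \<Rightarrow>
    (real \<Rightarrow> real vec \<Rightarrow> real vec \<Rightarrow> real vec) \<Rightarrow> bool" where
  "bounded_vecfun n m F \<longleftrightarrow> (\<exists>c. \<forall>t x u. x \<in> carrier_vec n \<longrightarrow> u \<in> carrier_vec m \<longrightarrow>
      vnorm (F t x u) \<le> c)"

definition DmA :: "real mat \<Rightarrow> (real \<Rightarrow> real mat) \<Rightarrow> real \<Rightarrow> real mat" where
  "DmA A F = (\<lambda>t. mat_deriv F t - A * F t)"

text \<open>\<B>(t) = [BL, (d/dt - A)(BL), ..., (d/dt - A)^{r-1}(BL)] \<in> \<real>^{n x rm}.\<close>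
definition calB :: "nat \<Rightarrow> nat \<Rightarrow> nat \<Rightarrow> real mat \<Rightarrow> real mat \<Rightarrow> (real \<Rightarrow> real mat)
    \<Rightarrow> real \<Rightarrow> real mat" where
  "calB n m r A B L t = mat n (r * m)
     (\<lambda>(i,j). ((DmA A ^^ (j div m)) (\<lambda>s. B * L s) t) $$ (i, j mod m))"

text \<open>\<C> = [C; CA; ...; CA^{r-1}] \<in> \<real>^{rp x n}.\<close>
definition calC :: "nat \<Rightarrow> nat \<Rightarrow> nat \<Rightarrow> real mat \<Rightarrow> real mat \<Rightarrow> real mat" where
  "calC n p r A C = mat (r * p) n (\<lambda>(i,j). (C * A ^\<^sub>m (i div p)) $$ (i mod p, j))"

definition calN :: "nat \<Rightarrow> nat \<Rightarrow> nat \<Rightarrow> nat \<Rightarrow> real mat \<Rightarrow> real mat \<Rightarrow> real mat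
    \<Rightarrow> (real \<Rightarrow> real mat) \<Rightarrow> real mat \<Rightarrow> real \<Rightarrow> real mat" where
  "calN n m p r A B C L V t = pinv V * (1\<^sub>m n - calB n m r A B L t *
      pinv (calC n p r A C * calB n m r A B L t) * calC n p r A C)"

definition calU :: "nat \<Rightarrow> nat \<Rightarrow> nat \<Rightarrow> nat \<Rightarrow> real mat \<Rightarrow> real mat \<Rightarrow> real mat
    \<Rightarrow> (real \<Rightarrow> real mat) \<Rightarrow> real mat \<Rightarrow> real \<Rightarrow> real mat" where
  "calU n m p r A B C L V t = vstack (calC n p r A C) (calN n m p r A B C L V t)"

definition E0I :: "nat \<Rightarrow> nat \<Rightarrow> real mat" where
  "E0I p r = mat (r * p) p (\<lambda>(i,j). if i = (r - 1) * p + j then 1 else 0)"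

end

(* The matrix E(t) = B(t) (C B(t))^+ (calligraphic B, C) satisfies C E = I, because C B is block
   anti-triangular with full-rank blocks +-Gamma L on the anti-diagonal.  Everything in the normal
   form except (ii) uses only this: it gives U^{-1} = [E, V], and the shape of the transformed system can be
   read off from the rows C A^k of U.  Smoothness rests on the smoothness of the pseudoinverse of a
   matrix function of constant rank, which near each point has a smooth full rank factorization.
   For (i), K solves Gamma L K = I, N K = 0 iff B L K = E [0; I].
   For (ii), q = p yields a factorization B L = W G with G = Gamma L and C A^{r-1} W = I.  Passing from
   B L to W does not change E, so N annihilates (d/dt - A)^k W for k < r, and therefore
   N' + N A annihilates these for k < r - 1; this forces (N' + N A) E to be a left multiple of C E = [I, 0]. *)

theory Submission
  imports Defs
begin

section \<open>Full rank factorizations\<close>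

text \<open>\<open>pinv\<close> is a definite description, so nothing can be said about it before
  existence and uniqueness are settled. A full rank factorization A = F G settles existence by the
  formula G^T (G G^T)^{-1} (F^T F)^{-1} F^T. The same formula carries smoothness, because the
  entries of an inverse are quotients of determinants. The obstacle in (ii) is that the
  pseudoinverse of \<open>CC * calB\<close> is in general only a right inverse: N E = 0 says nothing
  directly about N applied to the columns of \<open>calB\<close>. Once B L is replaced by W, which
  has p columns, the corresponding product is square, E fixes the columns of the Krylov matrix of W,
  and N annihilates all of them. No formula for the derivative of E or of the pseudoinverse is
  needed. The identity Z (G' - A G) = (Z G)' - (Z' + Z A) G moves the operator d/dt - A from G to
  the left factor, and for this reason annihilators are allowed to depend on time.\<close>

lemma det_nonzero_minv:
  fixes A :: "real mat"
  assumes A: "A \<in> carrier_mat n n" and d: "det A \<noteq> 0"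
  shows "(1 / det A) \<cdot>\<^sub>m adj_mat A \<in> carrier_mat n n"
    "A * ((1 / det A) \<cdot>\<^sub>m adj_mat A) = 1\<^sub>m n"
    "((1 / det A) \<cdot>\<^sub>m adj_mat A) * A = 1\<^sub>m n"
proof -
  have e: "(1 / det A) \<cdot>\<^sub>m (det A \<cdot>\<^sub>m 1\<^sub>m n) = 1\<^sub>m n"
    using d by (intro eq_matI) auto
  show "(1 / det A) \<cdot>\<^sub>m adj_mat A \<in> carrier_mat n n" using adj_mat(1)[OF A] by simp
  show "A * ((1 / det A) \<cdot>\<^sub>m adj_mat A) = 1\<^sub>m n"
    using mult_smult_distrib[OF A adj_mat(1)[OF A]] adj_mat(2)[OF A] e by simp
  show "((1 / det A) \<cdot>\<^sub>m adj_mat A) * A = 1\<^sub>m n"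
    using mult_smult_assoc_mat[OF adj_mat(1)[OF A] A] adj_mat(3)[OF A] e by simp
qed

lemma minv_eqI:
  assumes A: "A \<in> carrier_mat n n" and X: "X \<in> carrier_mat n n" and AX: "A * X = 1\<^sub>m n"
  shows "minv A = X"
proof -
  have XA: "X * A = 1\<^sub>m n" by (rule mat_mult_left_right_inverse[OF A X AX])
  show ?thesis unfolding minv_def
  proof (rule the_equality)
    show "X \<in> carrier_mat (dim_row A) (dim_row A) \<and> A * X = 1\<^sub>m (dim_row A) \<and> X * A = 1\<^sub>m (dim_row A)"
      using A X AX XA by auto
    fix Y assume "Y \<in> carrier_mat (dim_row A) (dim_row A) \<and> A * Y = 1\<^sub>m (dim_row A) \<and> Y * A = 1\<^sub>m (dim_row A)"
    then have Y: "Y \<in> carrier_mat n n" "Y * A = 1\<^sub>m n" using A by auto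
    have "Y = Y * (A * X)" using AX Y by auto
    also have "\<dots> = (Y * A) * X" using assoc_mult_mat[OF Y(1) A X] by simp
    also have "\<dots> = X" using Y X by simp
    finally show "Y = X" .
  qed
qed

text \<open>Cramer's rule: the entries become quotients of determinants, which is how smoothness in
  t passes to \<open>minv\<close>.\<close>

lemma minv_conv_adj:
  assumes A: "A \<in> carrier_mat n n" and d: "det A \<noteq> 0"
  shows "minv A = (1 / det A) \<cdot>\<^sub>m adj_mat A"
  using minv_eqI[OF A] det_nonzero_minv[OF assms] by blast

lemma minv_props:
  assumes A: "A \<in> carrier_mat n n" and d: "det A \<noteq> 0"
  shows "minv A \<in> carrier_mat n n" "A * minv A = 1\<^sub>m n" "minv A * A = 1\<^sub>m n"
  unfolding minv_conv_adj[OF assms] by (rule det_nonzero_minv[OF assms])+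

lemma scalar_self_eq_0:
  fixes v :: "real vec"
  assumes "v \<in> carrier_vec n" "v \<bullet> v = 0" shows "v = 0\<^sub>v n"
proof -
  have "conjugate v = v" by (intro eq_vecI) auto
  with assms conjugate_square_eq_0_vec[OF assms(1)] show ?thesis by auto
qed

text \<open>F^T F x = 0 gives |F x|^2 = x . F^T F x = 0, hence F x = 0. Over the reals the Gram
  matrix thus has the same kernel as F.\<close>

lemma gram_det_nonzero:
  fixes F :: "real mat"
  assumes F: "F \<in> carrier_mat n q"
    and inj: "\<And>x. x \<in> carrier_vec q \<Longrightarrow> F *\<^sub>v x = 0\<^sub>v n \<Longrightarrow> x = 0\<^sub>v q"
  shows "det (F\<^sup>T * F) \<noteq> 0"
proof
  have FF: "F\<^sup>T * F \<in> carrier_mat q q" using F by auto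
  assume "det (F\<^sup>T * F) = 0"
  then obtain x where x: "x \<in> carrier_vec q" "x \<noteq> 0\<^sub>v q" and z: "F\<^sup>T * F *\<^sub>v x = 0\<^sub>v q"
    using det_0_iff_vec_prod_zero[OF FF] by auto
  have Fx: "F *\<^sub>v x \<in> carrier_vec n" using F x by auto
  have "(F *\<^sub>v x) \<bullet> (F *\<^sub>v x) = x \<bullet> (F\<^sup>T *\<^sub>v (F *\<^sub>v x))"
    using F x Fx by (metis transpose_vec_mult_scalar comm_scalar_prod mult_mat_vec_carrier transpose_carrier_mat)
  also have "\<dots> = 0" using z F x assoc_mult_mat_vec[of "F\<^sup>T" q n F q x] by auto
  finally have "F *\<^sub>v x = 0\<^sub>v n" by (rule scalar_self_eq_0[OF Fx])
  with inj x show False by auto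
qed

lemma left_inverse_injective:
  fixes F H :: "real mat"
  assumes F: "F \<in> carrier_mat n q" and H: "H \<in> carrier_mat q n" and HF: "H * F = 1\<^sub>m q"
    and x: "x \<in> carrier_vec q" and "F *\<^sub>v x = 0\<^sub>v n"
  shows "x = 0\<^sub>v q"
proof -
  have "x = (H * F) *\<^sub>v x" using HF x by simp
  also have "\<dots> = H *\<^sub>v (F *\<^sub>v x)" by (rule assoc_mult_mat_vec[OF H F x])
  also have "\<dots> = 0\<^sub>v q" using assms by auto
  finally show ?thesis .
qed

lemma injective_left_inverse:
  fixes F :: "real mat"
  assumes F: "F \<in> carrier_mat n q"
    and inj: "\<And>x. x \<in> carrier_vec q \<Longrightarrow> F *\<^sub>v x = 0\<^sub>v n \<Longrightarrow> x = 0\<^sub>v q"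
  shows "\<exists>H \<in> carrier_mat q n. H * F = 1\<^sub>m q"
proof -
  have FF: "F\<^sup>T * F \<in> carrier_mat q q" using F by auto
  note d = gram_det_nonzero[OF assms]
  note m = minv_props[OF FF d]
  have "minv (F\<^sup>T * F) * F\<^sup>T * F = 1\<^sub>m q"
    using assoc_mult_mat[OF m(1) transpose_carrier_mat[THEN iffD2, OF F] F] m(3) by simp
  then show ?thesis
    by (intro bexI[of _ "minv (F\<^sup>T * F) * F\<^sup>T"]) (use F m(1) in auto)
qed

lemma transpose_injective_right_inverse:
  fixes G :: "real mat"
  assumes G: "G \<in> carrier_mat q m"
    and inj: "\<And>x. x \<in> carrier_vec q \<Longrightarrow> G\<^sup>T *\<^sub>v x = 0\<^sub>v m \<Longrightarrow> x = 0\<^sub>v q"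
  shows "\<exists>J \<in> carrier_mat m q. G * J = 1\<^sub>m q"
proof -
  obtain H where H: "H \<in> carrier_mat q m" "H * G\<^sup>T = 1\<^sub>m q"
    using injective_left_inverse[of "G\<^sup>T" m q] G inj by auto
  then have "(H * G\<^sup>T)\<^sup>T = 1\<^sub>m q" by simp
  then have "G * H\<^sup>T = 1\<^sub>m q" using H G transpose_mult[of H q m "G\<^sup>T" q] by simp
  then show ?thesis using H by (intro bexI[of _ "H\<^sup>T"]) auto
qed

text \<open>\<open>H\<close> and \<open>J\<close> witness that \<open>F\<close> has full column rank
  and \<open>G\<close> full row rank. With the one-sided inverses among the data, later arguments
  cancel factors algebraically instead of reasoning about ranks.\<close>

definition full_rank_factors :: "real mat \<Rightarrow> nat \<Rightarrow> nat \<Rightarrow> nat \<Rightarrow> real mat \<Rightarrow> real mat \<Rightarrow> real mat \<Rightarrow> real mat \<Rightarrow> bool" where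
  "full_rank_factors A n m q F G H J \<longleftrightarrow>
     F \<in> carrier_mat n q \<and> G \<in> carrier_mat q m \<and> H \<in> carrier_mat q n \<and> J \<in> carrier_mat m q \<and>
     A = F * G \<and> H * F = 1\<^sub>m q \<and> G * J = 1\<^sub>m q"

text \<open>The columns of \<open>F\<close> are a maximal linearly independent set of columns of
  \<open>A\<close>, whose size is the rank; the columns of \<open>G\<close> are the coordinates of
  the columns of \<open>A\<close> with respect to it.\<close>

lemma mrank_full_rank_factors:
  assumes A: "A \<in> carrier_mat n m"
  shows "\<exists>F G H J. full_rank_factors A n m (mrank A) F G H J"
proof -
  interpret vec_space "TYPE(real)" n .
  have fin: "finite (set (cols A))" by simp
  have sub: "set (cols A) \<subseteq> carrier_vec n" using A cols_dim by blast
  have "lin_indpt {}" by (simp add: lin_dep_def)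
  then obtain S where S: "finite S" "maximal S (\<lambda>T. T \<subseteq> set (cols A) \<and> lin_indpt T)"
    using maximal_exists_superset[of "set (cols A)" "(\<lambda>T. T \<subseteq> set (cols A) \<and> lin_indpt T)" "{}"] by auto
  have SA: "S \<subseteq> set (cols A)" and li: "lin_indpt S" using S by (auto simp: maximal_def)
  have q: "mrank A = card S" using A rank_card_indpt[OF A S(2)] unfolding mrank_def by auto
  obtain ws where ws: "set ws = S" "distinct ws" using finite_distinct_list[OF S(1)] by auto
  have lws: "length ws = card S" using ws distinct_card by force
  have wsn: "set ws \<subseteq> carrier_vec n" using ws SA sub by auto
  define F where "F = mat_of_cols n ws"
  have F: "F \<in> carrier_mat n (card S)" unfolding F_def using lws by auto
  have cF: "cols F = ws" unfolding F_def using cols_mat_of_cols[OF wsn] .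
  have inj: "x = 0\<^sub>v (card S)" if x: "x \<in> carrier_vec (card S)" and z: "F *\<^sub>v x = 0\<^sub>v n" for x
  proof (rule ccontr)
    assume "x \<noteq> 0\<^sub>v (card S)"
    then have "lin_dep S"
      using lin_depI[OF F, of x] x z cF ws by auto
    with li show False by simp
  qed
  obtain H where H: "H \<in> carrier_mat (card S) n" "H * F = 1\<^sub>m (card S)"
    using injective_left_inverse[OF F inj] by auto
  have mu: "A *\<^sub>v unit_vec m k = col A k" if "k < m" for k
    using that A by (intro eq_vecI) auto
  have "\<exists>g \<in> carrier_vec (card S). col A j = F *\<^sub>v g" if j: "j < m" for j
  proof -
    have cj: "col A j \<in> set (cols A)" using j A unfolding cols_def by auto
    have "col A j \<in> span S"
    proof (rule ccontr)
      assume n: "col A j \<notin> span S"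
      have nS: "col A j \<notin> S" using n in_own_span[of S] SA sub by auto
      have "lin_indpt (S \<union> {col A j})"
        using lin_dep_iff_in_span[OF _ li _ nS] SA sub cj n by auto
      then have "S \<union> {col A j} = S"
        using S(2) SA cj unfolding maximal_def by (metis Un_upper1 insert_subset Un_insert_right sup_bot_right)
      with nS show False by auto
    qed
    then obtain c where "col A j = lincomb_list c ws"
      using span_list_as_span[OF wsn] ws unfolding span_list_def by blast
    also have "\<dots> = F *\<^sub>v vec (length ws) c"
      unfolding F_def by (rule lincomb_list_as_mat_mult) (use wsn in auto)
    finally show ?thesis using lws by (intro bexI[of _ "vec (length ws) c"]) auto
  qed
  then obtain g where g: "\<And>j. j < m \<Longrightarrow> g j \<in> carrier_vec (card S) \<and> col A j = F *\<^sub>v g j" by metis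
  define G where "G = mat_of_cols (card S) (map g [0..<m])"
  have G: "G \<in> carrier_mat (card S) m" unfolding G_def by auto
  have colG: "col G j = g j" if "j < m" for j
    unfolding G_def using that g by (subst col_mat_of_cols) auto
  have AFG: "A = F * G"
  proof (rule mat_col_eqI)
    fix j assume "j < dim_col (F * G)"
    then have j: "j < m" using G by simp
    then show "col A j = col (F * G) j" using col_mult2[OF F G j] colG g by simp
  qed (use A F G in auto)
  have "\<exists>k<m. col F i = col A k" if i: "i < card S" for i
  proof -
    have "col F i = ws ! i" using cF F i by (metis carrier_matD(2) cols_nth)
    also have "\<dots> \<in> set (cols A)" using SA ws lws i nth_mem by force
    finally show ?thesis using A unfolding cols_def by auto
  qed
  then obtain k where k: "\<And>i. i < card S \<Longrightarrow> k i < m \<and> col F i = col A (k i)" by metis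
  \<comment> \<open>A selection matrix: each column of \<open>F\<close> is itself a column of
    \<open>A\<close>, and \<open>J\<close> picks it out. Then
    \<open>F = A * J = F * (G * J)\<close>, and \<open>H\<close> cancels \<open>F\<close>.\<close>
  define J where "J = mat_of_cols m (map (\<lambda>i. unit_vec m (k i) :: real vec) [0..<card S])"
  have J: "J \<in> carrier_mat m (card S)" unfolding J_def by auto
  have "F = A * J"
  proof (rule mat_col_eqI)
    fix i assume "i < dim_col (A * J)"
    then have i: "i < card S" using J by simp
    have "col J i = unit_vec m (k i)" unfolding J_def using i by (subst col_mat_of_cols) auto
    then show "col F i = col (A * J) i"
      using col_mult2[OF A J i] k[OF i] mu by simp
  qed (use A F J in auto)
  then have "F = F * (G * J)" using AFG assoc_mult_mat[OF F G J] by simp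
  then have "H * F = H * F * (G * J)" using H F G J assoc_mult_mat[OF H(1) F, of "G * J" "card S"] by simp
  then have "G * J = 1\<^sub>m (card S)" using H G J by simp
  then show ?thesis unfolding full_rank_factors_def q using F G H J AFG by blast
qed

section \<open>The Moore-Penrose inverse\<close>

text \<open>The side conditions compare dimensions and mention no variable outside the left-hand
  side, so the equation works as a rewrite rule and brings products to right-nested form.\<close>

lemma mat_assoc:
  "dim_col A = dim_row B \<Longrightarrow> dim_col B = dim_row C \<Longrightarrow> A * B * C = A * (B * C)"
  for A B C :: "real mat"
  by (rule assoc_mult_mat[of A "dim_row A" "dim_row B" B "dim_row C" C "dim_col C"]) auto

lemma mat_transpose_mult:
  "dim_col A = dim_row B \<Longrightarrow> (A * B)\<^sup>T = B\<^sup>T * A\<^sup>T" for A B :: "real mat"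
  by (rule transpose_mult[of A "dim_row A" "dim_row B" B "dim_col B"]) auto

text \<open>In a right-nested product the pair \<open>A * B\<close> is no longer a subterm; in this
  form a one-sided inverse still cancels there.\<close>

lemma mat_cancel_left:
  fixes A B X :: "real mat"
  assumes "A * B = 1\<^sub>m k" "dim_col A = dim_row B" "dim_row X = k"
  shows "A * (B * X) = X"
proof -
  have "dim_col B = k" using assms(1) by (metis index_mult_mat(3) index_one_mat(3))
  then have "A * (B * X) = (A * B) * X" using mat_assoc[of A B X] assms by simp
  also have "\<dots> = X" unfolding assms(1) using assms(3) by (intro left_mult_one_mat) auto
  finally show ?thesis .
qed

text \<open>The Penrose equations have at most one solution: for solutions X and Y the products A X
  and A Y are symmetric, so transposing (A Y)(A X) gives A X = A Y, and likewise X A = Y A. This is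
  the uniqueness that the description in \<open>pinv\<close> requires.\<close>

lemma pinv_eqI:
  fixes A X :: "real mat"
  assumes A: "A \<in> carrier_mat n m" and X: "X \<in> carrier_mat m n"
    and P: "A * X * A = A" "X * A * X = X" "(A * X)\<^sup>T = A * X" "(X * A)\<^sup>T = X * A"
  shows "pinv A = X"
  unfolding pinv_def
proof (rule the_equality)
  show "X \<in> carrier_mat (dim_col A) (dim_row A) \<and> A * X * A = A \<and> X * A * X = X \<and>
      (A * X)\<^sup>T = A * X \<and> (X * A)\<^sup>T = X * A"
    using A X P by auto
  fix Y assume "Y \<in> carrier_mat (dim_col A) (dim_row A) \<and> A * Y * A = A \<and> Y * A * Y = Y \<and>
      (A * Y)\<^sup>T = A * Y \<and> (Y * A)\<^sup>T = Y * A"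
  then have Y: "Y \<in> carrier_mat m n" and Q: "A * Y * A = A" "Y * A * Y = Y" "(A * Y)\<^sup>T = A * Y" "(Y * A)\<^sup>T = Y * A"
    using A by auto
  note d = carrier_matD[OF A] carrier_matD[OF X] carrier_matD[OF Y]
  have "A * X = (A * Y * A) * X" using Q by simp
  also have "\<dots> = (A * Y) * (A * X)" using d by (simp add: mat_assoc)
  also have "\<dots> = (A * Y)\<^sup>T * (A * X)\<^sup>T" using P Q by simp
  also have "\<dots> = (A * X * (A * Y))\<^sup>T" using d by (simp add: mat_transpose_mult)
  also have "A * X * (A * Y) = (A * X * A) * Y" using d by (simp add: mat_assoc)
  also have "(\<dots>)\<^sup>T = A * Y" using P Q by simp
  finally have AX: "A * X = A * Y" .
  have "X * A = X * (A * Y * A)" using Q by simp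
  also have "\<dots> = (X * A) * (Y * A)" using d by (simp add: mat_assoc)
  also have "\<dots> = (X * A)\<^sup>T * (Y * A)\<^sup>T" using P Q by simp
  also have "\<dots> = (Y * A * (X * A))\<^sup>T" using d by (simp add: mat_transpose_mult)
  also have "Y * A * (X * A) = Y * (A * X * A)" using d by (simp add: mat_assoc)
  also have "(\<dots>)\<^sup>T = Y * A" using P Q by simp
  finally have XA: "X * A = Y * A" .
  have "X = X * A * X" using P by simp
  also have "\<dots> = Y * (A * X)" using d XA by (simp add: mat_assoc)
  also have "\<dots> = Y * A * Y" using d AX by (simp add: mat_assoc)
  finally show "Y = X" using Q by simp
qed

lemma minv_symmetric:
  fixes M :: "real mat"
  assumes M: "M \<in> carrier_mat k k" and d: "det M \<noteq> 0" and s: "M\<^sup>T = M"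
  shows "(minv M)\<^sup>T = minv M"
proof -
  note m = minv_props[OF M d]
  have "(minv M * M)\<^sup>T = 1\<^sub>m k" using m by simp
  then have "M * (minv M)\<^sup>T = 1\<^sub>m k" using m(1) M s by (simp add: mat_transpose_mult)
  then show ?thesis using minv_eqI[OF M, of "(minv M)\<^sup>T"] m(1) by simp
qed

lemma full_rank_factors_det:
  assumes "full_rank_factors A n m q F G H J"
  shows "det (F\<^sup>T * F) \<noteq> 0" "det (G * G\<^sup>T) \<noteq> 0"
proof -
  have F: "F \<in> carrier_mat n q" and G: "G \<in> carrier_mat q m" and H: "H \<in> carrier_mat q n"
    and J: "J \<in> carrier_mat m q" and HF: "H * F = 1\<^sub>m q" and GJ: "G * J = 1\<^sub>m q"
    using assms by (auto simp: full_rank_factors_def)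
  show "det (F\<^sup>T * F) \<noteq> 0"
    by (rule gram_det_nonzero[OF F left_inverse_injective[OF F H HF]])
  have "(G * J)\<^sup>T = 1\<^sub>m q" using GJ by simp
  then have "J\<^sup>T * G\<^sup>T = 1\<^sub>m q" using G J by (simp add: mat_transpose_mult)
  note JG = this
  have GT: "G\<^sup>T \<in> carrier_mat m q" and JT: "J\<^sup>T \<in> carrier_mat q m" using G J by auto
  show "det (G * G\<^sup>T) \<noteq> 0"
    using gram_det_nonzero[OF GT left_inverse_injective[OF GT JT JG]] by simp
qed

text \<open>\<open>R\<close> is a right inverse of \<open>G\<close> and \<open>S\<close> a left
  inverse of \<open>F\<close>. Hence A (R S) = F S and (R S) A = R G, the orthogonal projections
  onto the column space of \<open>F\<close> and the row space of \<open>G\<close>, and all four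
  Penrose equations follow.\<close>

lemma pinv_full_rank_factors:
  assumes "full_rank_factors A n m q F G H J"
  shows "pinv A = G\<^sup>T * minv (G * G\<^sup>T) * (minv (F\<^sup>T * F) * F\<^sup>T)"
    and "pinv A \<in> carrier_mat m n" and "A * pinv A * A = A"
proof -
  have F: "F \<in> carrier_mat n q" and G: "G \<in> carrier_mat q m" and A: "A = F * G"
    using assms by (auto simp: full_rank_factors_def)
  have FF: "F\<^sup>T * F \<in> carrier_mat q q" and GG: "G * G\<^sup>T \<in> carrier_mat q q" using F G by auto
  note d = full_rank_factors_det[OF assms]
  note mF = minv_props[OF FF d(1)] and mG = minv_props[OF GG d(2)]
  have sF: "(minv (F\<^sup>T * F))\<^sup>T = minv (F\<^sup>T * F)"
    by (rule minv_symmetric[OF FF d(1)]) (use F in \<open>simp add: mat_transpose_mult\<close>)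
  have sG: "(minv (G * G\<^sup>T))\<^sup>T = minv (G * G\<^sup>T)"
    by (rule minv_symmetric[OF GG d(2)]) (use G in \<open>simp add: mat_transpose_mult\<close>)
  define R where "R = G\<^sup>T * minv (G * G\<^sup>T)"
  define S where "S = minv (F\<^sup>T * F) * F\<^sup>T"
  have R: "R \<in> carrier_mat m q" using G mG by (simp add: R_def)
  have S: "S \<in> carrier_mat q n" using F mF by (simp add: S_def)
  note D = carrier_matD[OF F] carrier_matD[OF G] carrier_matD[OF R] carrier_matD[OF S]
    carrier_matD[OF mF(1)] carrier_matD[OF mG(1)]
  have GR: "G * R = 1\<^sub>m q" using mG(2) D by (simp add: R_def mat_assoc)
  have SF: "S * F = 1\<^sub>m q" using mF(3) D by (simp add: S_def mat_assoc)
  note c = mat_cancel_left[OF GR] mat_cancel_left[OF SF]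
  have AX: "A * (R * S) = F * S" using D by (simp add: A mat_assoc c)
  have XA: "R * S * A = R * G" using D by (simp add: A mat_assoc c)
  have sAX: "(F * S)\<^sup>T = F * S" using D sF by (simp add: S_def mat_transpose_mult mat_assoc)
  have sXA: "(R * G)\<^sup>T = R * G" using D sG by (simp add: R_def mat_transpose_mult mat_assoc)
  have 1: "A * (R * S) * A = A" unfolding AX using D by (simp add: A mat_assoc c)
  have 2: "R * S * A * (R * S) = R * S" unfolding XA using D by (simp add: mat_assoc c)
  have X: "R * S \<in> carrier_mat m n" using R S by simp
  have "A \<in> carrier_mat n m" using A F G by simp
  from pinv_eqI[OF this X 1 2] have e: "pinv A = R * S"
    using sAX sXA unfolding AX XA by blast
  show "pinv A = G\<^sup>T * minv (G * G\<^sup>T) * (minv (F\<^sup>T * F) * F\<^sup>T)" using e by (simp add: R_def S_def)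
  show "pinv A \<in> carrier_mat m n" using e X by simp
  show "A * pinv A * A = A" unfolding e by (rule 1)
qed

lemma pinv_props:
  assumes A: "A \<in> carrier_mat n m"
  shows "pinv A \<in> carrier_mat m n" "A * pinv A * A = A"
proof -
  obtain F G H J where f: "full_rank_factors A n m (mrank A) F G H J"
    using mrank_full_rank_factors[OF A] by blast
  show "pinv A \<in> carrier_mat m n" "A * pinv A * A = A"
    by (rule pinv_full_rank_factors[OF f])+
qed

text \<open>Multiplying A A^+ A = A on the right by any right inverse \<open>J\<close> leaves A A^+
  = I.\<close>

lemma pinv_right_inverse:
  assumes A: "A \<in> carrier_mat n m" and J: "J \<in> carrier_mat m n" and AJ: "A * J = 1\<^sub>m n"
  shows "A * pinv A = 1\<^sub>m n"
proof -
  have "A * pinv A = A * pinv A * (A * J)" using AJ A pinv_props(1)[OF A] by simp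
  also have "\<dots> = A * pinv A * A * J" using A J pinv_props(1)[OF A] by (simp add: mat_assoc)
  finally show ?thesis using pinv_props(2)[OF A] AJ by simp
qed

lemma pinv_left_inverse:
  assumes A: "A \<in> carrier_mat n m" and J: "J \<in> carrier_mat m n" and JA: "J * A = 1\<^sub>m m"
  shows "pinv A * A = 1\<^sub>m m"
proof -
  have "pinv A * A = J * A * (pinv A * A)" using JA A pinv_props(1)[OF A] by simp
  also have "\<dots> = J * (A * pinv A * A)" using A J pinv_props(1)[OF A] by (simp add: mat_assoc)
  finally show ?thesis using pinv_props(2)[OF A] JA by simp
qed

section \<open>Rank and one-sided inverses\<close>

lemma two_sided_inverse_square:
  fixes F H :: "real mat"
  assumes F: "F \<in> carrier_mat a b" and H: "H \<in> carrier_mat b a"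
    and FH: "F * H = 1\<^sub>m a" and HF: "H * F = 1\<^sub>m b"
  shows "a = b"
proof -
  \<comment> \<open>Two evaluations of one trace: trace (F H) = a and trace (H F) = b.\<close>
  have "real a = (\<Sum>i<a. (F * H) $$ (i,i))" unfolding FH by simp
  also have "\<dots> = (\<Sum>i<a. \<Sum>j<b. F $$ (i,j) * H $$ (j,i))"
    using F H by (intro sum.cong) (auto simp: scalar_prod_def lessThan_atLeast0)
  also have "\<dots> = (\<Sum>j<b. \<Sum>i<a. H $$ (j,i) * F $$ (i,j))"
    by (subst sum.swap) (simp add: mult.commute)
  also have "\<dots> = (\<Sum>j<b. (H * F) $$ (j,j))"
    using F H by (intro sum.cong) (auto simp: scalar_prod_def lessThan_atLeast0)
  also have "\<dots> = real b" unfolding HF by simp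
  finally show ?thesis by simp
qed

lemma mrank_right_inverse:
  assumes A: "A \<in> carrier_mat p m" and J: "J \<in> carrier_mat m p" and AJ: "A * J = 1\<^sub>m p"
  shows "mrank A = p"
proof -
  obtain F G H J' where f: "full_rank_factors A p m (mrank A) F G H J'"
    using mrank_full_rank_factors[OF A] by blast
  then have F: "F \<in> carrier_mat p (mrank A)" and G: "G \<in> carrier_mat (mrank A) m"
    and H: "H \<in> carrier_mat (mrank A) p" and HF: "H * F = 1\<^sub>m (mrank A)" and AFG: "A = F * G"
    by (auto simp: full_rank_factors_def)
  have FGJ: "F * (G * J) = 1\<^sub>m p" using AJ F G J AFG by (simp add: mat_assoc)
  \<comment> \<open>The left inverse \<open>H\<close> and the right inverse \<open>G * J\<close> of
    \<open>F\<close> coincide, so \<open>F\<close> is invertible on both sides and its column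
    number, which is the rank, equals \<open>p\<close>.\<close>
  have "H = H * (F * (G * J))" using H FGJ by simp
  also have "\<dots> = G * J" by (rule mat_cancel_left[OF HF]) (use F G H in auto)
  finally have "F * H = 1\<^sub>m p" using FGJ by simp
  from two_sided_inverse_square[OF F H this HF] show ?thesis by simp
qed

lemma mrank_full_row_right_inverse:
  assumes A: "A \<in> carrier_mat p m" and r: "mrank A = p"
  shows "\<exists>J \<in> carrier_mat m p. A * J = 1\<^sub>m p"
proof -
  obtain F G H J where f: "full_rank_factors A p m p F G H J"
    using mrank_full_rank_factors[OF A] r by auto
  then have F: "F \<in> carrier_mat p p" and G: "G \<in> carrier_mat p m" and J: "J \<in> carrier_mat m p"
    and H: "H \<in> carrier_mat p p" and HF: "H * F = 1\<^sub>m p" and GJ: "G * J = 1\<^sub>m p" and AFG: "A = F * G"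
    by (auto simp: full_rank_factors_def)
  have "F * H = 1\<^sub>m p" by (rule mat_mult_left_right_inverse[OF H F HF])
  then have "A * (J * H) = 1\<^sub>m p"
    using F G J H by (simp add: AFG mat_assoc mat_cancel_left[OF GJ])
  then show ?thesis using J H by (intro bexI[of _ "J * H"]) auto
qed

text \<open>In a rank factorization M = F G with inner dimension p, the hypothesis makes the square
  matrices T F and G J inverse to each other, and exchanging their order inside F (G J) (T F) G
  gives M back. The factors M J and T M depend on t as smoothly as M, T and J do, which rank
  factorizations chosen separately for each t need not. The lemma serves both the smoothness of
  \<open>pinv\<close> and the factorization B L = W G in (ii).\<close>

lemma mrank_factor_through:
  assumes M: "M \<in> carrier_mat n m" and r: "mrank M = p"
    and T: "T \<in> carrier_mat p n" and J: "J \<in> carrier_mat m p" and TMJ: "T * M * J = 1\<^sub>m p"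
  shows "M = M * J * (T * M)"
proof -
  obtain F G H K where f: "full_rank_factors M n m p F G H K"
    using mrank_full_rank_factors[OF M] r by auto
  then have F: "F \<in> carrier_mat n p" and G: "G \<in> carrier_mat p m" and MFG: "M = F * G"
    by (auto simp: full_rank_factors_def)
  have "(T * F) * (G * J) = 1\<^sub>m p" using TMJ F G J T by (simp add: MFG mat_assoc)
  then have e: "(G * J) * (T * F) = 1\<^sub>m p"
    by (rule mat_mult_left_right_inverse[rotated 2]) (use F G J T in auto)
  have "M * J * (T * M) = F * ((G * J) * ((T * F) * G))" using F G J T by (simp add: MFG mat_assoc)
  also have "(G * J) * ((T * F) * G) = G" by (rule mat_cancel_left[OF e]) (use F G J T in auto)
  finally show ?thesis using MFG by simp
qed

section \<open>Smooth real and matrix functions\<close>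

text \<open>All derivatives of order at most \<open>k\<close> are required to be differentiable, so
  \<open>Ck_on k\<close> means k + 1 times differentiable. Finite orders give an induction in which
  product and quotient rules can use \<open>f\<close> itself at one order less.\<close>

definition Ck_on :: "nat \<Rightarrow> real set \<Rightarrow> (real \<Rightarrow> real) \<Rightarrow> bool" where
  "Ck_on k S f \<longleftrightarrow> (\<forall>j\<le>k. \<forall>t\<in>S. (deriv ^^ j) f differentiable (at t))"

lemma Ck_on_0: "Ck_on 0 S f \<longleftrightarrow> (\<forall>t\<in>S. f differentiable (at t))"
  by (simp add: Ck_on_def)

lemma Ck_on_Suc: "Ck_on (Suc k) S f \<longleftrightarrow> (\<forall>t\<in>S. f differentiable (at t)) \<and> Ck_on k S (deriv f)"
proof -
  have "(deriv ^^ Suc j) f = (deriv ^^ j) (deriv f)" for j by (simp add: funpow_swap1)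
  moreover have "(\<forall>j\<le>Suc k. P j) \<longleftrightarrow> P 0 \<and> (\<forall>j\<le>k. P (Suc j))" for P
    using All_less_Suc2[of "Suc k" P] by (simp add: less_Suc_eq_le)
  ultimately show ?thesis unfolding Ck_on_def by simp
qed

lemma Ck_on_differentiable: "Ck_on k S f \<Longrightarrow> t \<in> S \<Longrightarrow> f differentiable (at t)"
  unfolding Ck_on_def by (metis funpow_0 le0)

lemma Ck_on_mono: "Ck_on k S f \<Longrightarrow> j \<le> k \<Longrightarrow> Ck_on j S f"
  unfolding Ck_on_def by simp

lemma real_has_deriv: "f differentiable (at t) \<Longrightarrow> (f has_field_derivative deriv f t) (at t)"
  for f :: "real \<Rightarrow> real"
  using DERIV_deriv_iff_real_differentiable by blast

text \<open>\<open>deriv\<close> depends only on the values near a point, and openness keeps a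
  neighbourhood inside \<open>S\<close>. The rules of calculus yield a derivative on
  \<open>S\<close> only, whereas iterated \<open>deriv\<close> is formed from the total function;
  this lemma bridges the two.\<close>

lemma Ck_on_cong:
  assumes "open S" and "Ck_on k S f" and "\<And>t. t \<in> S \<Longrightarrow> f t = g t"
  shows "Ck_on k S g"
  using assms(2,3)
proof (induction k arbitrary: f g)
  case (Suc k)
  have D: "(g has_field_derivative deriv f t) (at t)" if t: "t \<in> S" for t
    by (rule has_field_derivative_transform_within_open[OF _ assms(1) t Suc.prems(2)])
      (rule real_has_deriv[OF Ck_on_differentiable[OF Suc.prems(1) t]])
  then have "deriv g t = deriv f t" if "t \<in> S" for t using that by (blast intro: DERIV_imp_deriv)
  then have "Ck_on k S (deriv g)" using Suc.IH[of "deriv f" "deriv g"] Suc.prems(1) by (simp add: Ck_on_Suc)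
  then show ?case using D by (auto simp: Ck_on_Suc real_differentiable_def)
next
  case 0
  show ?case unfolding Ck_on_0
  proof
    fix t assume t: "t \<in> S"
    have "(g has_field_derivative deriv f t) (at t)"
      by (rule has_field_derivative_transform_within_open[OF _ assms(1) t 0(2)])
        (rule real_has_deriv[OF Ck_on_differentiable[OF 0(1) t]])
    then show "g differentiable (at t)" by (auto simp: real_differentiable_def)
  qed
qed

lemma Ck_on_SucI:
  assumes "open S" and "\<And>t. t \<in> S \<Longrightarrow> (f has_field_derivative f' t) (at t)" and "Ck_on k S f'"
  shows "Ck_on (Suc k) S f"
proof -
  have "Ck_on k S (deriv f)"
    by (rule Ck_on_cong[OF assms(1,3)]) (use assms(2) in \<open>blast intro: DERIV_imp_deriv[symmetric]\<close>)
  then show ?thesis using assms(2) by (auto simp: Ck_on_Suc real_differentiable_def)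
qed

lemma Ck_on_const: "Ck_on k S (\<lambda>t. c)"
proof (induction k arbitrary: c)
  case (Suc k)
  have "deriv (\<lambda>t::real. c) = (\<lambda>t. 0)" by auto
  then show ?case using Suc by (simp add: Ck_on_Suc)
qed (simp add: Ck_on_0)

lemma Ck_on_add:
  assumes "open S" "Ck_on k S f" "Ck_on k S g"
  shows "Ck_on k S (\<lambda>t. f t + g t)"
  using assms(2,3)
proof (induction k arbitrary: f g)
  case (Suc k)
  show ?case
  proof (rule Ck_on_SucI[OF assms(1)])
    show "((\<lambda>t. f t + g t) has_field_derivative deriv f t + deriv g t) (at t)" if "t \<in> S" for t
      using Suc.prems that by (intro DERIV_add real_has_deriv) (auto intro: Ck_on_differentiable)
    show "Ck_on k S (\<lambda>t. deriv f t + deriv g t)" using Suc by (simp add: Ck_on_Suc)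
  qed
qed (simp add: Ck_on_0)

lemma Ck_on_mult:
  assumes "open S" "Ck_on k S f" "Ck_on k S g"
  shows "Ck_on k S (\<lambda>t. f t * g t)"
  using assms(2,3)
proof (induction k arbitrary: f g)
  case (Suc k)
  show ?case
  proof (rule Ck_on_SucI[OF assms(1)])
    show "((\<lambda>t. f t * g t) has_field_derivative deriv f t * g t + deriv g t * f t) (at t)" if "t \<in> S" for t
      using Suc.prems that by (intro DERIV_mult real_has_deriv) (auto intro: Ck_on_differentiable)
    have "Ck_on k S f" "Ck_on k S g" using Suc.prems by (auto intro: Ck_on_mono)
    then show "Ck_on k S (\<lambda>t. deriv f t * g t + deriv g t * f t)"
      using Suc by (intro Ck_on_add[OF assms(1)]) (auto simp: Ck_on_Suc)
  qed
qed (simp add: Ck_on_0)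

text \<open>The derivative of 1/f is -f' (1/f)^2, in which 1/f reappears one order lower, where the
  induction hypothesis covers it.\<close>

lemma Ck_on_inverse:
  assumes "open S" "Ck_on k S f" and nz: "\<And>t. t \<in> S \<Longrightarrow> f t \<noteq> 0"
  shows "Ck_on k S (\<lambda>t. inverse (f t))"
  using assms(2)
proof (induction k)
  case (Suc k)
  show ?case
  proof (rule Ck_on_SucI[OF assms(1)])
    show "((\<lambda>t. inverse (f t)) has_field_derivative (-1) * (deriv f t * (inverse (f t) * inverse (f t)))) (at t)"
      if "t \<in> S" for t
      using DERIV_inverse'[OF real_has_deriv[OF Ck_on_differentiable[OF Suc.prems that]] nz[OF that]]
      by (simp add: mult.commute mult.left_commute)
    have "Ck_on k S f" using Suc.prems by (auto intro: Ck_on_mono)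
    from Suc.IH[OF this] Suc.prems
    show "Ck_on k S (\<lambda>t. (-1) * (deriv f t * (inverse (f t) * inverse (f t))))"
      by (intro Ck_on_mult[OF assms(1)] Ck_on_const) (auto simp: Ck_on_Suc)
  qed
qed (use nz in \<open>auto simp: Ck_on_0\<close>)

definition smooth_on :: "real set \<Rightarrow> (real \<Rightarrow> real) \<Rightarrow> bool" where
  "smooth_on S f \<longleftrightarrow> (\<forall>k. Ck_on k S f)"

lemma smooth_on_iff: "smooth_on S f \<longleftrightarrow> (\<forall>k. \<forall>t\<in>S. (deriv ^^ k) f differentiable (at t))"
  unfolding smooth_on_def Ck_on_def by blast

lemma smooth_on_const: "smooth_on S (\<lambda>t. c)"
  by (simp add: smooth_on_def Ck_on_const)

lemma smooth_on_cong:
  "open S \<Longrightarrow> smooth_on S f \<Longrightarrow> (\<And>t. t \<in> S \<Longrightarrow> f t = g t) \<Longrightarrow> smooth_on S g"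
  unfolding smooth_on_def using Ck_on_cong by blast

lemma smooth_on_add:
  "open S \<Longrightarrow> smooth_on S f \<Longrightarrow> smooth_on S g \<Longrightarrow> smooth_on S (\<lambda>t. f t + g t)"
  by (simp add: smooth_on_def Ck_on_add)

lemma smooth_on_mult:
  "open S \<Longrightarrow> smooth_on S f \<Longrightarrow> smooth_on S g \<Longrightarrow> smooth_on S (\<lambda>t. f t * g t)"
  by (simp add: smooth_on_def Ck_on_mult)

lemma smooth_on_uminus: "open S \<Longrightarrow> smooth_on S f \<Longrightarrow> smooth_on S (\<lambda>t. - f t)"
  using smooth_on_mult[OF _ smooth_on_const, of S f "-1"] by simp

lemma smooth_on_diff:
  "open S \<Longrightarrow> smooth_on S f \<Longrightarrow> smooth_on S g \<Longrightarrow> smooth_on S (\<lambda>t. f t - g t)"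
  using smooth_on_add[OF _ _ smooth_on_uminus, of S f g] by simp

lemma smooth_on_divide:
  "open S \<Longrightarrow> smooth_on S f \<Longrightarrow> smooth_on S g \<Longrightarrow> (\<And>t. t \<in> S \<Longrightarrow> g t \<noteq> 0) \<Longrightarrow>
    smooth_on S (\<lambda>t. f t / g t)"
  unfolding divide_inverse
  by (intro smooth_on_mult) (auto simp: smooth_on_def intro: Ck_on_inverse)

lemma smooth_on_sum:
  assumes "open S" and "\<And>i. i \<in> I \<Longrightarrow> smooth_on S (f i)"
  shows "smooth_on S (\<lambda>t. \<Sum>i\<in>I. f i t)"
  using assms(2)
  by (induction I rule: infinite_finite_induct)
    (auto intro: smooth_on_const smooth_on_add[OF assms(1)])

lemma smooth_on_prod:
  assumes "open S" and "\<And>i. i \<in> I \<Longrightarrow> smooth_on S (f i)"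
  shows "smooth_on S (\<lambda>t. \<Prod>i\<in>I. f i t)"
  using assms(2)
  by (induction I rule: infinite_finite_induct)
    (auto intro: smooth_on_const smooth_on_mult[OF assms(1)])

lemma smooth_on_differentiable: "smooth_on S f \<Longrightarrow> t \<in> S \<Longrightarrow> f differentiable (at t)"
  unfolding smooth_on_def using Ck_on_differentiable by blast

lemma smooth_on_has_deriv:
  "smooth_on S f \<Longrightarrow> t \<in> S \<Longrightarrow> (f has_field_derivative deriv f t) (at t)"
  by (intro real_has_deriv smooth_on_differentiable)

lemma smooth_on_deriv: "smooth_on S f \<Longrightarrow> smooth_on S (deriv f)"
  unfolding smooth_on_def by (metis Ck_on_Suc)

section \<open>Smooth matrix functions\<close>

definition smooth_mat_on :: "real set \<Rightarrow> nat \<Rightarrow> nat \<Rightarrow> (real \<Rightarrow> real mat) \<Rightarrow> bool" where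
  "smooth_mat_on S nr nc F \<longleftrightarrow> (\<forall>t\<in>S. F t \<in> carrier_mat nr nc) \<and>
     (\<forall>i j. i < nr \<longrightarrow> j < nc \<longrightarrow> smooth_on S (\<lambda>t. F t $$ (i,j)))"

lemma smooth_matfun_iff: "smooth_matfun nr nc F \<longleftrightarrow> smooth_mat_on UNIV nr nc F"
  unfolding smooth_matfun_def smooth_mat_on_def smooth_on_iff by blast

lemma smooth_mat_on_carrier: "smooth_mat_on S nr nc F \<Longrightarrow> t \<in> S \<Longrightarrow> F t \<in> carrier_mat nr nc"
  by (simp add: smooth_mat_on_def)

lemma smooth_mat_on_entry:
  "smooth_mat_on S nr nc F \<Longrightarrow> i < nr \<Longrightarrow> j < nc \<Longrightarrow> smooth_on S (\<lambda>t. F t $$ (i,j))"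
  by (simp add: smooth_mat_on_def)

lemma smooth_mat_onI:
  assumes "open S" and "\<And>t. t \<in> S \<Longrightarrow> F t \<in> carrier_mat nr nc"
    and "\<And>i j. i < nr \<Longrightarrow> j < nc \<Longrightarrow> smooth_on S (f i j)"
    and "\<And>i j t. i < nr \<Longrightarrow> j < nc \<Longrightarrow> t \<in> S \<Longrightarrow> F t $$ (i,j) = f i j t"
  shows "smooth_mat_on S nr nc F"
  unfolding smooth_mat_on_def
  using assms by (auto intro: smooth_on_cong[OF assms(1) assms(3)])

lemma smooth_mat_on_cong:
  assumes "open S" "smooth_mat_on S nr nc F" "\<And>t. t \<in> S \<Longrightarrow> F t = G t"
  shows "smooth_mat_on S nr nc G"
  by (rule smooth_mat_onI[OF assms(1), of _ _ _ "\<lambda>i j t. F t $$ (i,j)"])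
    (use assms in \<open>auto simp: smooth_mat_on_def\<close>)

lemma smooth_mat_on_subset: "smooth_mat_on S nr nc F \<Longrightarrow> T \<subseteq> S \<Longrightarrow> smooth_mat_on T nr nc F"
  unfolding smooth_mat_on_def smooth_on_iff by blast

text \<open>Derivatives are those of the total function \<open>at t\<close>, not within
  \<open>S\<close>, so a covering by arbitrary sets suffices and nothing has to be glued.\<close>

lemma smooth_mat_on_UNIV_local:
  assumes "\<And>t. \<exists>S. t \<in> S \<and> smooth_mat_on S nr nc F"
  shows "smooth_mat_on UNIV nr nc F"
  using assms unfolding smooth_mat_on_def smooth_on_iff by blast

lemma smooth_mat_on_const: "M \<in> carrier_mat nr nc \<Longrightarrow> smooth_mat_on S nr nc (\<lambda>t. M)"
  by (simp add: smooth_mat_on_def smooth_on_const)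

lemma smooth_mat_on_mult:
  assumes S: "open S" and F: "smooth_mat_on S a b F" and G: "smooth_mat_on S b c G"
  shows "smooth_mat_on S a c (\<lambda>t. F t * G t)"
proof (rule smooth_mat_onI[OF S, of _ _ _ "\<lambda>i j t. \<Sum>k<b. F t $$ (i,k) * G t $$ (k,j)"])
  fix t assume t: "t \<in> S"
  note c = smooth_mat_on_carrier[OF F t] smooth_mat_on_carrier[OF G t]
  show "F t * G t \<in> carrier_mat a c" using c by simp
  show "(F t * G t) $$ (i,j) = (\<Sum>k<b. F t $$ (i,k) * G t $$ (k,j))" if "i < a" "j < c" for i j
    using c that by (simp add: scalar_prod_def lessThan_atLeast0)
next
  fix i j assume ij: "i < a" "j < c"
  show "smooth_on S (\<lambda>t. \<Sum>k<b. F t $$ (i,k) * G t $$ (k,j))"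
  proof (rule smooth_on_sum[OF S])
    fix k assume "k \<in> {..<b}"
    then have k: "k < b" by simp
    show "smooth_on S (\<lambda>t. F t $$ (i,k) * G t $$ (k,j))"
      by (rule smooth_on_mult[OF S smooth_mat_on_entry[OF F ij(1) k] smooth_mat_on_entry[OF G k ij(2)]])
  qed
qed

lemma smooth_mat_on_add:
  assumes S: "open S" and F: "smooth_mat_on S a b F" and G: "smooth_mat_on S a b G"
  shows "smooth_mat_on S a b (\<lambda>t. F t + G t)"
proof (rule smooth_mat_onI[OF S, of _ _ _ "\<lambda>i j t. F t $$ (i,j) + G t $$ (i,j)"])
  fix t assume t: "t \<in> S"
  note c = smooth_mat_on_carrier[OF F t] smooth_mat_on_carrier[OF G t]
  show "F t + G t \<in> carrier_mat a b" using c by (intro add_carrier_mat)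
  show "(F t + G t) $$ (i,j) = F t $$ (i,j) + G t $$ (i,j)" if "i < a" "j < b" for i j
    using c that by auto
qed (intro smooth_on_add S smooth_mat_on_entry[OF F] smooth_mat_on_entry[OF G])

lemma smooth_mat_on_diff:
  assumes S: "open S" and F: "smooth_mat_on S a b F" and G: "smooth_mat_on S a b G"
  shows "smooth_mat_on S a b (\<lambda>t. F t - G t)"
proof (rule smooth_mat_onI[OF S, of _ _ _ "\<lambda>i j t. F t $$ (i,j) - G t $$ (i,j)"])
  fix t assume t: "t \<in> S"
  note c = smooth_mat_on_carrier[OF F t] smooth_mat_on_carrier[OF G t]
  show "F t - G t \<in> carrier_mat a b" using c by (intro minus_carrier_mat)
  show "(F t - G t) $$ (i,j) = F t $$ (i,j) - G t $$ (i,j)" if "i < a" "j < b" for i j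
    using c that by auto
qed (intro smooth_on_diff S smooth_mat_on_entry[OF F] smooth_mat_on_entry[OF G])

lemma smooth_mat_on_transpose:
  assumes S: "open S" and F: "smooth_mat_on S a b F"
  shows "smooth_mat_on S b a (\<lambda>t. (F t)\<^sup>T)"
proof (rule smooth_mat_onI[OF S, of _ _ _ "\<lambda>i j t. F t $$ (j,i)"])
  fix t assume t: "t \<in> S"
  note c = smooth_mat_on_carrier[OF F t]
  show "(F t)\<^sup>T \<in> carrier_mat b a" using c by simp
  show "(F t)\<^sup>T $$ (i,j) = F t $$ (j,i)" if "i < b" "j < a" for i j
    using c that by simp
qed (intro smooth_mat_on_entry[OF F])

lemma smooth_mat_on_deriv:
  assumes S: "open S" and F: "smooth_mat_on S a b F"
  shows "smooth_mat_on S a b (mat_deriv F)"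
proof (rule smooth_mat_onI[OF S, of _ _ _ "\<lambda>i j. deriv (\<lambda>t. F t $$ (i,j))"])
  fix t assume t: "t \<in> S"
  note c = smooth_mat_on_carrier[OF F t]
  show "mat_deriv F t \<in> carrier_mat a b" using c by (simp add: mat_deriv_def)
  show "mat_deriv F t $$ (i,j) = deriv (\<lambda>t. F t $$ (i,j)) t" if "i < a" "j < b" for i j
    using c that by (simp add: mat_deriv_def)
qed (intro smooth_on_deriv smooth_mat_on_entry[OF F])

lemma smooth_on_det:
  assumes S: "open S" and F: "smooth_mat_on S n n F"
  shows "smooth_on S (\<lambda>t. det (F t))"
proof (rule smooth_on_cong[OF S])
  show "smooth_on S (\<lambda>t. \<Sum>\<pi>\<in>{\<pi>. \<pi> permutes {0..<n}}. signof \<pi> * (\<Prod>i = 0..<n. F t $$ (i, \<pi> i)))"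
    by (intro smooth_on_sum smooth_on_mult smooth_on_prod smooth_on_const S smooth_mat_on_entry[OF F])
      (auto simp: permutes_in_image[of _ "{0..<n}", simplified])
  show "(\<Sum>\<pi>\<in>{\<pi>. \<pi> permutes {0..<n}}. signof \<pi> * (\<Prod>i = 0..<n. F t $$ (i, \<pi> i))) = det (F t)"
    if "t \<in> S" for t
    using smooth_mat_on_carrier[OF F that] by (simp add: det_def)
qed

lemma smooth_mat_on_delete:
  assumes S: "open S" and F: "smooth_mat_on S n n F" and ij: "i < n" "j < n"
  shows "smooth_mat_on S (n - 1) (n - 1) (\<lambda>t. mat_delete (F t) i j)"
proof (rule smooth_mat_onI[OF S, of _ _ _ "\<lambda>i' j' t. F t $$ (if i' < i then i' else Suc i', if j' < j then j' else Suc j')"])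
  fix t assume t: "t \<in> S"
  note c = smooth_mat_on_carrier[OF F t]
  show "mat_delete (F t) i j \<in> carrier_mat (n - 1) (n - 1)" using c by (simp add: mat_delete_def)
  show "mat_delete (F t) i j $$ (i',j') = F t $$ (if i' < i then i' else Suc i', if j' < j then j' else Suc j')" if "i' < n - 1" "j' < n - 1" for i' j'
    using c that by (simp add: mat_delete_def)
qed (rule smooth_mat_on_entry[OF F]; auto)

lemma smooth_mat_on_minv:
  assumes S: "open S" and F: "smooth_mat_on S n n F" and d: "\<And>t. t \<in> S \<Longrightarrow> det (F t) \<noteq> 0"
  shows "smooth_mat_on S n n (\<lambda>t. minv (F t))"
proof (rule smooth_mat_onI[OF S, of _ _ _ "\<lambda>i j t. 1 / det (F t) * ((-1) ^ (j + i) * det (mat_delete (F t) j i))"])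
  fix t assume t: "t \<in> S"
  note c = smooth_mat_on_carrier[OF F t]
  show "minv (F t) \<in> carrier_mat n n" using minv_props(1)[OF c d[OF t]] .
  show "minv (F t) $$ (i,j) = 1 / det (F t) * ((-1) ^ (j + i) * det (mat_delete (F t) j i))"
    if "i < n" "j < n" for i j
    using c that unfolding minv_conv_adj[OF c d[OF t]] by (simp add: adj_mat_def cofactor_def)
next
  fix i j assume "i < n" "j < n"
  then show "smooth_on S (\<lambda>t. 1 / det (F t) * ((-1) ^ (j + i) * det (mat_delete (F t) j i)))"
    by (intro smooth_on_mult smooth_on_divide smooth_on_const S smooth_on_det[OF S F]
        smooth_on_det[OF S smooth_mat_on_delete[OF S F]] d)
qed

lemma mat_deriv_carrier: "F t \<in> carrier_mat a b \<Longrightarrow> mat_deriv F t \<in> carrier_mat a b"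
  by (auto simp: mat_deriv_def)

lemma mat_deriv_entry:
  "F t \<in> carrier_mat a b \<Longrightarrow> i < a \<Longrightarrow> j < b \<Longrightarrow> mat_deriv F t $$ (i,j) = deriv (\<lambda>s. F s $$ (i,j)) t"
  by (auto simp: mat_deriv_def)

lemma mat_deriv_const: "mat_deriv (\<lambda>s. M) t = 0\<^sub>m (dim_row M) (dim_col M)"
  by (rule eq_matI) (auto simp: mat_deriv_def)

lemma mat_deriv_mult:
  assumes F: "smooth_mat_on UNIV a b F" and G: "smooth_mat_on UNIV b c G"
  shows "mat_deriv (\<lambda>s. F s * G s) t = mat_deriv F t * G t + F t * mat_deriv G t"
proof (rule eq_matI)
  note cF = smooth_mat_on_carrier[OF F UNIV_I] and cG = smooth_mat_on_carrier[OF G UNIV_I]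
  note D = carrier_matD[OF cF] carrier_matD[OF cG] carrier_matD[OF mat_deriv_carrier[OF cF]]
    carrier_matD[OF mat_deriv_carrier[OF cG]]
  show "dim_row (mat_deriv (\<lambda>s. F s * G s) t) = dim_row (mat_deriv F t * G t + F t * mat_deriv G t)"
    "dim_col (mat_deriv (\<lambda>s. F s * G s) t) = dim_col (mat_deriv F t * G t + F t * mat_deriv G t)"
    using D by (simp_all add: mat_deriv_def)
  fix i j assume "i < dim_row (mat_deriv F t * G t + F t * mat_deriv G t)"
    "j < dim_col (mat_deriv F t * G t + F t * mat_deriv G t)"
  then have ij: "i < a" "j < c" using D by auto
  have "(\<lambda>s. (F s * G s) $$ (i,j)) = (\<lambda>s. \<Sum>k=0..<b. F s $$ (i,k) * G s $$ (k,j))"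
    using D ij by (auto simp: scalar_prod_def)
  moreover have "((\<lambda>s. \<Sum>k=0..<b. F s $$ (i,k) * G s $$ (k,j)) has_field_derivative
      (\<Sum>k=0..<b. deriv (\<lambda>s. F s $$ (i,k)) t * G t $$ (k,j) + deriv (\<lambda>s. G s $$ (k,j)) t * F t $$ (i,k))) (at t)"
    using ij by (intro DERIV_sum DERIV_mult smooth_on_has_deriv[of UNIV])
      (auto intro: smooth_mat_on_entry[OF F] smooth_mat_on_entry[OF G])
  ultimately have "deriv (\<lambda>s. (F s * G s) $$ (i,j)) t =
      (\<Sum>k=0..<b. deriv (\<lambda>s. F s $$ (i,k)) t * G t $$ (k,j) + deriv (\<lambda>s. G s $$ (k,j)) t * F t $$ (i,k))"
    by (simp add: DERIV_imp_deriv)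
  moreover have "F t * G t \<in> carrier_mat a c" by (rule mult_carrier_mat[OF cF cG])
  ultimately show "mat_deriv (\<lambda>s. F s * G s) t $$ (i,j) = (mat_deriv F t * G t + F t * mat_deriv G t) $$ (i,j)"
    using D ij by (simp add: mat_deriv_entry[of "\<lambda>s. F s * G s" t a c] scalar_prod_def sum.distrib
        mat_deriv_entry[OF cF] mat_deriv_entry[OF cG] mult.commute)
qed

section \<open>Pseudoinverses of constant rank, bounded matrix functions\<close>

text \<open>The rank factorization at \<open>t0\<close> is used only for its fixed matrices
  \<open>H\<close> and \<open>J\<close>: H M(t) J is the identity at \<open>t0\<close>, stays
  invertible nearby, and there supplies factors of M(t) that are smooth in t.\<close>

lemma smooth_mat_on_pinv:
  assumes M: "smooth_mat_on UNIV n m M" and r: "\<And>t. mrank (M t) = q"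
  shows "smooth_mat_on UNIV m n (\<lambda>t. pinv (M t))"
proof (rule smooth_mat_on_UNIV_local)
  fix t0
  note cM = smooth_mat_on_carrier[OF M UNIV_I]
  obtain F0 G0 H J where f0: "full_rank_factors (M t0) n m q F0 G0 H J"
    using mrank_full_rank_factors[OF cM] r by metis
  then have F0: "F0 \<in> carrier_mat n q" and G0: "G0 \<in> carrier_mat q m" and H: "H \<in> carrier_mat q n"
    and J: "J \<in> carrier_mat m q" and M0: "M t0 = F0 * G0" and HF: "H * F0 = 1\<^sub>m q" and GJ: "G0 * J = 1\<^sub>m q"
    by (auto simp: full_rank_factors_def)
  define D where "D = (\<lambda>t. H * M t * J)"
  have sD: "smooth_mat_on UNIV q q D" unfolding D_def
    by (rule smooth_mat_on_mult[OF open_UNIV smooth_mat_on_mult[OF open_UNIV smooth_mat_on_const[OF H] M]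
        smooth_mat_on_const[OF J]])
  define S where "S = {t. det (D t) \<noteq> 0}"
  have "continuous_on UNIV (\<lambda>t. det (D t))"
    using smooth_on_differentiable[OF smooth_on_det[OF open_UNIV sD] UNIV_I]
    by (auto simp: continuous_on_eq_continuous_at intro: differentiable_imp_continuous_within)
  then have S: "open S" unfolding S_def
    by (intro open_Collect_neq continuous_on_const)
  have "D t0 = 1\<^sub>m q"
    using F0 G0 H J by (simp add: D_def M0 mat_assoc mat_cancel_left[OF HF] GJ)
  then have t0: "t0 \<in> S" by (simp add: S_def)
  have mS: "smooth_mat_on S n m M" and dS: "smooth_mat_on S q q D"
    using M sD by (auto intro: smooth_mat_on_subset)
  note mult = smooth_mat_on_mult[OF S]
  define T where "T = (\<lambda>t. minv (D t) * H)"
  define F where "F = (\<lambda>t. M t * J)"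
  define G where "G = (\<lambda>t. T t * M t)"
  have sT: "smooth_mat_on S q n T" unfolding T_def
    by (rule mult[OF smooth_mat_on_minv[OF S dS] smooth_mat_on_const[OF H]]) (simp add: S_def)
  have sF: "smooth_mat_on S n q F" unfolding F_def
    by (rule mult[OF mS smooth_mat_on_const[OF J]])
  have sG: "smooth_mat_on S q m G" unfolding G_def by (rule mult[OF sT mS])
  have fac: "full_rank_factors (M t) n m q (F t) (G t) (T t) J" if t: "t \<in> S" for t
  proof -
    have "D t \<in> carrier_mat q q" "det (D t) \<noteq> 0" using sD t by (auto simp: S_def smooth_mat_on_def)
    note mD = minv_props[OF this]
    note T = smooth_mat_on_carrier[OF sT t]
    have TMJ: "T t * M t * J = 1\<^sub>m q"
      using mD(3) carrier_matD[OF mD(1)] carrier_matD[OF H] carrier_matD[OF J] carrier_matD[OF cM]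
      by (simp add: T_def D_def mat_assoc)
    \<comment> \<open>Constancy of the rank enters here. Invertibility of \<open>D t\<close> alone
      bounds the rank from below by \<open>q\<close>; the factorization needs it to be exactly
      \<open>q\<close>.\<close>
    have "M t = F t * G t"
      unfolding F_def G_def by (rule mrank_factor_through[OF cM r T J TMJ])
    moreover have "T t * F t = 1\<^sub>m q"
      using TMJ carrier_matD[OF T] carrier_matD[OF J] carrier_matD[OF cM] by (simp add: F_def mat_assoc)
    ultimately show ?thesis
      using TMJ J T smooth_mat_on_carrier[OF sF t] smooth_mat_on_carrier[OF sG t]
      unfolding full_rank_factors_def G_def by blast
  qed
  note tF = smooth_mat_on_transpose[OF S sF] and tG = smooth_mat_on_transpose[OF S sG]
  have "smooth_mat_on S m n (\<lambda>t. (G t)\<^sup>T * minv (G t * (G t)\<^sup>T) * (minv ((F t)\<^sup>T * F t) * (F t)\<^sup>T))"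
    by (intro mult[OF mult[OF tG smooth_mat_on_minv[OF S mult[OF sG tG]]]
          mult[OF smooth_mat_on_minv[OF S mult[OF tF sF]] tF]] full_rank_factors_det[OF fac])
  then have "smooth_mat_on S m n (\<lambda>t. pinv (M t))"
    by (rule smooth_mat_on_cong[OF S]) (simp add: pinv_full_rank_factors(1)[OF fac])
  then show "\<exists>S. t0 \<in> S \<and> smooth_mat_on S m n (\<lambda>t. pinv (M t))" using t0 by blast
qed

section \<open>Bounded matrix functions\<close>

lemma bounded_matfunE:
  assumes "bounded_matfun F" and "\<And>t. F t \<in> carrier_mat a b"
  obtains c where "c \<ge> 0" "\<And>t i j. i < a \<Longrightarrow> j < b \<Longrightarrow> \<bar>F t $$ (i,j)\<bar> \<le> c"
proof -
  obtain c where c: "\<And>t i j. i < dim_row (F t) \<Longrightarrow> j < dim_col (F t) \<Longrightarrow> \<bar>F t $$ (i,j)\<bar> \<le> c"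
    using assms(1) unfolding bounded_matfun_def by blast
  \<comment> \<open>For empty matrices the given bound may be negative; the absolute value makes it
    usable in products of bounds.\<close>
  have "\<bar>F t $$ (i,j)\<bar> \<le> \<bar>c\<bar>" if "i < a" "j < b" for t i j
    using c[of i t j] assms(2)[of t] that by auto
  then show thesis using that[of "\<bar>c\<bar>"] by auto
qed

lemma bounded_matfunI:
  "(\<And>t. F t \<in> carrier_mat a b) \<Longrightarrow> (\<And>t i j. i < a \<Longrightarrow> j < b \<Longrightarrow> \<bar>F t $$ (i,j)\<bar> \<le> c) \<Longrightarrow> bounded_matfun F"
  unfolding bounded_matfun_def by (metis carrier_matD)

lemma bounded_matfun_const: "bounded_matfun (\<lambda>t. M)"
proof -
  have "\<bar>M $$ (i,j)\<bar> \<le> (\<Sum>i<dim_row M. \<Sum>j<dim_col M. \<bar>M $$ (i,j)\<bar>)"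
    if "i < dim_row M" "j < dim_col M" for i j
  proof -
    have "\<bar>M $$ (i,j)\<bar> \<le> (\<Sum>j<dim_col M. \<bar>M $$ (i,j)\<bar>)"
      by (rule member_le_sum[of j _ "\<lambda>j. \<bar>M $$ (i,j)\<bar>"]) (use that in auto)
    also have "\<dots> \<le> (\<Sum>i<dim_row M. \<Sum>j<dim_col M. \<bar>M $$ (i,j)\<bar>)"
      by (rule member_le_sum[of i _ "\<lambda>i. \<Sum>j<dim_col M. \<bar>M $$ (i,j)\<bar>"]) (use that in \<open>auto intro: sum_nonneg\<close>)
    finally show ?thesis .
  qed
  then show ?thesis unfolding bounded_matfun_def by blast
qed

lemma bounded_matfun_mult:
  assumes F: "bounded_matfun F" and cF: "\<And>t. F t \<in> carrier_mat a b"
    and G: "bounded_matfun G" and cG: "\<And>t. G t \<in> carrier_mat b c"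
  shows "bounded_matfun (\<lambda>t. F t * G t)"
proof -
  obtain x where x: "x \<ge> 0" "\<And>t i j. i < a \<Longrightarrow> j < b \<Longrightarrow> \<bar>F t $$ (i,j)\<bar> \<le> x"
    using bounded_matfunE[OF F cF] by blast
  obtain y where y: "y \<ge> 0" "\<And>t i j. i < b \<Longrightarrow> j < c \<Longrightarrow> \<bar>G t $$ (i,j)\<bar> \<le> y"
    using bounded_matfunE[OF G cG] by blast
  show ?thesis
  proof (rule bounded_matfunI)
    show "F t * G t \<in> carrier_mat a c" for t using cF cG by (rule mult_carrier_mat)
    fix t i j assume ij: "i < a" "j < c"
    have "\<bar>(F t * G t) $$ (i,j)\<bar> = \<bar>\<Sum>k=0..<b. F t $$ (i,k) * G t $$ (k,j)\<bar>"
      using carrier_matD[OF cF[of t]] carrier_matD[OF cG[of t]] ij by (simp add: scalar_prod_def)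
    also have "\<dots> \<le> (\<Sum>k=0..<b. x * y)"
      by (rule order_trans[OF sum_abs sum_mono]) (use x y ij in \<open>auto simp: abs_mult intro!: mult_mono\<close>)
    finally show "\<bar>(F t * G t) $$ (i,j)\<bar> \<le> b * (x * y)" by simp
  qed
qed

lemma bounded_matfun_add:
  assumes F: "bounded_matfun F" and cF: "\<And>t. F t \<in> carrier_mat a b"
    and G: "bounded_matfun G" and cG: "\<And>t. G t \<in> carrier_mat a b"
  shows "bounded_matfun (\<lambda>t. F t + G t)"
proof -
  obtain x where x: "x \<ge> 0" "\<And>t i j. i < a \<Longrightarrow> j < b \<Longrightarrow> \<bar>F t $$ (i,j)\<bar> \<le> x"
    using bounded_matfunE[OF F cF] by blast
  obtain y where y: "y \<ge> 0" "\<And>t i j. i < a \<Longrightarrow> j < b \<Longrightarrow> \<bar>G t $$ (i,j)\<bar> \<le> y"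
    using bounded_matfunE[OF G cG] by blast
  show ?thesis
  proof (rule bounded_matfunI)
    show "F t + G t \<in> carrier_mat a b" for t using cG by (rule add_carrier_mat)
    fix t i j assume ij: "i < a" "j < b"
    show "\<bar>(F t + G t) $$ (i,j)\<bar> \<le> x + y"
      using carrier_matD[OF cF[of t]] carrier_matD[OF cG[of t]] ij x(2)[OF ij, of t] y(2)[OF ij, of t] by auto
  qed
qed

lemma blk_carrier [simp]: "blk M r0 c0 nr nc \<in> carrier_mat nr nc"
  by (simp add: blk_def)

lemma blk_entry [simp]:
  "i < nr \<Longrightarrow> j < nc \<Longrightarrow> blk M r0 c0 nr nc $$ (i,j) = M $$ (r0 + i, c0 + j)"
  by (simp add: blk_def)

lemma blk_dim [simp]: "dim_row (blk M r0 c0 nr nc) = nr" "dim_col (blk M r0 c0 nr nc) = nc"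
  by (simp_all add: blk_def)

lemma smooth_matfun_blk:
  assumes F: "smooth_mat_on UNIV a b F" and le: "r0 + nr \<le> a" "c0 + nc \<le> b"
  shows "smooth_matfun nr nc (\<lambda>t. blk (F t) r0 c0 nr nc)"
  unfolding smooth_matfun_iff
proof (rule smooth_mat_onI[OF open_UNIV, of _ _ _ "\<lambda>i j t. F t $$ (r0 + i, c0 + j)"])
  fix i j assume "i < nr" "j < nc"
  then show "smooth_on UNIV (\<lambda>t. F t $$ (r0 + i, c0 + j))"
    using le by (intro smooth_mat_on_entry[OF F]) auto
qed simp_all

lemma bounded_matfun_blk:
  assumes F: "bounded_matfun F" "\<And>t. F t \<in> carrier_mat a b" and le: "r0 + nr \<le> a" "c0 + nc \<le> b"
  shows "bounded_matfun (\<lambda>t. blk (F t) r0 c0 nr nc)"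
proof -
  obtain x where x: "x \<ge> 0" "\<And>t i j. i < a \<Longrightarrow> j < b \<Longrightarrow> \<bar>F t $$ (i,j)\<bar> \<le> x"
    using bounded_matfunE[OF F] by blast
  show ?thesis
  proof (rule bounded_matfunI)
    show "blk (F t) r0 c0 nr nc \<in> carrier_mat nr nc" for t by simp
    show "\<bar>blk (F t) r0 c0 nr nc $$ (i,j)\<bar> \<le> x" if "i < nr" "j < nc" for t i j
      using x(2)[of "r0 + i" "c0 + j" t] le that by simp
  qed
qed

lemma blk_mult:
  assumes "X \<in> carrier_mat a b" "Y \<in> carrier_mat b c" "r0 + nr \<le> a" "c0 + nc \<le> c"
  shows "blk (X * Y) r0 c0 nr nc = blk X r0 0 nr b * blk Y 0 c0 b nc"
  by (rule eq_matI) (use assms in \<open>auto simp: scalar_prod_def\<close>)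

section \<open>Continuity of vector fields\<close>

lemma vnorm_L2_set: "vnorm v = L2_set (\<lambda>i. v $ i) {..<dim_vec v}"
  by (simp add: vnorm_def L2_set_def scalar_prod_def power2_eq_square lessThan_atLeast0)

lemma vnorm_nonneg: "vnorm v \<ge> 0"
  by (simp add: vnorm_L2_set)

lemma entry_le_vnorm: "i < dim_vec v \<Longrightarrow> \<bar>v $ i\<bar> \<le> vnorm v"
proof -
  assume i: "i < dim_vec v"
  have "\<bar>v $ i\<bar> = L2_set (\<lambda>i. v $ i) {i}" by (simp add: L2_set_def)
  also have "\<dots> \<le> vnorm v" unfolding vnorm_L2_set L2_set_def
    using i by (intro real_sqrt_le_mono sum_mono2) auto
  finally show ?thesis .
qed

lemma vnorm_le_sum: "vnorm v \<le> (\<Sum>i<dim_vec v. \<bar>v $ i\<bar>)"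
  unfolding vnorm_L2_set by (rule L2_set_le_sum_abs)

text \<open>The norm lies between each |v_i| and the sum of all |v_i|, so norm convergence reduces
  to the entries. Membership in the carrier is required only eventually, because \<open>v\<close> is
  unconstrained away from the limit point.\<close>

lemma tendsto_vnorm_iff:
  assumes v: "eventually (\<lambda>z. v z \<in> carrier_vec k) Fl" and w: "w \<in> carrier_vec k"
  shows "((\<lambda>z. vnorm (v z - w)) \<longlongrightarrow> 0) Fl \<longleftrightarrow> (\<forall>i<k. ((\<lambda>z. v z $ i) \<longlongrightarrow> w $ i) Fl)"
proof (intro iffI allI impI)
  fix i assume l: "((\<lambda>z. vnorm (v z - w)) \<longlongrightarrow> 0) Fl" and i: "i < k"
  have "eventually (\<lambda>z. norm (v z $ i - w $ i) \<le> vnorm (v z - w)) Fl"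
    using v
  proof eventually_elim
    case (elim z)
    then show ?case using w i entry_le_vnorm[of i "v z - w"] by auto
  qed
  then have "((\<lambda>z. v z $ i - w $ i) \<longlongrightarrow> 0) Fl" by (rule Lim_null_comparison[OF _ l])
  then show "((\<lambda>z. v z $ i) \<longlongrightarrow> w $ i) Fl" by (rule LIM_zero_cancel)
next
  assume "\<forall>i<k. ((\<lambda>z. v z $ i) \<longlongrightarrow> w $ i) Fl"
  then have "((\<lambda>z. \<Sum>i<k. \<bar>v z $ i - w $ i\<bar>) \<longlongrightarrow> (\<Sum>i<k. \<bar>w $ i - w $ i\<bar>)) Fl"
    by (intro tendsto_sum tendsto_rabs tendsto_diff tendsto_const) auto
  then have l: "((\<lambda>z. \<Sum>i<k. \<bar>v z $ i - w $ i\<bar>) \<longlongrightarrow> 0) Fl" by simp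
  have "norm (vnorm (v z - w)) \<le> (\<Sum>i<k. \<bar>v z $ i - w $ i\<bar>)" if c: "v z \<in> carrier_vec k" for z
  proof -
    have d: "dim_vec (v z - w) = k" using w by auto
    have "vnorm (v z - w) \<le> (\<Sum>i<k. \<bar>(v z - w) $ i\<bar>)" using vnorm_le_sum[of "v z - w"] d by simp
    also have "\<dots> = (\<Sum>i<k. \<bar>v z $ i - w $ i\<bar>)" using w c by (intro sum.cong) auto
    finally show ?thesis using vnorm_nonneg by simp
  qed
  then have "eventually (\<lambda>z. norm (vnorm (v z - w)) \<le> (\<Sum>i<k. \<bar>v z $ i - w $ i\<bar>)) Fl"
    using v by (auto elim: eventually_mono)
  then show "((\<lambda>z. vnorm (v z - w)) \<longlongrightarrow> 0) Fl" by (rule Lim_null_comparison[OF _ l])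
qed

text \<open>The neighbourhood filter of (t, x, u) in R x R^n x R^m. The type \<open>real vec\<close>
  mixes all dimensions, so the carriers are built into the filter. It turns the epsilon-delta clause
  of \<open>cont_vecfun\<close> into limits of entries, to which the calculus of limits
  applies.\<close>

definition nhds_tzu :: "nat \<Rightarrow> nat \<Rightarrow> real \<Rightarrow> real vec \<Rightarrow> real vec \<Rightarrow> (real \<times> real vec \<times> real vec) filter" where
  "nhds_tzu n m t x u = (INF d\<in>{0<..}. principal {(t',x',u'). x' \<in> carrier_vec n \<and> u' \<in> carrier_vec m \<and>
      \<bar>t' - t\<bar> < d \<and> vnorm (x' - x) < d \<and> vnorm (u' - u) < d})"

lemma eventually_nhds_tzu:
  "eventually P (nhds_tzu n m t x u) \<longleftrightarrow> (\<exists>d>0. \<forall>t' x' u'. x' \<in> carrier_vec n \<longrightarrow> u' \<in> carrier_vec m \<longrightarrow>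
      \<bar>t' - t\<bar> < d \<longrightarrow> vnorm (x' - x) < d \<longrightarrow> vnorm (u' - u) < d \<longrightarrow> P (t',x',u'))"
  unfolding nhds_tzu_def
proof (subst eventually_INF_base)
  fix a b :: real assume "a \<in> {0<..}" "b \<in> {0<..}"
  then show "\<exists>d\<in>{0<..}. principal {(t',x',u'). x' \<in> carrier_vec n \<and> u' \<in> carrier_vec m \<and>
      \<bar>t' - t\<bar> < d \<and> vnorm (x' - x) < d \<and> vnorm (u' - u) < d}
      \<le> inf (principal {(t',x',u'). x' \<in> carrier_vec n \<and> u' \<in> carrier_vec m \<and>
      \<bar>t' - t\<bar> < a \<and> vnorm (x' - x) < a \<and> vnorm (u' - u) < a})
        (principal {(t',x',u'). x' \<in> carrier_vec n \<and> u' \<in> carrier_vec m \<and>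
      \<bar>t' - t\<bar> < b \<and> vnorm (x' - x) < b \<and> vnorm (u' - u) < b})"
    by (intro bexI[of _ "min a b"]) auto
qed (auto simp: eventually_principal)

lemma cont_vecfun_iff:
  "cont_vecfun n m k F \<longleftrightarrow>
     (\<forall>t x u. x \<in> carrier_vec n \<longrightarrow> u \<in> carrier_vec m \<longrightarrow> F t x u \<in> carrier_vec k) \<and>
     (\<forall>t x u. x \<in> carrier_vec n \<longrightarrow> u \<in> carrier_vec m \<longrightarrow>
        (\<forall>i<k. ((\<lambda>(t',x',u'). F t' x' u' $ i) \<longlongrightarrow> F t x u $ i) (nhds_tzu n m t x u)))"
proof -
  have "(\<forall>\<epsilon>>0. \<exists>\<delta>>0. \<forall>t' x' u'. x' \<in> carrier_vec n \<longrightarrow> u' \<in> carrier_vec m \<longrightarrow>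
            \<bar>t' - t\<bar> < \<delta> \<longrightarrow> vnorm (x' - x) < \<delta> \<longrightarrow> vnorm (u' - u) < \<delta> \<longrightarrow>
            vnorm (F t' x' u' - F t x u) < \<epsilon>) \<longleftrightarrow>
        (\<forall>i<k. ((\<lambda>(t',x',u'). F t' x' u' $ i) \<longlongrightarrow> F t x u $ i) (nhds_tzu n m t x u))" (is "?L \<longleftrightarrow> ?R")
    if F: "\<And>t x u. x \<in> carrier_vec n \<Longrightarrow> u \<in> carrier_vec m \<Longrightarrow> F t x u \<in> carrier_vec k"
      and x: "x \<in> carrier_vec n" and u: "u \<in> carrier_vec m" for t x u
  proof -
    let ?v = "\<lambda>(t',x',u'). F t' x' u'"
    have "eventually (\<lambda>z. ?v z \<in> carrier_vec k) (nhds_tzu n m t x u)"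
      unfolding eventually_nhds_tzu using F by (intro exI[of _ 1]) auto
    from tendsto_vnorm_iff[OF this F[OF x u]]
    have "?R \<longleftrightarrow> ((\<lambda>z. vnorm (?v z - F t x u)) \<longlongrightarrow> 0) (nhds_tzu n m t x u)"
      by (simp add: case_prod_unfold)
    also have "\<dots> \<longleftrightarrow> ?L"
      unfolding tendsto_iff eventually_nhds_tzu by (simp add: dist_real_def vnorm_nonneg)
    finally show ?thesis by simp
  qed
  then show ?thesis unfolding cont_vecfun_def by (intro conj_cong refl) blast
qed

lemma tendsto_nhds_tzu:
  assumes x: "x \<in> carrier_vec n" and u: "u \<in> carrier_vec m"
  shows "((\<lambda>(t',x',u'). t') \<longlongrightarrow> t) (nhds_tzu n m t x u)"
    and "i < n \<Longrightarrow> ((\<lambda>(t',x',u'). x' $ i) \<longlongrightarrow> x $ i) (nhds_tzu n m t x u)"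
proof -
  show "((\<lambda>(t',x',u'). t') \<longlongrightarrow> t) (nhds_tzu n m t x u)"
    unfolding tendsto_iff eventually_nhds_tzu by (auto simp: dist_real_def)
  have e: "eventually (\<lambda>z. (case z of (t',x',u') \<Rightarrow> x') \<in> carrier_vec n) (nhds_tzu n m t x u)"
    unfolding eventually_nhds_tzu by (intro exI[of _ 1]) auto
  have "((\<lambda>z. vnorm ((case z of (t',x',u') \<Rightarrow> x') - x)) \<longlongrightarrow> 0) (nhds_tzu n m t x u)"
    unfolding tendsto_iff eventually_nhds_tzu by (auto simp: dist_real_def vnorm_nonneg)
  with tendsto_vnorm_iff[OF e x]
  show "((\<lambda>(t',x',u'). x' $ i) \<longlongrightarrow> x $ i) (nhds_tzu n m t x u)" if "i < n"
    using that by (simp add: case_prod_unfold)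
qed

text \<open>Each entry is a finite sum of products of convergent factors. This expansion is valid
  only for vectors of the right dimension, hence only eventually.\<close>

lemma tendsto_mult_mat_vec:
  fixes v :: "'z \<Rightarrow> real vec" and M :: "real \<Rightarrow> real mat"
  assumes "\<And>t. M t \<in> carrier_mat a b" and "\<And>i j. i < a \<Longrightarrow> j < b \<Longrightarrow> continuous_on UNIV (\<lambda>t. M t $$ (i,j))"
    and \<tau>: "(\<tau> \<longlongrightarrow> t) Fl" and v: "\<And>j. j < b \<Longrightarrow> ((\<lambda>z. v z $ j) \<longlongrightarrow> w $ j) Fl"
    and c: "eventually (\<lambda>z. v z \<in> carrier_vec b) Fl" and w: "w \<in> carrier_vec b" and i: "i < a"
  shows "((\<lambda>z. (M (\<tau> z) *\<^sub>v v z) $ i) \<longlongrightarrow> (M t *\<^sub>v w) $ i) Fl"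
proof -
  have e: "(M s *\<^sub>v y) $ i = (\<Sum>j<b. M s $$ (i,j) * y $ j)" if "y \<in> carrier_vec b" for s y
    using carrier_matD[OF assms(1)[of s]] i that by (auto simp: scalar_prod_def lessThan_atLeast0)
  have "((\<lambda>z. \<Sum>j<b. M (\<tau> z) $$ (i,j) * v z $ j) \<longlongrightarrow> (\<Sum>j<b. M t $$ (i,j) * w $ j)) Fl"
  proof (intro tendsto_sum tendsto_mult v)
    fix j assume j: "j \<in> {..<b}"
    have "isCont (\<lambda>t. M t $$ (i,j)) t"
      using assms(2)[OF i, of j] j by (simp add: continuous_on_eq_continuous_at)
    then show "((\<lambda>z. M (\<tau> z) $$ (i,j)) \<longlongrightarrow> M t $$ (i,j)) Fl" by (rule isCont_tendsto_compose[OF _ \<tau>])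
  qed simp
  then have "((\<lambda>z. \<Sum>j<b. M (\<tau> z) $$ (i,j) * v z $ j) \<longlongrightarrow> (M t *\<^sub>v w) $ i) Fl" using e[OF w] by simp
  moreover have "eventually (\<lambda>z. (\<Sum>j<b. M (\<tau> z) $$ (i,j) * v z $ j) = (M (\<tau> z) *\<^sub>v v z) $ i) Fl"
    using c by eventually_elim (simp add: e)
  ultimately show ?thesis by (rule Lim_transform_eventually)
qed

text \<open>Continuity of the coordinate change (t, x, u) -> (t, M(t) x, u), stated for filters so
  that it composes with the limits that express continuity of \<open>f\<close>.\<close>

lemma filterlim_nhds_tzu:
  assumes cM: "\<And>t. M t \<in> carrier_mat n n" and M: "\<And>i j. i < n \<Longrightarrow> j < n \<Longrightarrow> continuous_on UNIV (\<lambda>t. M t $$ (i,j))"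
    and x: "x \<in> carrier_vec n" and u: "u \<in> carrier_vec m"
  shows "filterlim (\<lambda>(t',x',u'). (t', M t' *\<^sub>v x', u')) (nhds_tzu n m t (M t *\<^sub>v x) u) (nhds_tzu n m t x u)"
  unfolding filterlim_iff
proof (intro allI impI)
  fix P assume "eventually P (nhds_tzu n m t (M t *\<^sub>v x) u)"
  then obtain d where d: "d > 0" and P: "\<And>t' x' u'. x' \<in> carrier_vec n \<Longrightarrow> u' \<in> carrier_vec m \<Longrightarrow>
      \<bar>t' - t\<bar> < d \<Longrightarrow> vnorm (x' - M t *\<^sub>v x) < d \<Longrightarrow> vnorm (u' - u) < d \<Longrightarrow> P (t',x',u')"
    unfolding eventually_nhds_tzu by blast
  let ?Fl = "nhds_tzu n m t x u"
  let ?v = "\<lambda>z. M (fst z) *\<^sub>v fst (snd z)"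
  have c: "eventually (\<lambda>z. fst (snd z) \<in> carrier_vec n \<and> snd (snd z) \<in> carrier_vec m \<and>
      \<bar>fst z - t\<bar> < d \<and> vnorm (snd (snd z) - u) < d) ?Fl"
    unfolding eventually_nhds_tzu using d by (intro exI[of _ d]) auto
  have c1: "eventually (\<lambda>z. fst (snd z) \<in> carrier_vec n) ?Fl" using c by (rule eventually_mono) simp
  have c2: "eventually (\<lambda>z. ?v z \<in> carrier_vec n) ?Fl"
    using c1 by eventually_elim (rule mult_mat_vec_carrier[OF cM])
  have "((\<lambda>z. ?v z $ i) \<longlongrightarrow> (M t *\<^sub>v x) $ i) ?Fl" if "i < n" for i
    using tendsto_nhds_tzu[OF x u] c1 x that
    by (intro tendsto_mult_mat_vec[OF cM M]) (auto simp: case_prod_unfold)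
  then have "((\<lambda>z. vnorm (?v z - M t *\<^sub>v x)) \<longlongrightarrow> 0) ?Fl"
    using tendsto_vnorm_iff[OF c2 mult_mat_vec_carrier[OF cM x]] by blast
  then have "eventually (\<lambda>z. vnorm (?v z - M t *\<^sub>v x) < d) ?Fl"
    using d by (auto simp: tendsto_iff dist_real_def vnorm_nonneg)
  with c c2 show "eventually (\<lambda>z. P (case z of (t',x',u') \<Rightarrow> (t', M t' *\<^sub>v x', u'))) ?Fl"
    by eventually_elim (auto simp: case_prod_unfold intro!: P)
qed

lemma cont_vecfun_transform:
  assumes f: "cont_vecfun n m n f"
    and cU: "\<And>t. U t \<in> carrier_mat n n" and U: "\<And>i j. i < n \<Longrightarrow> j < n \<Longrightarrow> continuous_on UNIV (\<lambda>t. U t $$ (i,j))"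
    and cM: "\<And>t. M t \<in> carrier_mat n n" and M: "\<And>i j. i < n \<Longrightarrow> j < n \<Longrightarrow> continuous_on UNIV (\<lambda>t. M t $$ (i,j))"
  shows "cont_vecfun n m n (\<lambda>t z u. U t *\<^sub>v f t (M t *\<^sub>v z) u)"
  unfolding cont_vecfun_iff
proof (intro conjI allI impI)
  have fc: "f t x u \<in> carrier_vec n" if "x \<in> carrier_vec n" "u \<in> carrier_vec m" for t x u
    using f that by (simp add: cont_vecfun_def)
  fix t :: real and x u :: "real vec"
  assume x: "x \<in> carrier_vec n" and u: "u \<in> carrier_vec m"
  note Mx = mult_mat_vec_carrier[OF cM x]
  show "U t *\<^sub>v f t (M t *\<^sub>v x) u \<in> carrier_vec n"
    by (rule mult_mat_vec_carrier[OF cU fc[OF Mx u]])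
  fix i assume i: "i < n"
  let ?Fl = "nhds_tzu n m t x u"
  let ?v = "\<lambda>z. f (fst z) (M (fst z) *\<^sub>v fst (snd z)) (snd (snd z))"
  have c: "eventually (\<lambda>z. ?v z \<in> carrier_vec n) ?Fl"
    unfolding eventually_nhds_tzu using fc mult_mat_vec_carrier[OF cM] by (intro exI[of _ 1]) auto
  have "((\<lambda>z. ?v z $ j) \<longlongrightarrow> f t (M t *\<^sub>v x) u $ j) ?Fl" if j: "j < n" for j
  proof -
    have "((\<lambda>(t',x',u'). f t' x' u' $ j) \<longlongrightarrow> f t (M t *\<^sub>v x) u $ j) (nhds_tzu n m t (M t *\<^sub>v x) u)"
      using f Mx u j unfolding cont_vecfun_iff by blast
    from filterlim_compose[OF this filterlim_nhds_tzu[OF cM M x u]] show ?thesis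
      by (simp add: case_prod_unfold)
  qed
  then show "((\<lambda>(t',x',u'). (U t' *\<^sub>v f t' (M t' *\<^sub>v x') u') $ i) \<longlongrightarrow> (U t *\<^sub>v f t (M t *\<^sub>v x) u) $ i) ?Fl"
    unfolding case_prod_unfold
    using tendsto_nhds_tzu(1)[OF x u] c fc[OF Mx u] i
    by (intro tendsto_mult_mat_vec[OF cU U]) (auto simp: case_prod_unfold)
qed

lemma cont_vecfun_sub:
  assumes "cont_vecfun n m N h" "a + k \<le> N"
  shows "cont_vecfun n m k (\<lambda>t z u. vec k (\<lambda>i. h t z u $ (a + i)))"
  using assms unfolding cont_vecfun_iff by auto

section \<open>Bounded vector fields\<close>

lemma bounded_vecfun_iff:
  assumes F: "\<And>t x u. x \<in> carrier_vec n \<Longrightarrow> u \<in> carrier_vec m \<Longrightarrow> F t x u \<in> carrier_vec k"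
  shows "bounded_vecfun n m F \<longleftrightarrow> (\<exists>c\<ge>0. \<forall>t x u. x \<in> carrier_vec n \<longrightarrow> u \<in> carrier_vec m \<longrightarrow>
      (\<forall>i<k. \<bar>F t x u $ i\<bar> \<le> c))"
proof
  assume "bounded_vecfun n m F"
  then obtain c where c: "\<And>t x u. x \<in> carrier_vec n \<Longrightarrow> u \<in> carrier_vec m \<Longrightarrow> vnorm (F t x u) \<le> c"
    unfolding bounded_vecfun_def by blast
  have "\<bar>F t x u $ i\<bar> \<le> \<bar>c\<bar>" if "x \<in> carrier_vec n" "u \<in> carrier_vec m" "i < k" for t x u i
    using entry_le_vnorm[of i "F t x u"] c[OF that(1,2), of t] F[OF that(1,2), of t] that(3) by auto
  then show "\<exists>c\<ge>0. \<forall>t x u. x \<in> carrier_vec n \<longrightarrow> u \<in> carrier_vec m \<longrightarrow> (\<forall>i<k. \<bar>F t x u $ i\<bar> \<le> c)"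
    by (intro exI[of _ "\<bar>c\<bar>"]) auto
next
  assume "\<exists>c\<ge>0. \<forall>t x u. x \<in> carrier_vec n \<longrightarrow> u \<in> carrier_vec m \<longrightarrow> (\<forall>i<k. \<bar>F t x u $ i\<bar> \<le> c)"
  then obtain c where c: "\<And>t x u i. x \<in> carrier_vec n \<Longrightarrow> u \<in> carrier_vec m \<Longrightarrow> i < k \<Longrightarrow> \<bar>F t x u $ i\<bar> \<le> c"
    by blast
  have "vnorm (F t x u) \<le> k * c" if "x \<in> carrier_vec n" "u \<in> carrier_vec m" for t x u
  proof -
    have "vnorm (F t x u) \<le> (\<Sum>i<k. \<bar>F t x u $ i\<bar>)"
      using vnorm_le_sum[of "F t x u"] F[OF that, of t] by simp
    also have "\<dots> \<le> (\<Sum>i<k. c)" using c that by (intro sum_mono) auto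
    finally show ?thesis by simp
  qed
  then show "bounded_vecfun n m F" unfolding bounded_vecfun_def by blast
qed

lemma bounded_vecfun_transform:
  assumes f: "bounded_vecfun n m f" and fc: "\<And>t x u. x \<in> carrier_vec n \<Longrightarrow> u \<in> carrier_vec m \<Longrightarrow> f t x u \<in> carrier_vec n"
    and cU: "\<And>t. U t \<in> carrier_mat n n" and U: "\<And>t i j. i < n \<Longrightarrow> j < n \<Longrightarrow> \<bar>U t $$ (i,j)\<bar> \<le> b"
    and cM: "\<And>t. M t \<in> carrier_mat n n"
  shows "bounded_vecfun n m (\<lambda>t z u. U t *\<^sub>v f t (M t *\<^sub>v z) u)"
proof -
  obtain c where c: "c \<ge> 0" "\<And>t x u i. x \<in> carrier_vec n \<Longrightarrow> u \<in> carrier_vec m \<Longrightarrow> i < n \<Longrightarrow> \<bar>f t x u $ i\<bar> \<le> c"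
    using f bounded_vecfun_iff[where F=f and n=n and m=m and k=n, OF fc] by auto
  have "\<bar>(U t *\<^sub>v f t (M t *\<^sub>v x) u) $ i\<bar> \<le> n * (\<bar>b\<bar> * c)"
    if x: "x \<in> carrier_vec n" and u: "u \<in> carrier_vec m" and i: "i < n" for t x u i
  proof -
    let ?y = "f t (M t *\<^sub>v x) u"
    note Mx = mult_mat_vec_carrier[OF cM x]
    have "\<bar>(U t *\<^sub>v ?y) $ i\<bar> = \<bar>\<Sum>j=0..<n. U t $$ (i,j) * ?y $ j\<bar>"
      using carrier_matD[OF cU[of t]] carrier_vecD[OF fc[OF Mx u, of t t]] i by (simp add: scalar_prod_def)
    also have "\<dots> \<le> (\<Sum>j=0..<n. \<bar>b\<bar> * c)"
    proof (rule order_trans[OF sum_abs sum_mono])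
      fix j assume "j \<in> {0..<n}"
      then have j: "j < n" by simp
      show "\<bar>U t $$ (i,j) * ?y $ j\<bar> \<le> \<bar>b\<bar> * c"
        unfolding abs_mult using U[OF i j, of t] c(2)[OF Mx u j] c(1) by (intro mult_mono) auto
    qed
    finally show ?thesis by simp
  qed
  moreover have "0 \<le> n * (\<bar>b\<bar> * c)" using c by simp
  moreover have "U t *\<^sub>v f t (M t *\<^sub>v x) u \<in> carrier_vec n" if "x \<in> carrier_vec n" "u \<in> carrier_vec m" for t x u
    by (rule mult_mat_vec_carrier[OF cU fc[OF mult_mat_vec_carrier[OF cM that(1)] that(2)]])
  ultimately show ?thesis by (subst bounded_vecfun_iff[where k=n]) blast+
qed

lemma bounded_vecfun_sub:
  assumes h: "bounded_vecfun n m h" and hc: "\<And>t x u. x \<in> carrier_vec n \<Longrightarrow> u \<in> carrier_vec m \<Longrightarrow> h t x u \<in> carrier_vec N"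
    and le: "a + k \<le> N"
  shows "bounded_vecfun n m (\<lambda>t z u. vec k (\<lambda>i. h t z u $ (a + i)))"
proof -
  obtain c where c: "c \<ge> 0" "\<And>t x u i. x \<in> carrier_vec n \<Longrightarrow> u \<in> carrier_vec m \<Longrightarrow> i < N \<Longrightarrow> \<bar>h t x u $ i\<bar> \<le> c"
    using h bounded_vecfun_iff[where F=h and n=n and m=m and k=N, OF hc] by auto
  show ?thesis
    by (subst bounded_vecfun_iff[where k=k]) (use c le in \<open>auto intro!: exI[of _ c]\<close>)
qed

section \<open>Relative degree and the Krylov matrices\<close>

text \<open>With \<open>k = m\<close> and \<open>F\<close> equal to B L this is \<open>calB\<close>;
  (ii) needs it also for a function W with p columns.\<close>

definition krylov :: "nat \<Rightarrow> nat \<Rightarrow> nat \<Rightarrow> real mat \<Rightarrow> (real \<Rightarrow> real mat) \<Rightarrow> real \<Rightarrow> real mat" where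
  "krylov n k r A F t = mat n (r * k) (\<lambda>(i,j). ((DmA A ^^ (j div k)) F t) $$ (i, j mod k))"

lemma calB_krylov: "calB n m r A B L t = krylov n m r A (\<lambda>s. B * L s) t"
  by (simp add: calB_def krylov_def)

lemma krylov_carrier [simp]: "krylov n k r A F t \<in> carrier_mat n (r * k)"
  by (simp add: krylov_def)

lemma calC_carrier [simp]: "calC n p r A C \<in> carrier_mat (r * p) n"
  by (simp add: calC_def)

lemma smooth_mat_on_DmA:
  assumes A: "A \<in> carrier_mat n n" and F: "smooth_mat_on UNIV n k F"
  shows "smooth_mat_on UNIV n k (DmA A F)"
  unfolding DmA_def
  by (rule smooth_mat_on_diff[OF open_UNIV smooth_mat_on_deriv[OF open_UNIV F]
        smooth_mat_on_mult[OF open_UNIV smooth_mat_on_const[OF A] F]])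

lemma smooth_mat_on_DmA_pow:
  assumes A: "A \<in> carrier_mat n n" and F: "smooth_mat_on UNIV n k F"
  shows "smooth_mat_on UNIV n k ((DmA A ^^ j) F)"
  by (induction j) (simp_all add: F smooth_mat_on_DmA[OF A])

lemma DmA_pow_carrier:
  "A \<in> carrier_mat n n \<Longrightarrow> smooth_mat_on UNIV n k F \<Longrightarrow> (DmA A ^^ j) F t \<in> carrier_mat n k"
  using smooth_mat_on_carrier[OF smooth_mat_on_DmA_pow] by blast

lemma block_index:
  fixes j k r :: nat
  assumes "b < r * k" shows "b div k < r" "b mod k < k"
proof -
  have "k > 0" using assms by (cases k) auto
  then show "b div k < r" "b mod k < k" using assms by (auto simp: less_mult_imp_div_less)
qed

lemma smooth_mat_on_krylov:
  assumes A: "A \<in> carrier_mat n n" and F: "smooth_mat_on UNIV n k F"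
  shows "smooth_mat_on UNIV n (r * k) (krylov n k r A F)"
proof (rule smooth_mat_onI[OF open_UNIV, of _ _ _ "\<lambda>i j t. (DmA A ^^ (j div k)) F t $$ (i, j mod k)"])
  fix i j assume ij: "i < n" "j < r * k"
  show "smooth_on UNIV (\<lambda>t. (DmA A ^^ (j div k)) F t $$ (i, j mod k))"
    by (rule smooth_mat_on_entry[OF smooth_mat_on_DmA_pow[OF A F] ij(1) block_index(2)[OF ij(2)]])
qed (simp_all add: krylov_def)

lemma mult_krylov_entry:
  assumes A: "A \<in> carrier_mat n n" and F: "smooth_mat_on UNIV n k F"
    and Z: "Z \<in> carrier_mat a n" and i: "i < a" and b: "b < r * k"
  shows "(Z * krylov n k r A F t) $$ (i,b) = (Z * (DmA A ^^ (b div k)) F t) $$ (i, b mod k)"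
  using Z i b block_index[OF b] carrier_matD[OF DmA_pow_carrier[OF A F, of "b div k" t]]
  by (simp add: scalar_prod_def krylov_def)

lemma mult_krylov_eq_0_iff:
  assumes A: "A \<in> carrier_mat n n" and F: "smooth_mat_on UNIV n k F" and Z: "Z \<in> carrier_mat a n"
  shows "Z * krylov n k r A F t = 0\<^sub>m a (r * k) \<longleftrightarrow> (\<forall>j<r. Z * (DmA A ^^ j) F t = 0\<^sub>m a k)"
proof (intro iffI allI impI)
  note D = DmA_pow_carrier[OF A F]
  { fix j assume z: "Z * krylov n k r A F t = 0\<^sub>m a (r * k)" and j: "j < r"
    show "Z * (DmA A ^^ j) F t = 0\<^sub>m a k"
    proof (rule eq_matI)
      fix i l assume "i < dim_row (0\<^sub>m a k :: real mat)" "l < dim_col (0\<^sub>m a k :: real mat)"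
      then have il: "i < a" "l < k" by auto
      have b: "j * k + l < r * k"
        using j il(2) by (metis add.commute add_less_mono1 less_le_trans mult_Suc mult_le_mono1 Suc_leI)
      from mult_krylov_entry[OF A F Z il(1) b, of t] z il b
      show "(Z * (DmA A ^^ j) F t) $$ (i,l) = 0\<^sub>m a k $$ (i,l)" by simp
    qed (use Z D[of j t] in auto)
  }
  assume z: "\<forall>j<r. Z * (DmA A ^^ j) F t = 0\<^sub>m a k"
  show "Z * krylov n k r A F t = 0\<^sub>m a (r * k)"
  proof (rule eq_matI)
    fix i b assume "i < dim_row (0\<^sub>m a (r * k) :: real mat)" "b < dim_col (0\<^sub>m a (r * k) :: real mat)"
    then have ib: "i < a" "b < r * k" by auto
    then show "(Z * krylov n k r A F t) $$ (i,b) = 0\<^sub>m a (r * k) $$ (i,b)"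
      unfolding mult_krylov_entry[OF A F Z ib] using z block_index[OF ib(2)] by simp
  qed (use Z in \<open>auto simp: krylov_def\<close>)
qed

text \<open>Product rule: Z (G' - A G) = (Z G)' - (Z' + Z A) G. Where Z G vanishes for all times,
  applying d/dt - A to G amounts to replacing Z by -(Z' + Z A).\<close>

lemma mult_DmA_pow_Suc:
  assumes A: "A \<in> carrier_mat n n" and F: "smooth_mat_on UNIV n k F" and Z: "smooth_mat_on UNIV a n Z"
  shows "Z t * (DmA A ^^ Suc j) F t =
    mat_deriv (\<lambda>s. Z s * (DmA A ^^ j) F s) t - (mat_deriv Z t + Z t * A) * (DmA A ^^ j) F t"
proof -
  let ?G = "(DmA A ^^ j) F"
  note sG = smooth_mat_on_DmA_pow[OF A F, of j]
  note c = smooth_mat_on_carrier[OF Z UNIV_I, of t] smooth_mat_on_carrier[OF sG UNIV_I, of t]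
    mat_deriv_carrier[of Z t, OF smooth_mat_on_carrier[OF Z UNIV_I]]
    mat_deriv_carrier[of ?G t, OF smooth_mat_on_carrier[OF sG UNIV_I]]
  have 1: "Z t * (DmA A ^^ Suc j) F t = Z t * mat_deriv ?G t - Z t * A * ?G t"
    using mult_minus_distrib_mat[OF c(1,4) mult_carrier_mat[OF A c(2)]] assoc_mult_mat[OF c(1) A c(2)]
    by (simp add: DmA_def)
  have 2: "(mat_deriv Z t + Z t * A) * ?G t = mat_deriv Z t * ?G t + Z t * A * ?G t"
    by (rule add_mult_distrib_mat[OF c(3) mult_carrier_mat[OF c(1) A] c(2)])
  show ?thesis
    unfolding 1 2 mat_deriv_mult[OF Z sG]
    by (rule eq_matI) (use c A in auto)
qed

lemma mult_const_DmA_pow_Suc: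
  assumes A: "A \<in> carrier_mat n n" and F: "smooth_mat_on UNIV n k F" and Z: "Z \<in> carrier_mat a n"
  shows "Z * (DmA A ^^ Suc j) F t =
    mat_deriv (\<lambda>s. Z * (DmA A ^^ j) F s) t - Z * A * (DmA A ^^ j) F t"
  using mult_DmA_pow_Suc[OF A F smooth_mat_on_const[OF Z], where t=t and j=j] Z A
  by (simp add: mat_deriv_const)

lemma mat_diff_eq_0D:
  fixes X Y :: "real mat"
  assumes "X \<in> carrier_mat a b" "Y \<in> carrier_mat a b" "X - Y = 0\<^sub>m a b"
  shows "X = Y"
proof (rule eq_matI)
  fix i j assume "i < dim_row Y" "j < dim_col Y"
  then have "(X - Y) $$ (i,j) = X $$ (i,j) - Y $$ (i,j)" "i < a" "j < b"
    using assms(2) by auto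
  then show "X $$ (i,j) = Y $$ (i,j)" unfolding assms(3) by simp
qed (use assms in auto)

text \<open>By the Leibniz rule the iterates of W G are combinations of those of W, but no such
  formula is expanded. The induction generalizes over \<open>Z\<close>: if \<open>Z\<close>
  annihilates the iterates of W up to order j + 1 at all times, then both Z and Z' + Z A annihilate
  those up to order j.\<close>

lemma mult_DmA_pow_factor_eq_0:
  assumes A: "A \<in> carrier_mat n n" and W: "smooth_mat_on UNIV n k W" and G: "smooth_mat_on UNIV k m G"
    and "smooth_mat_on UNIV a n Z" and "\<And>i t. i \<le> j \<Longrightarrow> Z t * (DmA A ^^ i) W t = 0\<^sub>m a k"
  shows "Z t * (DmA A ^^ j) (\<lambda>s. W s * G s) t = 0\<^sub>m a m"
  using assms(4,5)
proof (induction j arbitrary: Z t)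
  case 0
  note c = smooth_mat_on_carrier[OF 0(1) UNIV_I, of t] smooth_mat_on_carrier[OF W UNIV_I, of t]
    smooth_mat_on_carrier[OF G UNIV_I, of t]
  have "Z t * W t = 0\<^sub>m a k" using 0(2)[of 0 t] by simp
  with assoc_mult_mat[OF c] have "Z t * (W t * G t) = 0\<^sub>m a k * G t" by metis
  then show ?case using c(3) by simp
next
  case (Suc j)
  note Z = Suc.prems(1) and z = Suc.prems(2)
  note sWG = smooth_mat_on_mult[OF open_UNIV W G]
  define Y where "Y = (\<lambda>t. mat_deriv Z t + Z t * A)"
  have Y: "smooth_mat_on UNIV a n Y" unfolding Y_def
    by (rule smooth_mat_on_add[OF open_UNIV smooth_mat_on_deriv[OF open_UNIV Z]
          smooth_mat_on_mult[OF open_UNIV Z smooth_mat_on_const[OF A]]])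
  \<comment> \<open>\<open>Z\<close> annihilates the iterates \<open>i\<close> and
    \<open>Suc i\<close>, the former for all times, so that the derivative of that product vanishes
    too; only the term with \<open>Y\<close> is left in the product rule.\<close>
  have y: "Y t * (DmA A ^^ i) W t = 0\<^sub>m a k" if i: "i \<le> j" for i t
  proof -
    have c: "Y t * (DmA A ^^ i) W t \<in> carrier_mat a k"
      by (rule mult_carrier_mat[OF smooth_mat_on_carrier[OF Y UNIV_I] DmA_pow_carrier[OF A W]])
    have "0\<^sub>m a k = mat_deriv (\<lambda>s. 0\<^sub>m a k) t - Y t * (DmA A ^^ i) W t"
      using mult_DmA_pow_Suc[OF A W Z, where t=t and j=i] z[of i] z[of "Suc i" t] i by (simp add: Y_def)
    then have "0\<^sub>m a k = 0\<^sub>m a k - Y t * (DmA A ^^ i) W t" by (simp add: mat_deriv_const)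
    from mat_diff_eq_0D[OF zero_carrier_mat c this[symmetric]] show ?thesis by simp
  qed
  have "Z t * (DmA A ^^ j) (\<lambda>s. W s * G s) t = 0\<^sub>m a m" for t
    by (rule Suc.IH[OF Z]) (use z in auto)
  moreover have "Y t * (DmA A ^^ j) (\<lambda>s. W s * G s) t = 0\<^sub>m a m"
    by (rule Suc.IH[OF Y y])
  ultimately show ?case
    unfolding mult_DmA_pow_Suc[OF A sWG Z] by (simp add: Y_def mat_deriv_const)
qed

text \<open>(P2) for a general matrix function \<open>F\<close> in place of B L, with full row rank
  given as a right inverse. Writing \<open>i + 2 \<le> r\<close> for i <= r - 2 avoids truncated
  subtraction, so that \<open>low\<close> claims nothing when r = 1.\<close>

locale relative_degree =
  fixes n p k r :: nat and A C :: "real mat" and F :: "real \<Rightarrow> real mat"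
  assumes A: "A \<in> carrier_mat n n" and C: "C \<in> carrier_mat p n"
    and F: "smooth_mat_on UNIV n k F" and r: "r \<ge> 1"
    and low: "\<And>i t. i + 2 \<le> r \<Longrightarrow> C * A ^\<^sub>m i * F t = 0\<^sub>m p k"
    and high: "\<And>t. \<exists>J \<in> carrier_mat k p. C * A ^\<^sub>m (r - 1) * F t * J = 1\<^sub>m p"
begin

abbreviation "D j \<equiv> (DmA A ^^ j) F"
abbreviation "K \<equiv> krylov n k r A F"
abbreviation "CC \<equiv> calC n p r A C"

lemma CA: "C * A ^\<^sub>m i \<in> carrier_mat p n"
  by (rule mult_carrier_mat[OF C pow_carrier_mat[OF A]])

lemma CA_Suc: "C * A ^\<^sub>m i * A = C * A ^\<^sub>m Suc i"
  using assoc_mult_mat[OF C pow_carrier_mat[OF A] A] by simp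

lemma D_carrier: "D j t \<in> carrier_mat n k"
  by (rule DmA_pow_carrier[OF A F])

text \<open>The product rule trades one application of d/dt - A for one more factor A and keeps the
  total i + j; the derivative term vanishes because the product one iterate earlier is zero at all
  times.\<close>

lemma CA_D_low: "i + j + 2 \<le> r \<Longrightarrow> C * A ^\<^sub>m i * D j t = 0\<^sub>m p k"
proof (induction j arbitrary: i t)
  case (Suc j)
  have "C * A ^\<^sub>m i * D j s = 0\<^sub>m p k" for s by (rule Suc.IH) (use Suc.prems in simp)
  moreover have "C * A ^\<^sub>m Suc i * D j t = 0\<^sub>m p k" by (rule Suc.IH) (use Suc.prems in simp)
  ultimately show ?case
    unfolding mult_const_DmA_pow_Suc[OF A F CA] CA_Suc by (simp add: mat_deriv_const)
qed (use low in simp)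

text \<open>On the anti-diagonal i + j = r - 1 the derivative term of each trade still vanishes by
  \<open>CA_D_low\<close>, and each of the \<open>j\<close> trades contributes a factor -1.\<close>

lemma CA_D_high: "i + j + 1 = r \<Longrightarrow> C * A ^\<^sub>m i * D j t = (-1) ^ j \<cdot>\<^sub>m (C * A ^\<^sub>m (r - 1) * F t)"
proof (induction j arbitrary: i t)
  case (Suc j)
  have 1: "C * A ^\<^sub>m i * D j s = 0\<^sub>m p k" for s by (rule CA_D_low) (use Suc.prems in simp)
  have 2: "C * A ^\<^sub>m Suc i * D j t = (-1) ^ j \<cdot>\<^sub>m (C * A ^\<^sub>m (r - 1) * F t)"
    by (rule Suc.IH) (use Suc.prems in simp)
  have c: "C * A ^\<^sub>m (r - 1) * F t \<in> carrier_mat p k"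
    by (rule mult_carrier_mat[OF CA smooth_mat_on_carrier[OF F UNIV_I]])
  show ?case
    unfolding mult_const_DmA_pow_Suc[OF A F CA] CA_Suc 1 2
    by (rule eq_matI)
      (use c carrier_matD[OF C] carrier_matD[OF smooth_mat_on_carrier[OF F UNIV_I, of t]] in \<open>auto simp: mat_deriv_const\<close>)
next
  case 0
  have "C * A ^\<^sub>m (r - 1) * F t \<in> carrier_mat p k"
    by (rule mult_carrier_mat[OF CA smooth_mat_on_carrier[OF F UNIV_I]])
  then show ?case using 0 by (intro eq_matI) auto
qed

lemma calC_mult_entry:
  assumes M: "M \<in> carrier_mat n c" and a: "a < r * p" and b: "b < c"
  shows "(CC * M) $$ (a,b) = (C * A ^\<^sub>m (a div p) * M) $$ (a mod p, b)"
  using M a b block_index[OF a] carrier_matD[OF CA[of "a div p"]]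
  by (simp add: scalar_prod_def calC_def)

lemma calC_krylov_entry:
  assumes "i < r" "a < p" "j < r" "b < k"
  shows "(CC * K t) $$ (i * p + a, j * k + b) = (C * A ^\<^sub>m i * D j t) $$ (a,b)"
proof -
  have lt: "i * p + a < r * p" "j * k + b < r * k"
    using assms by (metis add.commute add_less_mono1 less_le_trans mult_Suc mult_le_mono1 Suc_leI)+
  have "(CC * K t) $$ (i * p + a, j * k + b) = (C * A ^\<^sub>m i * K t) $$ (a, j * k + b)"
    using calC_mult_entry[OF krylov_carrier lt, of A F t] assms by simp
  also have "\<dots> = (C * A ^\<^sub>m i * D j t) $$ (a,b)"
    using mult_krylov_entry[OF A F CA assms(2) lt(2), of i t] assms by simp
  finally show ?thesis .
qed

text \<open>The matrix \<open>CC * K t\<close> is block triangular with respect to the anti-diagonal, so a vector in the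
  kernel of its transpose is eliminated block by block, from the last one upwards.\<close>

lemma calC_krylov_right_inverse: "\<exists>J \<in> carrier_mat (r * k) (r * p). CC * K t * J = 1\<^sub>m (r * p)"
proof (rule transpose_injective_right_inverse)
  show M: "CC * K t \<in> carrier_mat (r * p) (r * k)" by (rule mult_carrier_mat[OF calC_carrier krylov_carrier])
  fix x assume x: "x \<in> carrier_vec (r * p)" and z: "(CC * K t)\<^sup>T *\<^sub>v x = 0\<^sub>v (r * k)"
  have eq: "(\<Sum>i<r. \<Sum>a<p. (C * A ^\<^sub>m i * D j t) $$ (a,b) * x $ (i * p + a)) = 0"
    if jb: "j < r" "b < k" for j b
  proof -
    have lt: "j * k + b < r * k"
      using jb by (metis add.commute add_less_mono1 less_le_trans mult_Suc mult_le_mono1 Suc_leI)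
    have "0 = ((CC * K t)\<^sup>T *\<^sub>v x) $ (j * k + b)" using z lt by simp
    also have "\<dots> = (\<Sum>c<r * p. (CC * K t) $$ (c, j * k + b) * x $ c)"
      using carrier_matD[OF M] x lt by (auto simp: scalar_prod_def lessThan_atLeast0 intro!: sum.cong)
    also have "\<dots> = (\<Sum>i<r. \<Sum>c\<in>{i * p..<i * p + p}. (CC * K t) $$ (c, j * k + b) * x $ c)"
      by (rule sum.nat_group[symmetric])
    also have "\<dots> = (\<Sum>i<r. \<Sum>a<p. (CC * K t) $$ (i * p + a, j * k + b) * x $ (i * p + a))"
    proof (rule sum.cong[OF refl])
      fix i
      show "(\<Sum>c\<in>{i * p..<i * p + p}. (CC * K t) $$ (c, j * k + b) * x $ c) =
        (\<Sum>a<p. (CC * K t) $$ (i * p + a, j * k + b) * x $ (i * p + a))"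
        using sum.shift_bounds_nat_ivl[of "\<lambda>c. (CC * K t) $$ (c, j * k + b) * x $ c" 0 "i * p" p]
        by (simp add: add.commute lessThan_atLeast0)
    qed
    also have "\<dots> = (\<Sum>i<r. \<Sum>a<p. (C * A ^\<^sub>m i * D j t) $$ (a,b) * x $ (i * p + a))"
      using jb by (intro sum.cong refl arg_cong2[where f = "(*)"] calC_krylov_entry) auto
    finally show ?thesis by simp
  qed
  define \<Gamma> where "\<Gamma> = C * A ^\<^sub>m (r - 1) * F t"
  have \<Gamma>: "\<Gamma> \<in> carrier_mat p k" unfolding \<Gamma>_def
    by (rule mult_carrier_mat[OF CA smooth_mat_on_carrier[OF F UNIV_I]])
  obtain J where J: "J \<in> carrier_mat k p" "\<Gamma> * J = 1\<^sub>m p" using high unfolding \<Gamma>_def by blast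
  have JT: "J\<^sup>T * \<Gamma>\<^sup>T = 1\<^sub>m p" using J \<Gamma> by (metis transpose_mult transpose_one)
  have block: "\<forall>a<p. x $ ((r - 1 - j) * p + a) = 0" if "j < r" for j
    using that
  proof (induction j rule: less_induct)
    case (less j)
    define i0 where "i0 = r - 1 - j"
    have i0: "i0 < r" "i0 + j + 1 = r" using less.prems by (auto simp: i0_def)
    define y where "y = vec p (\<lambda>a. x $ (i0 * p + a))"
    have y: "y \<in> carrier_vec p" by (simp add: y_def)
    have "\<Gamma>\<^sup>T *\<^sub>v y = 0\<^sub>v k"
    proof (rule eq_vecI)
      fix b assume "b < dim_vec (0\<^sub>v k :: real vec)"
      then have b: "b < k" by simp
      have "0 = (\<Sum>i<r. \<Sum>a<p. (C * A ^\<^sub>m i * D j t) $$ (a,b) * x $ (i * p + a))"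
        using eq[OF less.prems b] by simp
      also have "\<dots> = (\<Sum>i<r. if i = i0 then \<Sum>a<p. (C * A ^\<^sub>m i * D j t) $$ (a,b) * x $ (i * p + a) else 0)"
      proof (rule sum.cong[OF refl])
        fix i assume "i \<in> {..<r}"
        \<comment> \<open>In column block \<open>j\<close>, rows above \<open>i0\<close> vanish by
          the relative degree, and rows below \<open>i0\<close> meet components of \<open>x\<close>
          that are already known to be zero. Only \<open>i0\<close>, on the anti-diagonal,
          remains.\<close>
        then consider "i = i0" | "i + j + 2 \<le> r" | "i = r - 1 - (r - 1 - i)" "r - 1 - i < j" "i \<noteq> i0"
          using i0 by fastforce
        then show "(\<Sum>a<p. (C * A ^\<^sub>m i * D j t) $$ (a,b) * x $ (i * p + a)) =
          (if i = i0 then \<Sum>a<p. (C * A ^\<^sub>m i * D j t) $$ (a,b) * x $ (i * p + a) else 0)"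
        proof cases
          case 2
          then have "i \<noteq> i0" using i0 by auto
          with CA_D_low[OF 2, of t] b show ?thesis by simp
        next
          case 3
          have "\<forall>a<p. x $ ((r - 1 - (r - 1 - i)) * p + a) = 0"
            using 3 less.prems by (intro less.IH) auto
          with 3 show ?thesis by simp
        qed simp
      qed
      also have "\<dots> = (\<Sum>a<p. (C * A ^\<^sub>m i0 * D j t) $$ (a,b) * x $ (i0 * p + a))"
        using i0 by (simp add: sum.delta)
      also have "\<dots> = (\<Sum>a<p. (-1) ^ j * (\<Gamma> $$ (a,b) * y $ a))"
        using CA_D_high[OF i0(2), of t] \<Gamma> b unfolding \<Gamma>_def[symmetric] by (intro sum.cong) (auto simp: y_def)
      also have "\<dots> = (-1) ^ j * (\<Gamma>\<^sup>T *\<^sub>v y) $ b"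
        using \<Gamma> b y by (simp add: scalar_prod_def lessThan_atLeast0 sum_distrib_left)
      finally show "(\<Gamma>\<^sup>T *\<^sub>v y) $ b = 0\<^sub>v k $ b" using b by simp
    qed (use \<Gamma> in auto)
    with left_inverse_injective[OF _ _ JT y] \<Gamma> J have "y = 0\<^sub>v p" by auto
    then have "y $ a = 0" if "a < p" for a using that by simp
    then show ?case unfolding i0_def[symmetric] by (simp add: y_def)
  qed
  show "x = 0\<^sub>v (r * p)"
  proof (rule eq_vecI)
    fix c assume "c < dim_vec (0\<^sub>v (r * p) :: real vec)"
    then have c: "c < r * p" by simp
    note bi = block_index[OF c]
    have "r - 1 - (r - 1 - c div p) = c div p" using bi by simp
    with block[of "r - 1 - c div p"] bi have "x $ (c div p * p + c mod p) = 0" by auto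
    then show "x $ c = 0\<^sub>v (r * p) $ c" using c by simp
  qed (use x in auto)
qed

section \<open>The smooth right inverse E of the stacked output matrices\<close>

definition E :: "real \<Rightarrow> real mat" where
  "E t = K t * pinv (CC * K t)"

lemma CCK_carrier: "CC * K t \<in> carrier_mat (r * p) (r * k)"
  by (rule mult_carrier_mat[OF calC_carrier krylov_carrier])

lemma E_carrier: "E t \<in> carrier_mat n (r * p)"
  unfolding E_def by (rule mult_carrier_mat[OF krylov_carrier pinv_props(1)[OF CCK_carrier]])

lemma CCK_pinv: "CC * K t * pinv (CC * K t) = 1\<^sub>m (r * p)"
  using calC_krylov_right_inverse pinv_right_inverse[OF CCK_carrier] by blast

lemma CC_E: "CC * E t = 1\<^sub>m (r * p)"
  unfolding E_def
  using assoc_mult_mat[OF calC_carrier[of n p r A C] krylov_carrier[of n k r A F t]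
      pinv_props(1)[OF CCK_carrier[of t]]] CCK_pinv[of t] by simp

text \<open>Right invertibility fixes the rank of \<open>CC * K t\<close> at r p for every t, which
  is what smoothness of the pseudoinverse asks for.\<close>

lemma smooth_E: "smooth_mat_on UNIV n (r * p) E"
proof -
  note sK = smooth_mat_on_krylov[OF A F, of r]
  have "smooth_mat_on UNIV (r * k) (r * p) (\<lambda>t. pinv (CC * K t))"
  proof (rule smooth_mat_on_pinv)
    show "smooth_mat_on UNIV (r * p) (r * k) (\<lambda>t. CC * K t)"
      by (rule smooth_mat_on_mult[OF open_UNIV smooth_mat_on_const[OF calC_carrier] sK])
    show "mrank (CC * K t) = r * p" for t
      by (rule mrank_right_inverse[OF CCK_carrier pinv_props(1)[OF CCK_carrier] CCK_pinv])
  qed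
  from smooth_mat_on_mult[OF open_UNIV sK this]
  show ?thesis unfolding E_def[abs_def] .
qed

end

section \<open>Block matrices\<close>

lemma projection_mult:
  fixes E C X :: "real mat"
  assumes "E \<in> carrier_mat n a" "C \<in> carrier_mat a n" "X \<in> carrier_mat n b"
  shows "(1\<^sub>m n - E * C) * X = X - E * (C * X)"
  using minus_mult_distrib_mat[OF one_carrier_mat mult_carrier_mat[OF assms(1,2)] assms(3)]
    assoc_mult_mat[OF assms] assms(3) by simp

text \<open>With p columns per block the matrix \<open>W.CC * W.K t\<close> is square, so the right
  inverse in \<open>E\<close> is also a left inverse. For wider blocks only the relation
  \<open>CC_E\<close> is available.\<close>

lemma relative_degree_E_calC_krylov:
  assumes "relative_degree n p p r A C W"
  shows "relative_degree.E n p p r A C W t * (calC n p r A C * krylov n p r A W t) = krylov n p r A W t"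
proof -
  interpret W: relative_degree n p p r A C W by fact
  note cK = krylov_carrier[of n p r A W t] and cP = pinv_props(1)[OF W.CCK_carrier[of t]]
  have "pinv (W.CC * W.K t) * (W.CC * W.K t) = 1\<^sub>m (r * p)"
    by (rule mat_mult_left_right_inverse[OF W.CCK_carrier cP W.CCK_pinv])
  then show ?thesis
    unfolding W.E_def using assoc_mult_mat[OF cK cP W.CCK_carrier[of t]] right_mult_one_mat[OF cK] by simp
qed

text \<open>The projection Z = I - E CC, with E formed from W, annihilates the Krylov matrix of W,
  hence also the Krylov matrix K of W G. So K = E (CC K), and multiplying by the pseudoinverse of CC
  K, a right inverse, leaves E.\<close>

lemma relative_degree_E_factor:
  assumes "relative_degree n p p r A C W" and "relative_degree n p m r A C (\<lambda>s. W s * G s)"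
    and G: "smooth_mat_on UNIV p m G"
  shows "relative_degree.E n p m r A C (\<lambda>s. W s * G s) t = relative_degree.E n p p r A C W t"
proof -
  interpret W: relative_degree n p p r A C W by fact
  interpret M: relative_degree n p m r A C "\<lambda>s. W s * G s" by fact
  define Z where "Z = (\<lambda>t. 1\<^sub>m n - W.E t * calC n p r A C)"
  note CCc = calC_carrier[of n p r A C]
  have sZ: "smooth_mat_on UNIV n n Z" unfolding Z_def
    by (rule smooth_mat_on_diff[OF open_UNIV smooth_mat_on_const[OF one_carrier_mat]
          smooth_mat_on_mult[OF open_UNIV W.smooth_E smooth_mat_on_const[OF CCc]]])
  note cZ = smooth_mat_on_carrier[OF sZ UNIV_I]
  have ZK: "Z t * W.K t = 0\<^sub>m n (r * p)" for t
    unfolding Z_def projection_mult[OF W.E_carrier CCc krylov_carrier]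
      relative_degree_E_calC_krylov[OF assms(1)]
    by (simp add: krylov_def)
  then have ZD: "Z t * W.D i t = 0\<^sub>m n p" if "i < r" for i t
    using mult_krylov_eq_0_iff[OF W.A W.F cZ] that by blast
  have "Z t * M.D j t = 0\<^sub>m n m" if "j < r" for j
    by (rule mult_DmA_pow_factor_eq_0[OF W.A W.F G sZ]) (use that ZD in simp)
  then have "Z t * M.K t = 0\<^sub>m n (r * m)"
    using mult_krylov_eq_0_iff[OF M.A M.F cZ] by blast
  then have "M.K t = W.E t * (W.CC * M.K t)"
    unfolding Z_def projection_mult[OF W.E_carrier CCc krylov_carrier]
    by (intro mat_diff_eq_0D[OF krylov_carrier mult_carrier_mat[OF W.E_carrier M.CCK_carrier]])
  then have "M.E t = W.E t * (W.CC * M.K t) * pinv (W.CC * M.K t)"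
    unfolding M.E_def by metis
  also have "\<dots> = W.E t"
    using assoc_mult_mat[OF W.E_carrier M.CCK_carrier pinv_props(1)[OF M.CCK_carrier]]
      M.CCK_pinv right_mult_one_mat[OF W.E_carrier] by simp
  finally show ?thesis .
qed

definition hcat :: "real mat \<Rightarrow> real mat \<Rightarrow> real mat" where
  "hcat A B = mat (dim_row A) (dim_col A + dim_col B)
     (\<lambda>(i,j). if j < dim_col A then A $$ (i,j) else B $$ (i, j - dim_col A))"

lemma hcat_carrier: "A \<in> carrier_mat n a \<Longrightarrow> B \<in> carrier_mat n b \<Longrightarrow> hcat A B \<in> carrier_mat n (a + b)"
  by (auto simp: hcat_def)

lemma vstack_carrier: "A \<in> carrier_mat a n \<Longrightarrow> B \<in> carrier_mat b n \<Longrightarrow> vstack A B \<in> carrier_mat (a + b) n"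
  by (auto simp: vstack_def)

lemma sum_split_add: "(\<Sum>l=0..<a + b. g l) = (\<Sum>l=0..<a. g l) + (\<Sum>l=0..<b. g (a + l))"
  for g :: "nat \<Rightarrow> real"
  using sum.atLeastLessThan_concat[of 0 a "a + b" g] sum.shift_bounds_nat_ivl[of g 0 a b]
  by (simp add: add.commute)

lemma hcat_mult_vstack:
  assumes "E \<in> carrier_mat n a" "V \<in> carrier_mat n b" "X \<in> carrier_mat a c" "Y \<in> carrier_mat b c"
  shows "hcat E V * vstack X Y = E * X + V * Y"
  by (rule eq_matI) (use assms in \<open>auto simp: hcat_def vstack_def scalar_prod_def sum_split_add\<close>)

lemma vstack_mult:
  assumes "X \<in> carrier_mat a n" "Y \<in> carrier_mat b n" "M \<in> carrier_mat n c"
  shows "vstack X Y * M = vstack (X * M) (Y * M)"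
  by (rule eq_matI) (use assms in \<open>auto simp: vstack_def scalar_prod_def\<close>)

lemma mult_hcat:
  assumes "E \<in> carrier_mat n a" "V \<in> carrier_mat n b" "M \<in> carrier_mat c n"
  shows "M * hcat E V = hcat (M * E) (M * V)"
  by (rule eq_matI) (use assms in \<open>auto simp: hcat_def scalar_prod_def\<close>)

lemma vstack_hcat_one:
  "vstack (hcat (1\<^sub>m a) (0\<^sub>m a b)) (hcat (0\<^sub>m b a) (1\<^sub>m b)) = 1\<^sub>m (a + b)"
  by (rule eq_matI) (auto simp: vstack_def hcat_def)

section \<open>Images, kernels and complements\<close>

lemma mat_im_subset_factor:
  assumes X: "X \<in> carrier_mat n k" and Y: "Y \<in> carrier_mat n l" and s: "mat_im X \<subseteq> mat_im Y"
  shows "\<exists>Z \<in> carrier_mat l k. X = Y * Z"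
proof -
  have "\<exists>z \<in> carrier_vec l. col X j = Y *\<^sub>v z" if j: "j < k" for j
  proof -
    have "X *\<^sub>v unit_vec k j = col X j" using j X by (intro eq_vecI) auto
    then have "col X j \<in> mat_im X" using X unfolding mat_im_def by (auto intro!: exI[of _ "unit_vec k j"])
    then show ?thesis using s Y unfolding mat_im_def by auto
  qed
  then obtain z where z: "\<And>j. j < k \<Longrightarrow> z j \<in> carrier_vec l \<and> col X j = Y *\<^sub>v z j" by metis
  define Z where "Z = mat_of_cols l (map z [0..<k])"
  have Z: "Z \<in> carrier_mat l k" unfolding Z_def by auto
  have "X = Y * Z"
  proof (rule mat_col_eqI)
    fix j assume "j < dim_col (Y * Z)"
    then have j: "j < k" using Z by simp
    have "col Z j = z j" unfolding Z_def using j z by (subst col_mat_of_cols) auto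
    then show "col X j = col (Y * Z) j" using col_mult2[OF Y Z j] z[OF j] by simp
  qed (use X Y Z in auto)
  then show ?thesis using Z by blast
qed

lemma mat_im_subset_kernel_iff:
  assumes M: "M \<in> carrier_mat a n" and X: "X \<in> carrier_mat n k"
  shows "mat_im X \<subseteq> mat_kernel M \<longleftrightarrow> M * X = 0\<^sub>m a k"
proof
  assume s: "mat_im X \<subseteq> mat_kernel M"
  show "M * X = 0\<^sub>m a k"
  proof (rule mat_col_eqI)
    fix j assume "j < dim_col (0\<^sub>m a k :: real mat)"
    then have j: "j < k" by simp
    have "X *\<^sub>v unit_vec k j = col X j" using j X by (intro eq_vecI) auto
    then have "col X j \<in> mat_im X" using X unfolding mat_im_def by (auto intro!: exI[of _ "unit_vec k j"])
    then have "M *\<^sub>v col X j = 0\<^sub>v a" using s M unfolding mat_kernel_def by auto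
    then show "col (M * X) j = col (0\<^sub>m a k) j" using col_mult2[OF M X j] j by simp
  qed (use M X in auto)
next
  assume z: "M * X = 0\<^sub>m a k"
  have "M *\<^sub>v (X *\<^sub>v v) = 0\<^sub>v a" if v: "v \<in> carrier_vec k" for v
    unfolding assoc_mult_mat_vec[OF M X v, symmetric] z using v by (intro eq_vecI) auto
  then show "mat_im X \<subseteq> mat_kernel M" using M X unfolding mat_im_def mat_kernel_def by auto
qed

text \<open>Z = I - E M is the projection onto ker M = im V along im E, so Z = V Y for some Y, and
  [E, V] [M; Y] = E M + Z = I. As V has exactly n - a columns, both factors are square and commute.
  This gives Y V = I: the columns of V are independent, its pseudoinverse is a left inverse, and it
  can take the place of the unspecified Y.\<close>

lemma complement_inverse:
  fixes M E V :: "real mat"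
  assumes M: "M \<in> carrier_mat a n" and E: "E \<in> carrier_mat n a" and ME: "M * E = 1\<^sub>m a"
    and V: "V \<in> carrier_mat n (n - a)" and im: "mat_im V = mat_kernel M" and an: "a \<le> n"
  shows "M * V = 0\<^sub>m a (n - a)" and "pinv V * (1\<^sub>m n - E * M) * E = 0\<^sub>m (n - a) a"
    and "vstack M (pinv V * (1\<^sub>m n - E * M)) * hcat E V = 1\<^sub>m n"
proof -
  let ?d = "n - a"
  have n: "a + ?d = n" using an by simp
  define Z where "Z = 1\<^sub>m n - E * M"
  have Z: "Z \<in> carrier_mat n n" unfolding Z_def using E M by (intro minus_carrier_mat mult_carrier_mat)
  note pV = pinv_props(1)[OF V]
  show MV: "M * V = 0\<^sub>m a ?d" using mat_im_subset_kernel_iff[OF M V] im by simp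
  have ZE: "Z * E = 0\<^sub>m n a" unfolding Z_def projection_mult[OF E M E] ME using E by simp
  have ZV: "Z * V = V"
    unfolding Z_def projection_mult[OF E M V] MV using E V by (intro eq_matI) auto
  have "M * Z = M - M * E * M"
    unfolding Z_def using mult_minus_distrib_mat[OF M one_carrier_mat mult_carrier_mat[OF E M]]
      assoc_mult_mat[OF M E M] M by simp
  then have "M * Z = 0\<^sub>m a n" using ME M by simp
  then obtain Y where Y: "Y \<in> carrier_mat ?d n" and ZY: "Z = V * Y"
    using mat_im_subset_factor[OF Z V] mat_im_subset_kernel_iff[OF M Z] im by auto
  have hW: "hcat E V \<in> carrier_mat n n" using hcat_carrier[OF E V] n by simp
  have hX: "vstack M Y \<in> carrier_mat n n" using vstack_carrier[OF M Y] n by simp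
  have "hcat E V * vstack M Y = E * M + Z" unfolding hcat_mult_vstack[OF E V M Y] ZY ..
  also have "\<dots> = 1\<^sub>m n" unfolding Z_def using E M by (intro eq_matI) auto
  finally have "vstack M Y * hcat E V = 1\<^sub>m n" by (rule mat_mult_left_right_inverse[OF hW hX])
  then have e: "hcat (vstack M Y * E) (vstack M Y * V) = 1\<^sub>m n" using mult_hcat[OF E V hX] by simp
  have "Y * V = 1\<^sub>m ?d"
  proof (rule eq_matI)
    fix i j assume "i < dim_row (1\<^sub>m ?d :: real mat)" "j < dim_col (1\<^sub>m ?d :: real mat)"
    then have ij: "i < ?d" "j < ?d" by auto
    \<comment> \<open>\<open>Y * V\<close> is the lower right block of [M; Y] [E, V] = I.\<close>
    have "(Y * V) $$ (i,j) = hcat (vstack M Y * E) (vstack M Y * V) $$ (a + i, a + j)"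
      unfolding vstack_mult[OF M Y V] vstack_mult[OF M Y E]
      using ij M Y V E by (simp add: hcat_def vstack_def)
    also have "\<dots> = 1\<^sub>m ?d $$ (i,j)" unfolding e using ij by auto
    finally show "(Y * V) $$ (i,j) = 1\<^sub>m ?d $$ (i,j)" .
  qed (use Y V in auto)
  then have VV: "pinv V * V = 1\<^sub>m ?d" by (rule pinv_left_inverse[OF V Y])
  define N where "N = pinv V * Z"
  have N: "N \<in> carrier_mat ?d n" unfolding N_def by (rule mult_carrier_mat[OF pV Z])
  have NE: "N * E = 0\<^sub>m ?d a" unfolding N_def using assoc_mult_mat[OF pV Z E] ZE pV by simp
  then show "pinv V * (1\<^sub>m n - E * M) * E = 0\<^sub>m ?d a" unfolding N_def Z_def .
  have NV: "N * V = 1\<^sub>m ?d" unfolding N_def using assoc_mult_mat[OF pV Z V] ZV VV by simp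
  have "vstack M N * hcat E V = vstack (M * hcat E V) (N * hcat E V)"
    by (rule vstack_mult[OF M N hW])
  also have "\<dots> = 1\<^sub>m n"
    unfolding mult_hcat[OF E V M] mult_hcat[OF E V N] ME MV NE NV vstack_hcat_one n ..
  finally show "vstack M (pinv V * (1\<^sub>m n - E * M)) * hcat E V = 1\<^sub>m n" unfolding N_def Z_def .
qed

lemma mrank_le_cols: "M \<in> carrier_mat a n \<Longrightarrow> mrank M \<le> n"
  unfolding mrank_def using vec_space.rank_le_nc by auto

lemma blk_add:
  assumes "X \<in> carrier_mat a b" "Y \<in> carrier_mat a b" "r0 + nr \<le> a" "c0 + nc \<le> b"
  shows "blk (X + Y) r0 c0 nr nc = blk X r0 c0 nr nc + blk Y r0 c0 nr nc"
  by (rule eq_matI) (use assms in auto)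

lemma blk_full: "X \<in> carrier_mat a b \<Longrightarrow> blk X 0 0 a b = X"
  by (rule eq_matI) auto

lemma smooth_mat_on_vstack:
  assumes S: "open S" and X: "smooth_mat_on S a n X" and Y: "smooth_mat_on S b n Y"
  shows "smooth_mat_on S (a + b) n (\<lambda>t. vstack (X t) (Y t))"
proof (rule smooth_mat_onI[OF S, of _ _ _ "\<lambda>i j t. if i < a then X t $$ (i,j) else Y t $$ (i - a,j)"])
  fix t assume t: "t \<in> S"
  note c = smooth_mat_on_carrier[OF X t] smooth_mat_on_carrier[OF Y t]
  show "vstack (X t) (Y t) \<in> carrier_mat (a + b) n" by (rule vstack_carrier[OF c])
  show "vstack (X t) (Y t) $$ (i,j) = (if i < a then X t $$ (i,j) else Y t $$ (i - a,j))"
    if "i < a + b" "j < n" for i j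
    using c that by (simp add: vstack_def)
next
  fix i j assume ij: "i < a + b" "j < n"
  show "smooth_on S (\<lambda>t. if i < a then X t $$ (i,j) else Y t $$ (i - a,j))"
  proof (cases "i < a")
    case True
    then show ?thesis using smooth_mat_on_entry[OF X True ij(2)] by simp
  next
    case False
    then have "i - a < b" using ij by simp
    from smooth_mat_on_entry[OF Y this ij(2)] False show ?thesis by simp
  qed
qed

lemma smooth_mat_on_hcat:
  assumes S: "open S" and X: "smooth_mat_on S n a X" and Y: "smooth_mat_on S n b Y"
  shows "smooth_mat_on S n (a + b) (\<lambda>t. hcat (X t) (Y t))"
proof (rule smooth_mat_onI[OF S, of _ _ _ "\<lambda>i j t. if j < a then X t $$ (i,j) else Y t $$ (i,j - a)"])
  fix t assume t: "t \<in> S"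
  note c = smooth_mat_on_carrier[OF X t] smooth_mat_on_carrier[OF Y t]
  show "hcat (X t) (Y t) \<in> carrier_mat n (a + b)" by (rule hcat_carrier[OF c])
  show "hcat (X t) (Y t) $$ (i,j) = (if j < a then X t $$ (i,j) else Y t $$ (i,j - a))"
    if "i < n" "j < a + b" for i j
    using c that by (simp add: hcat_def)
next
  fix i j assume ij: "i < n" "j < a + b"
  show "smooth_on S (\<lambda>t. if j < a then X t $$ (i,j) else Y t $$ (i,j - a))"
  proof (cases "j < a")
    case True
    then show ?thesis using smooth_mat_on_entry[OF X ij(1) True] by simp
  next
    case False
    then have "j - a < b" using ij by simp
    from smooth_mat_on_entry[OF Y ij(1) this] False show ?thesis by simp
  qed
qed

lemma smooth_mat_on_continuous:
  assumes "smooth_mat_on UNIV a b F" "i < a" "j < b"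
  shows "continuous_on UNIV (\<lambda>t. F t $$ (i,j))"
  using smooth_on_differentiable[OF smooth_mat_on_entry[OF assms] UNIV_I]
  by (auto simp: continuous_on_eq_continuous_at intro: differentiable_imp_continuous_within)

section \<open>The normal form\<close>

lemma one_blk:
  assumes "r0 + nr \<le> n" "c0 + nc \<le> n"
  shows "blk (1\<^sub>m n) r0 c0 nr nc = mat nr nc (\<lambda>(i,j). if r0 + i = c0 + j then 1 else 0)"
  by (rule eq_matI) (use assms in auto)

lemma block_index_eq_iff:
  fixes i j k l p :: nat
  assumes "i < p" "j < p"
  shows "k * p + i = l * p + j \<longleftrightarrow> k = l \<and> i = j"
proof
  assume e: "k * p + i = l * p + j"
  have "(k * p + i) div p = k" "(l * p + j) div p = l" "(k * p + i) mod p = i" "(l * p + j) mod p = j"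
    using assms by auto
  with e show "k = l \<and> i = j" by metis
qed simp

lemma block_bound: "i < r \<Longrightarrow> i * p + p \<le> r * p" for i p r :: nat
  by (metis Suc_leI add.commute mult_Suc mult_le_mono1)

text \<open>The general locale at \<open>F\<close> equal to B L, so that \<open>E t\<close> is
  \<open>calB\<close> times the pseudoinverse of \<open>CC * calB\<close>. Added are
  \<open>V\<close> and the Lyapunov property, which concern the change of coordinates.\<close>

locale byrnes_isidori = relative_degree n p m r A C "\<lambda>s. B * L s"
  for n p m r :: nat and A C B :: "real mat" and L :: "real \<Rightarrow> real mat" +
  fixes V :: "real mat"
  assumes B: "B \<in> carrier_mat n m" and L: "smooth_mat_on UNIV m m L"
    and L_bdd: "bounded_matfun L"
    and V: "V \<in> carrier_mat n (n - mrank (calC n p r A C))"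
    and V_im: "mat_im V = mat_kernel (calC n p r A C)"
    and lyap: "lyapunov_transformation n (calU n m p r A B C L V)"
begin

abbreviation "d \<equiv> n - r * p"
abbreviation "U \<equiv> calU n m p r A B C L V"
abbreviation "W t \<equiv> hcat (E t) V"
definition "NN t = pinv V * (1\<^sub>m n - E t * CC)"
abbreviation "Ah t \<equiv> (U t * A + mat_deriv U t) * minv (U t)"
abbreviation "Bh t \<equiv> U t * B * L t"
abbreviation "E_last t \<equiv> E t * E0I p r"

lemma L_carrier: "L t \<in> carrier_mat m m" by (rule smooth_mat_on_carrier[OF L UNIV_I])

lemma BL_carrier: "B * L t \<in> carrier_mat n m" by (rule mult_carrier_mat[OF B L_carrier])

lemma calB_pinv: "calB n m r A B L t * pinv (CC * calB n m r A B L t) = E t"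
  by (simp add: E_def calB_krylov)

lemma mrank_CC: "mrank CC = r * p"
  by (rule mrank_right_inverse[OF calC_carrier E_carrier CC_E])

lemma dim_le: "r * p \<le> n"
  using mrank_le_cols[OF calC_carrier, of n p r A C] mrank_CC by simp

lemma dim_add: "r * p + d = n" using dim_le by simp

lemma V_carrier: "V \<in> carrier_mat n d"
  using V mrank_CC by simp

lemmas complement = complement_inverse[OF calC_carrier E_carrier CC_E V_carrier V_im dim_le]

lemma Z_carrier: "1\<^sub>m n - E t * CC \<in> carrier_mat n n"
  by (rule minus_carrier_mat[OF mult_carrier_mat[OF E_carrier calC_carrier]])

lemma NN_carrier: "NN t \<in> carrier_mat d n"
  unfolding NN_def by (rule mult_carrier_mat[OF pinv_props(1)[OF V_carrier] Z_carrier])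

lemma calN_eq: "calN n m p r A B C L V = NN"
  unfolding calN_def NN_def calB_pinv ..

lemma U_eq: "U t = vstack CC (NN t)"
  unfolding calU_def calN_eq ..

lemma U_carrier: "U t \<in> carrier_mat n n"
  using vstack_carrier[OF calC_carrier NN_carrier] dim_add unfolding U_eq by metis

lemma W_carrier: "W t \<in> carrier_mat n n"
  using hcat_carrier[OF E_carrier V_carrier] dim_add by metis

lemma U_W: "U t * W t = 1\<^sub>m n"
  unfolding U_eq NN_def by (rule complement(3))

lemma minv_U: "minv (U t) = W t"
  by (rule minv_eqI[OF U_carrier W_carrier U_W])

lemma W_U: "W t * U t = 1\<^sub>m n"
  by (rule mat_mult_left_right_inverse[OF U_carrier W_carrier U_W])

lemma NN_E: "NN t * E t = 0\<^sub>m d (r * p)"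
  unfolding NN_def by (rule complement(2))

lemma smooth_NN: "smooth_mat_on UNIV d n NN"
  unfolding NN_def[abs_def]
  by (rule smooth_mat_on_mult[OF open_UNIV smooth_mat_on_const[OF pinv_props(1)[OF V_carrier]]
        smooth_mat_on_diff[OF open_UNIV smooth_mat_on_const[OF one_carrier_mat]
          smooth_mat_on_mult[OF open_UNIV smooth_E smooth_mat_on_const[OF calC_carrier]]]])

text \<open>A Lyapunov transformation is only required to be C^1; the infinite differentiability of
  \<open>U\<close> comes from \<open>E\<close>.\<close>

lemma smooth_U: "smooth_mat_on UNIV n n U"
  using smooth_mat_on_vstack[OF open_UNIV smooth_mat_on_const[OF calC_carrier[of n p r A C]] smooth_NN]
  unfolding dim_add U_eq[symmetric] .

lemma smooth_W: "smooth_mat_on UNIV n n W"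
  using smooth_mat_on_hcat[OF open_UNIV smooth_E smooth_mat_on_const[OF V_carrier]] unfolding dim_add .

lemma dU_carrier: "mat_deriv U t \<in> carrier_mat n n"
  by (rule mat_deriv_carrier[OF U_carrier])

lemma smooth_Ah: "smooth_mat_on UNIV n n (\<lambda>t. Ah t)"
  unfolding minv_U
  by (rule smooth_mat_on_mult[OF open_UNIV smooth_mat_on_add[OF open_UNIV
          smooth_mat_on_mult[OF open_UNIV smooth_U smooth_mat_on_const[OF A]]
          smooth_mat_on_deriv[OF open_UNIV smooth_U]] smooth_W])

lemma UA_dU_carrier: "U t * A + mat_deriv U t \<in> carrier_mat n n"
  by (rule add_carrier_mat[OF dU_carrier])

lemma Ah_carrier: "Ah t \<in> carrier_mat n n"
  by (rule smooth_mat_on_carrier[OF smooth_Ah UNIV_I])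

lemma bounded_U: "bounded_matfun U" and bounded_minv_U: "bounded_matfun (\<lambda>t. minv (U t))"
  and bounded_dU: "bounded_matfun (mat_deriv U)"
  using lyap unfolding lyapunov_transformation_def by auto

text \<open>The bounds on U, U^{-1} and U' are exactly those of a Lyapunov transformation, so
  neither \<open>E\<close> nor its derivative has to be estimated.\<close>

lemma bounded_Ah: "bounded_matfun (\<lambda>t. Ah t)"
  by (rule bounded_matfun_mult[where c = n, OF bounded_matfun_add[OF bounded_matfun_mult[OF bounded_U U_carrier
            bounded_matfun_const A] mult_carrier_mat[OF U_carrier A] bounded_dU dU_carrier]
        UA_dU_carrier bounded_minv_U])
    (simp add: minv_U W_carrier)

lemma smooth_Bh: "smooth_mat_on UNIV n m (\<lambda>t. Bh t)"
  by (rule smooth_mat_on_mult[OF open_UNIV smooth_mat_on_mult[OF open_UNIV smooth_U smooth_mat_on_const[OF B]] L])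

lemma Bh_carrier: "Bh t \<in> carrier_mat n m"
  by (rule smooth_mat_on_carrier[OF smooth_Bh UNIV_I])

lemma bounded_Bh: "bounded_matfun (\<lambda>t. Bh t)"
  by (rule bounded_matfun_mult[OF bounded_matfun_mult[OF bounded_U U_carrier
            bounded_matfun_const B] mult_carrier_mat[OF U_carrier B] L_bdd L_carrier])

lemma Bh_eq: "Bh t = U t * (B * L t)"
  by (rule assoc_mult_mat[OF U_carrier B L_carrier])

lemma U_upper: "i < r \<Longrightarrow> blk (U t) (i * p) 0 p n = C * A ^\<^sub>m i"
proof (rule eq_matI)
  fix a b assume i: "i < r" and "a < dim_row (C * A ^\<^sub>m i)" "b < dim_col (C * A ^\<^sub>m i)"
  then have ab: "a < p" "b < n" using carrier_matD[OF CA[of i]] by auto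
  have "i * p + a < r * p" using block_bound[OF i, of p] ab by simp
  then show "blk (U t) (i * p) 0 p n $$ (a,b) = (C * A ^\<^sub>m i) $$ (a,b)"
    using ab unfolding U_eq by (simp add: vstack_def calC_def)
qed (use carrier_matD[OF CA[of i]] in auto)

lemma U_lower: "blk (U t) (r * p) 0 d n = NN t"
  by (rule eq_matI)
    (use carrier_matD[OF NN_carrier[of t]] carrier_matD[OF calC_carrier[of n p r A C]] in
      \<open>auto simp: U_eq vstack_def\<close>)

lemma dU_upper: "i < r \<Longrightarrow> blk (mat_deriv U t) (i * p) 0 p n = 0\<^sub>m p n"
proof (rule eq_matI)
  fix a b assume i: "i < r" and "a < dim_row (0\<^sub>m p n :: real mat)" "b < dim_col (0\<^sub>m p n :: real mat)"
  then have ab: "a < p" "b < n" by auto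
  have lt: "i * p + a < r * p" using block_bound[OF i, of p] ab by simp
  then have ltn: "i * p + a < n" using dim_le by simp
  have "(\<lambda>s. U s $$ (i * p + a, b)) = (\<lambda>s. CC $$ (i * p + a, b))"
    using lt ab carrier_matD[OF calC_carrier[of n p r A C]] unfolding U_eq by (auto simp: vstack_def)
  then show "blk (mat_deriv U t) (i * p) 0 p n $$ (a,b) = 0\<^sub>m p n $$ (a,b)"
    using ab ltn by (simp add: mat_deriv_entry[OF U_carrier])
qed auto

lemma dU_lower: "blk (mat_deriv U t) (r * p) 0 d n = mat_deriv NN t"
proof (rule eq_matI)
  note dN = carrier_matD[OF mat_deriv_carrier[of NN t, OF NN_carrier]]
  show "dim_row (blk (mat_deriv U t) (r * p) 0 d n) = dim_row (mat_deriv NN t)"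
    "dim_col (blk (mat_deriv U t) (r * p) 0 d n) = dim_col (mat_deriv NN t)" using dN by simp_all
  fix a b assume "a < dim_row (mat_deriv NN t)" "b < dim_col (mat_deriv NN t)"
  then have ab: "a < d" "b < n" using dN by auto
  have "(\<lambda>s. U s $$ (r * p + a, b)) = (\<lambda>s. NN s $$ (a, b))"
    using ab carrier_matD[OF calC_carrier[of n p r A C]] carrier_matD[OF NN_carrier]
    unfolding U_eq by (auto simp: vstack_def)
  then show "blk (mat_deriv U t) (r * p) 0 d n $$ (a,b) = mat_deriv NN t $$ (a,b)"
    using ab by (simp add: mat_deriv_entry[OF U_carrier] mat_deriv_entry[OF NN_carrier])
qed

lemma U_mult_upper:
  assumes X: "X \<in> carrier_mat n c" and i: "i < r" and le: "c0 + nc \<le> c"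
  shows "blk (U t * X) (i * p) c0 p nc = C * A ^\<^sub>m i * blk X 0 c0 n nc"
  using blk_mult[OF U_carrier X _ le, of "i * p" p t] block_bound[OF i, of p] dim_le U_upper[OF i] by simp

lemma U_mult_lower:
  assumes X: "X \<in> carrier_mat n c" and le: "c0 + nc \<le> c"
  shows "blk (U t * X) (r * p) c0 d nc = NN t * blk X 0 c0 n nc"
  using blk_mult[OF U_carrier X _ le, of "r * p" d t] dim_le U_lower by simp

text \<open>The upper rows of U are constant, so block row k of U A + U' is C A^{k+1}, which is
  block row k + 1 of U as long as k + 1 < r. Multiplied by U^{-1} it becomes block row k + 1 of the
  identity. The column range is left open because the square blocks and the zero blocks above S use
  different ones.\<close>

lemma Ah_upper:
  assumes k: "k + 1 < r" and le: "c0 + nc \<le> n"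
  shows "blk (Ah t) (k * p) c0 p nc = mat p nc (\<lambda>(i,j). if (k + 1) * p + i = c0 + j then 1 else 0)"
proof -
  have kr: "k < r" using k by simp
  have b: "k * p + p \<le> n" and b1: "(k + 1) * p + p \<le> n"
    using block_bound[OF kr, of p] block_bound[OF k, of p] dim_le by linarith+
  have "blk (U t * A + mat_deriv U t) (k * p) 0 p n = C * A ^\<^sub>m (k + 1)"
    using blk_add[OF mult_carrier_mat[OF U_carrier A] dU_carrier b, of 0 n t]
      U_mult_upper[OF A kr, of 0 n t] dU_upper[OF kr, of t] blk_full[OF A] CA_Suc[of k] CA[of "k + 1"]
    by (simp add: CA)
  then have "blk (Ah t) (k * p) c0 p nc = C * A ^\<^sub>m (k + 1) * blk (W t) 0 c0 n nc"
    using blk_mult[OF UA_dU_carrier W_carrier b le, of t t] unfolding minv_U by simp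
  also have "\<dots> = blk (U t * W t) ((k + 1) * p) c0 p nc"
    using U_mult_upper[OF W_carrier k le, of t] by simp
  also have "\<dots> = mat p nc (\<lambda>(i,j). if (k + 1) * p + i = c0 + j then 1 else 0)"
    unfolding U_W using one_blk[OF b1 le] by simp
  finally show ?thesis .
qed

text \<open>Isolates the left factor N' + N A of the lower rows, whose annihilation properties
  decide (ii).\<close>

lemma Ah_lower:
  assumes le: "c0 + nc \<le> n"
  shows "blk (Ah t) (r * p) c0 d nc = (mat_deriv NN t + NN t * A) * blk (W t) 0 c0 n nc"
proof -
  have b: "r * p + d \<le> n" using dim_le by simp
  have "blk (U t * A + mat_deriv U t) (r * p) 0 d n = NN t * A + mat_deriv NN t"
    using blk_add[OF mult_carrier_mat[OF U_carrier A] dU_carrier b, of 0 n t]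
      U_mult_lower[OF A, of 0 n t] dU_lower[of t] blk_full[OF A] by simp
  also have "\<dots> = mat_deriv NN t + NN t * A"
    by (rule comm_add_mat[OF mult_carrier_mat[OF NN_carrier A] mat_deriv_carrier[OF NN_carrier]])
  finally show ?thesis
    using blk_mult[OF UA_dU_carrier W_carrier b le, of t t] unfolding minv_U by simp
qed

lemma Ah_superdiagonal:
  assumes k: "k + 1 < r" and l: "l < r"
  shows "blk (Ah t) (k * p) (l * p) p p = (if l = k + 1 then 1\<^sub>m p else 0\<^sub>m p p)"
proof -
  have "l * p + p \<le> n" using block_bound[OF l, of p] dim_le by linarith
  note a = Ah_upper[OF k this, of t]
  show ?thesis unfolding a
  proof (rule eq_matI)
    fix i j assume "i < dim_row (if l = k + 1 then 1\<^sub>m p else 0\<^sub>m p p :: real mat)"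
      "j < dim_col (if l = k + 1 then 1\<^sub>m p else 0\<^sub>m p p :: real mat)"
    then have ij: "i < p" "j < p" by (auto split: if_splits)
    show "mat p p (\<lambda>(i,j). if (k + 1) * p + i = l * p + j then 1 else 0) $$ (i,j) =
      (if l = k + 1 then 1\<^sub>m p else 0\<^sub>m p p) $$ (i,j)"
      using block_index_eq_iff[OF ij, of "k + 1" l] ij by auto
  qed auto
qed

lemma Ah_upper_right:
  assumes k: "k + 1 < r"
  shows "blk (Ah t) (k * p) (r * p) p d = 0\<^sub>m p d"
proof -
  have "r * p + d \<le> n" using dim_le by simp
  note a = Ah_upper[OF k this, of t]
  show ?thesis unfolding a
  proof (rule eq_matI)
    fix i j assume "i < dim_row (0\<^sub>m p d :: real mat)" "j < dim_col (0\<^sub>m p d :: real mat)"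
    then show "mat p d (\<lambda>(i,j). if (k + 1) * p + i = r * p + j then 1 else 0) $$ (i,j) = 0\<^sub>m p d $$ (i,j)"
      using block_bound[OF k, of p] by simp
  qed auto
qed

lemma Bh_upper: "i < r \<Longrightarrow> blk (Bh t) (i * p) 0 p m = C * A ^\<^sub>m i * (B * L t)"
  unfolding Bh_eq using U_mult_upper[OF BL_carrier, of i 0 m t] blk_full[OF BL_carrier] by simp

lemma Bh_lower: "blk (Bh t) (r * p) 0 d m = NN t * (B * L t)"
  unfolding Bh_eq using U_mult_lower[OF BL_carrier, of 0 m t] blk_full[OF BL_carrier] by simp

lemma U_mult_entry:
  assumes X: "X \<in> carrier_mat n c" and a: "a < r * p" and b: "b < c"
  shows "(U t * X) $$ (a,b) = (C * A ^\<^sub>m (a div p) * X) $$ (a mod p, b)"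
  unfolding U_eq vstack_mult[OF calC_carrier NN_carrier X]
  using calC_mult_entry[OF X a b] a b X carrier_matD[OF calC_carrier[of n p r A C]]
  by (simp add: vstack_def)

lemma Bh_zero: "blk (Bh t) 0 0 ((r - 1) * p) m = 0\<^sub>m ((r - 1) * p) m"
proof (rule eq_matI)
  fix a b assume "a < dim_row (0\<^sub>m ((r - 1) * p) m :: real mat)" "b < dim_col (0\<^sub>m ((r - 1) * p) m :: real mat)"
  then have a: "a < (r - 1) * p" and b: "b < m" by auto
  have arp: "a < r * p" using a by (metis diff_le_self less_le_trans mult_le_mono1)
  have "a div p + 2 \<le> r" using block_index(1)[OF a] by simp
  then show "blk (Bh t) 0 0 ((r - 1) * p) m $$ (a,b) = 0\<^sub>m ((r - 1) * p) m $$ (a,b)"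
    using a b U_mult_entry[OF BL_carrier arp b] low block_index(2)[OF a] unfolding Bh_eq by simp
qed auto

text \<open>C is block row 0 of U, so C U^{-1} consists of the first p rows of the identity.\<close>

lemma C_minv_U: "C * minv (U t) = mat p n (\<lambda>(i,j). if i = j then 1 else 0)"
proof -
  have r0: "0 < r" using r by simp
  have pn: "p \<le> n" using order_trans[OF block_bound[OF r0, of p] dim_le] by simp
  have "C * minv (U t) = C * A ^\<^sub>m 0 * blk (W t) 0 0 n n"
    unfolding minv_U using blk_full[OF W_carrier] A C by simp
  also have "\<dots> = blk (U t * W t) 0 0 p n" using U_mult_upper[OF W_carrier r0, of 0 n t] by simp
  also have "\<dots> = mat p n (\<lambda>(i,j). if i = j then 1 else 0)"
    unfolding U_W using one_blk[of 0 p n 0 n] pn by simp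
  finally show ?thesis .
qed

text \<open>The first r - 1 blocks of \<open>CC\<close> applied to B L X vanish by the relative
  degree whatever X is. The two equations for X therefore say that U takes the same value on B L X
  and on \<open>E_last t\<close>, and U is invertible.\<close>

lemma feedback_iff:
  assumes K: "X \<in> carrier_mat m p"
  shows "C * A ^\<^sub>m (r - 1) * (B * L t) * X = 1\<^sub>m p \<and> NN t * (B * L t) * X = 0\<^sub>m d p
    \<longleftrightarrow> B * L t * X = E_last t"
proof -
  let ?Y = "B * L t * X"
  have Y: "?Y \<in> carrier_mat n p" by (rule mult_carrier_mat[OF BL_carrier K])
  have E0: "E0I p r \<in> carrier_mat (r * p) p" by (simp add: E0I_def)
  have CCE: "CC * E_last t = E0I p r"
    using assoc_mult_mat[OF calC_carrier[of n p r A C] E_carrier[of t] E0] CC_E[of t] E0 by simp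
  have NNE: "NN t * E_last t = 0\<^sub>m d p"
    using assoc_mult_mat[OF NN_carrier[of t] E_carrier[of t] E0] NN_E[of t] E0 by simp
  have a1: "C * A ^\<^sub>m i * (B * L t) * X = C * A ^\<^sub>m i * ?Y" for i
    by (rule assoc_mult_mat[OF CA BL_carrier K])
  have a2: "NN t * (B * L t) * X = NN t * ?Y" by (rule assoc_mult_mat[OF NN_carrier BL_carrier K])
  have rr: "r - 1 < r" using r by simp
  have z: "C * A ^\<^sub>m i * ?Y = 0\<^sub>m p p" if "i + 2 \<le> r" for i
    using low[OF that, of t] a1[of i] K by simp
  have "CC * ?Y = E0I p r \<longleftrightarrow> C * A ^\<^sub>m (r - 1) * ?Y = 1\<^sub>m p"
  proof
    assume e: "CC * ?Y = E0I p r"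
    show "C * A ^\<^sub>m (r - 1) * ?Y = 1\<^sub>m p"
    proof (rule eq_matI)
      fix a b assume "a < dim_row (1\<^sub>m p :: real mat)" "b < dim_col (1\<^sub>m p :: real mat)"
      then have ab: "a < p" "b < p" by auto
      have lt: "(r - 1) * p + a < r * p" using block_bound[OF rr, of p] ab by simp
      from calC_mult_entry[OF Y lt ab(2)] ab lt
      show "(C * A ^\<^sub>m (r - 1) * ?Y) $$ (a,b) = 1\<^sub>m p $$ (a,b)"
        unfolding e by (simp add: E0I_def)
    qed (use carrier_matD[OF CA[of "r - 1"]] Y in auto)
  next
    assume e: "C * A ^\<^sub>m (r - 1) * ?Y = 1\<^sub>m p"
    show "CC * ?Y = E0I p r"
    proof (rule eq_matI)
      fix a b assume "a < dim_row (E0I p r)" "b < dim_col (E0I p r)"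
      then have ab: "a < r * p" "b < p" using E0 by auto
      note bi = block_index[OF ab(1)]
      have ai: "a = (r - 1) * p + b \<longleftrightarrow> a div p = r - 1 \<and> a mod p = b"
        using block_index_eq_iff[OF bi(2) ab(2), of "a div p" "r - 1"] by simp
      consider "a div p = r - 1" | "a div p + 2 \<le> r" using bi(1) by linarith
      then show "(CC * ?Y) $$ (a,b) = E0I p r $$ (a,b)"
      proof cases
        case 1
        then show ?thesis using calC_mult_entry[OF Y ab] e bi ab ai by (simp add: E0I_def)
      next
        case 2
        then have "a div p \<noteq> r - 1" by linarith
        then show ?thesis using calC_mult_entry[OF Y ab] z[OF 2] bi ab ai by (simp add: E0I_def)
      qed
    qed (use E0 Y carrier_matD[OF calC_carrier[of n p r A C]] in auto)
  qed
  moreover have "CC * ?Y = E0I p r \<and> NN t * ?Y = 0\<^sub>m d p \<longleftrightarrow> ?Y = E_last t"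
  proof
    assume e: "CC * ?Y = E0I p r \<and> NN t * ?Y = 0\<^sub>m d p"
    \<comment> \<open>\<open>?Y\<close> is recovered from its two blocks \<open>CC * ?Y\<close> and
      \<open>NN t * ?Y\<close> through the inverse [E, V].\<close>
    have "?Y = W t * U t * ?Y" unfolding W_U by (rule left_mult_one_mat[OF Y, symmetric])
    also have "\<dots> = W t * vstack (CC * ?Y) (NN t * ?Y)"
      using assoc_mult_mat[OF W_carrier U_carrier Y] vstack_mult[OF calC_carrier NN_carrier Y]
      unfolding U_eq by metis
    also have "\<dots> = E t * E0I p r + V * 0\<^sub>m d p"
      using hcat_mult_vstack[OF E_carrier V_carrier E0 zero_carrier_mat, of t] e by simp
    also have "\<dots> = E_last t" using V_carrier E0 E_carrier[of t] by simp
    finally show "?Y = E_last t" .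
  qed (use CCE NNE in simp)
  ultimately show ?thesis unfolding a1 a2 by blast
qed

lemma smooth_E_last: "smooth_mat_on UNIV n p E_last"
  by (rule smooth_mat_on_mult[OF open_UNIV smooth_E smooth_mat_on_const]) (simp add: E0I_def)

text \<open>The inclusion of images only yields some X with B L X = E [0; I] at each time, with no
  regularity in t. Since B L (B L)^+ B L = B L, the pseudoinverse choice solves the same equation,
  and constant rank of B L makes it smooth.\<close>

lemma feedback_witness:
  assumes rk: "\<And>t. mrank (B * L t) = q" and im: "\<And>t. mat_im (E_last t) \<subseteq> mat_im (B * L t)"
  shows "smooth_mat_on UNIV m p (\<lambda>t. pinv (B * L t) * E_last t)"
    and "B * L t * (pinv (B * L t) * E_last t) = E_last t"
proof -
  show "smooth_mat_on UNIV m p (\<lambda>t. pinv (B * L t) * E_last t)"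
    by (rule smooth_mat_on_mult[OF open_UNIV smooth_mat_on_pinv[OF F rk] smooth_E_last])
  note c = smooth_mat_on_carrier[OF smooth_E_last UNIV_I, of t]
  obtain X where X: "X \<in> carrier_mat m p" and e: "E_last t = B * L t * X"
    using mat_im_subset_factor[OF c BL_carrier im] by blast
  note P = pinv_props[OF BL_carrier[of t]]
  have "B * L t * (pinv (B * L t) * E_last t) = B * L t * pinv (B * L t) * (B * L t * X)"
    using assoc_mult_mat[OF BL_carrier P(1) c] e by simp
  also have "\<dots> = B * L t * pinv (B * L t) * (B * L t) * X"
    by (rule assoc_mult_mat[OF mult_carrier_mat[OF BL_carrier P(1)] BL_carrier X, symmetric])
  finally show "B * L t * (pinv (B * L t) * E_last t) = E_last t" unfolding P(2) e .
qed

lemma feedback_im: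
  assumes X: "X \<in> carrier_mat m p" and e: "B * L t * X = E_last t"
  shows "mat_im (E_last t) \<subseteq> mat_im (B * L t)"
proof -
  have "\<exists>w \<in> carrier_vec m. B * L t * X *\<^sub>v v = B * L t *\<^sub>v w" if "v \<in> carrier_vec p" for v
    using assoc_mult_mat_vec[OF BL_carrier X that, of t] mult_mat_vec_carrier[OF X that] by blast
  then show ?thesis
    unfolding mat_im_def e[symmetric] using X carrier_matD[OF BL_carrier[of t]] by auto
qed

text \<open>Meant for y = f(t, x, u), where (P2) provides the hypothesis \<open>z\<close>; it gives
  the leading zeros of the transformed f.\<close>

lemma U_mult_vec_zero:
  assumes y: "y \<in> carrier_vec n" and z: "\<And>k. k + 2 \<le> r \<Longrightarrow> C * A ^\<^sub>m k *\<^sub>v y = 0\<^sub>v p"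
    and i: "i < (r - 1) * p"
  shows "(U t *\<^sub>v y) $ i = 0"
proof -
  have irp: "i < r * p" using i by (metis diff_le_self less_le_trans mult_le_mono1)
  note bi = block_index[OF i]
  have "i div p + 2 \<le> r" using bi by simp
  then have "0 = (C * A ^\<^sub>m (i div p) *\<^sub>v y) $ (i mod p)" using z bi by simp
  also have "\<dots> = (\<Sum>j=0..<n. (C * A ^\<^sub>m (i div p)) $$ (i mod p, j) * y $ j)"
    using y bi carrier_matD[OF CA[of "i div p"]] by (simp add: scalar_prod_def)
  also have "\<dots> = (\<Sum>j=0..<n. U t $$ (i,j) * y $ j)"
    using irp by (intro sum.cong) (auto simp: U_eq vstack_def calC_def)
  also have "\<dots> = (U t *\<^sub>v y) $ i"
    using y irp dim_le carrier_matD[OF U_carrier[of t]] by (simp add: scalar_prod_def)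
  finally show ?thesis by simp
qed

end

section \<open>The case q = p\<close>

context byrnes_isidori
begin

text \<open>On the iterates of W of order below r, N' + N A acts like a left multiple of C: both
  annihilate all of them but the last. \<open>E\<close> has its columns in the span of these
  iterates, so (N' + N A) E is the same multiple of C E = [I, 0], and only P_1 can be
  nonzero.\<close>

lemma minimal_rank:
  assumes rk: "\<And>t. mrank (B * L t) = p"
  shows "NN t * (B * L t) = 0\<^sub>m d m"
    and "1 \<le> l \<Longrightarrow> l < r \<Longrightarrow> blk (Ah t) (r * p) (l * p) d p = 0\<^sub>m d p"
proof -
  define G where "G = (\<lambda>t. C * A ^\<^sub>m (r - 1) * (B * L t))"
  have G: "smooth_mat_on UNIV p m G" unfolding G_def
    by (rule smooth_mat_on_mult[OF open_UNIV smooth_mat_on_const[OF CA] F])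
  note cG = smooth_mat_on_carrier[OF G UNIV_I]
  have G_pinv: "G t * pinv (G t) = 1\<^sub>m p" for t
    using high[of t] pinv_right_inverse[OF cG[of t]] unfolding G_def by blast
  note cP = pinv_props(1)[OF cG]
  have sP: "smooth_mat_on UNIV m p (\<lambda>t. pinv (G t))"
    by (rule smooth_mat_on_pinv[OF G mrank_right_inverse[OF cG cP G_pinv]])
  \<comment> \<open>Normalized so that C A^{r-1} W1 = I. The rank of B L being p is what makes W1 G
    recover B L.\<close>
  define W1 where "W1 = (\<lambda>t. B * L t * pinv (G t))"
  have W1: "smooth_mat_on UNIV n p W1" unfolding W1_def
    by (rule smooth_mat_on_mult[OF open_UNIV F sP])
  note cW1 = smooth_mat_on_carrier[OF W1 UNIV_I]
  have BL_eq: "(\<lambda>t. B * L t) = (\<lambda>t. W1 t * G t)"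
    using mrank_factor_through[OF BL_carrier rk CA[of "r - 1"] cP] G_pinv unfolding W1_def G_def by blast
  have CAW: "C * A ^\<^sub>m i * W1 t = C * A ^\<^sub>m i * (B * L t) * pinv (G t)" for i t
    unfolding W1_def by (rule assoc_mult_mat[OF CA BL_carrier cP, symmetric])
  have CAW1: "C * A ^\<^sub>m (r - 1) * W1 t = 1\<^sub>m p" for t
    using CAW[of "r - 1" t] G_pinv[of t] unfolding G_def by simp
  have X_rd: "relative_degree n p p r A C W1"
  proof
    show "C * A ^\<^sub>m i * W1 t = 0\<^sub>m p p" if "i + 2 \<le> r" for i t
      unfolding CAW low[OF that] by (rule left_mult_zero_mat[OF cP])
    show "\<exists>J\<in>carrier_mat p p. C * A ^\<^sub>m (r - 1) * W1 t * J = 1\<^sub>m p" for t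
      unfolding CAW1 by (intro bexI[of _ "1\<^sub>m p"]) auto
  qed (rule A C W1 r)+
  then interpret X: relative_degree n p p r A C W1 .
  have "relative_degree n p m r A C (\<lambda>s. W1 s * G s)"
    using relative_degree_axioms unfolding BL_eq .
  from relative_degree_E_factor[OF X_rd this G]
  have E_eq: "E t = X.E t" for t unfolding BL_eq .
  \<comment> \<open>With p columns per block the Krylov matrix is \<open>X.E t\<close> times a
    matrix, so annihilating E implies annihilating every iterate.\<close>
  have "NN t * X.K t = NN t * X.E t * (X.CC * X.K t)" for t
    using relative_degree_E_calC_krylov[OF X_rd, of t]
      assoc_mult_mat[OF NN_carrier[of t] X.E_carrier[of t] X.CCK_carrier[of t]] by simp
  then have "NN t * X.K t = 0\<^sub>m d (r * p)" for t
    using NN_E[of t] left_mult_zero_mat[OF X.CCK_carrier[of t]] unfolding E_eq by simp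
  then have NND: "NN t * X.D j t = 0\<^sub>m d p" if "j < r" for j t
    using mult_krylov_eq_0_iff[OF A W1 NN_carrier] that by blast
  have r0: "0 < r" using r by simp
  have "NN t * W1 t = 0\<^sub>m d p" using NND[OF r0, of t] by simp
  then show "NN t * (B * L t) = 0\<^sub>m d m"
    using assoc_mult_mat[OF NN_carrier cW1 cG, of t t t] left_mult_zero_mat[OF cG[of t]]
      fun_cong[OF BL_eq, of t] by simp
  \<comment> \<open>The product rule costs one iterate: \<open>NN\<close> annihilates the iterates
    of order at most r - 1, \<open>N2\<close> only those of order at most r - 2.\<close>
  define N2 where "N2 = mat_deriv NN t + NN t * A"
  have N2: "N2 \<in> carrier_mat d n" unfolding N2_def
    by (rule add_carrier_mat[OF mult_carrier_mat[OF NN_carrier A]])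
  have N2D: "N2 * X.D j t = 0\<^sub>m d p" if j: "j + 1 < r" for j
  proof -
    have "NN s * X.D j s = 0\<^sub>m d p" for s by (rule NND) (use j in simp)
    moreover have "NN t * X.D (Suc j) t = 0\<^sub>m d p" by (rule NND) (use j in simp)
    ultimately have e: "0\<^sub>m d p - N2 * X.D j t = 0\<^sub>m d p"
      using mult_DmA_pow_Suc[OF A W1 smooth_NN, where t = t and j = j] by (simp add: N2_def mat_deriv_const)
    show ?thesis
      using mat_diff_eq_0D[OF zero_carrier_mat mult_carrier_mat[OF N2 X.D_carrier] e] by simp
  qed
  define s :: real where "s = (-1) ^ (r - 1)"
  have ss: "s * s = 1" by (simp add: s_def power_add[symmetric] mult_2[symmetric])
  \<comment> \<open>Chosen to make \<open>\<Theta> * C\<close> agree with \<open>N2\<close> on the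
    last iterate, where C gives \<open>s\<close> times the identity; \<open>s * s = 1\<close> undoes
    the sign.\<close>
  define \<Theta> where "\<Theta> = s \<cdot>\<^sub>m (N2 * X.D (r - 1) t)"
  have \<Theta>: "\<Theta> \<in> carrier_mat d p" unfolding \<Theta>_def
    by (rule smult_carrier_mat[OF mult_carrier_mat[OF N2 X.D_carrier]])
  have \<Theta>C: "\<Theta> * C \<in> carrier_mat d n" by (rule mult_carrier_mat[OF \<Theta> C])
  have C1: "C * A ^\<^sub>m 0 = C" using A C by simp
  have "(N2 - \<Theta> * C) * X.D j t = 0\<^sub>m d p" if j: "j < r" for j
  proof -
    note cD = X.D_carrier[of j t]
    have m: "(N2 - \<Theta> * C) * X.D j t = N2 * X.D j t - \<Theta> * (C * X.D j t)"
      using minus_mult_distrib_mat[OF N2 \<Theta>C cD] assoc_mult_mat[OF \<Theta> C cD] by simp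
    consider "j + 1 < r" | "j = r - 1" using j by linarith
    then show ?thesis
    proof cases
      case 1
      have "C * X.D j t = 0\<^sub>m p p" using X.CA_D_low[of 0 j t] 1 C1 by simp
      then show ?thesis using m N2D[OF 1] \<Theta> by simp
    next
      case 2
      have "C * X.D j t = s \<cdot>\<^sub>m 1\<^sub>m p"
        using X.CA_D_high[of 0 j t] 2 r C1 CAW1[of t] by (simp add: s_def)
      then have "\<Theta> * (C * X.D j t) = s \<cdot>\<^sub>m \<Theta>"
        using mult_smult_distrib[OF \<Theta> one_carrier_mat, of s] \<Theta> by simp
      also have "\<dots> = N2 * X.D j t"
        unfolding \<Theta>_def 2 using ss by (intro eq_matI) (auto simp: mult.assoc[symmetric])
      finally show ?thesis using m mult_carrier_mat[OF N2 cD] by simp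
    qed
  qed
  then have K0: "(N2 - \<Theta> * C) * X.K t = 0\<^sub>m d (r * p)"
    using mult_krylov_eq_0_iff[OF A W1 minus_carrier_mat[OF \<Theta>C]] by blast
  have "(N2 - \<Theta> * C) * X.E t = 0\<^sub>m d (r * p)"
    unfolding X.E_def
    using assoc_mult_mat[OF minus_carrier_mat[OF \<Theta>C, of N2] krylov_carrier[of n p r A W1 t]
        pinv_props(1)[OF X.CCK_carrier[of t]]] K0 left_mult_zero_mat[OF pinv_props(1)[OF X.CCK_carrier[of t]], of d]
    by simp
  then have "N2 * E t - \<Theta> * (C * E t) = 0\<^sub>m d (r * p)"
    using minus_mult_distrib_mat[OF N2 \<Theta>C E_carrier[of t]] assoc_mult_mat[OF \<Theta> C E_carrier[of t]]
    unfolding E_eq by simp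
  then have N2E: "N2 * E t = \<Theta> * (C * E t)"
    by (rule mat_diff_eq_0D[OF mult_carrier_mat[OF N2 E_carrier]
          mult_carrier_mat[OF \<Theta> mult_carrier_mat[OF C E_carrier]]])
  have CE: "C * E t \<in> carrier_mat p (r * p)" by (rule mult_carrier_mat[OF C E_carrier])
  have CE_entry: "(C * E t) $$ (a,b) = (if a = b then 1 else 0)" if ab: "a < p" "b < r * p" for a b
  proof -
    have a: "a < r * p" using less_le_trans[OF ab(1)] block_bound[OF r0, of p] by simp
    from calC_mult_entry[OF E_carrier this ab(2), of t] a ab C1
    show ?thesis unfolding CC_E by simp
  qed
  show "blk (Ah t) (r * p) (l * p) d p = 0\<^sub>m d p" if l: "1 \<le> l" "l < r"
  proof -
    have le: "l * p + p \<le> r * p" by (rule block_bound[OF l(2)])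
    have len: "l * p + p \<le> n" using le dim_le by simp
    have "blk (W t) 0 (l * p) n p = blk (E t) 0 (l * p) n p"
      by (rule eq_matI) (use le carrier_matD[OF E_carrier[of t]] V_carrier in \<open>auto simp: hcat_def\<close>)
    then have "blk (Ah t) (r * p) (l * p) d p = N2 * blk (E t) 0 (l * p) n p"
      using Ah_lower[OF len, of t] unfolding N2_def by simp
    also have "\<dots> = blk (N2 * E t) 0 (l * p) d p"
      using blk_mult[OF N2 E_carrier _ le, of 0 d t] blk_full[OF N2] by simp
    also have "\<dots> = \<Theta> * blk (C * E t) 0 (l * p) p p"
      unfolding N2E using blk_mult[OF \<Theta> CE _ le, of 0 d] blk_full[OF \<Theta>] by simp
    \<comment> \<open>For \<open>l \<ge> 1\<close> these columns lie to the right of the identity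
      block in [I, 0].\<close>
    also have "blk (C * E t) 0 (l * p) p p = 0\<^sub>m p p"
    proof (rule eq_matI)
      fix a b assume "a < dim_row (0\<^sub>m p p :: real mat)" "b < dim_col (0\<^sub>m p p :: real mat)"
      then have ab: "a < p" "b < p" by auto
      have "l * p + b < r * p" using le ab by simp
      moreover have "a \<noteq> l * p + b"
        using l(1) ab by (metis le_trans le_add1 mult_le_mono1 mult_1 not_le)
      ultimately show "blk (C * E t) 0 (l * p) p p $$ (a,b) = 0\<^sub>m p p $$ (a,b)"
        using CE_entry[OF ab(1)] ab by simp
    qed auto
    finally show ?thesis using \<Theta> by simp
  qed
qed

end

section \<open>The normal form with its blocks, the feedback criterion (i) and the case (ii)\<close>

theorem theorem1:
  fixes n m p q r :: nat
    and A B C V :: "real mat"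
    and L :: "real \<Rightarrow> real mat"
    and f :: "real \<Rightarrow> real vec \<Rightarrow> real vec \<Rightarrow> real vec"
  defines "U \<equiv> calU n m p r A B C L V"
    and "\<Gamma> \<equiv> C * A ^\<^sub>m (r - 1) * B"
  assumes A: "A \<in> carrier_mat n n" and B: "B \<in> carrier_mat n m" and C: "C \<in> carrier_mat p n"
    and mp: "m \<ge> p"
    and f_cont: "cont_vecfun n m n f" and f_bdd: "bounded_vecfun n m f"
    \<comment> \<open>(P1)\<close>
    and L_smooth: "smooth_matfun m m L"
    and L_bdd: "\<forall>k \<le> n. bounded_matfun ((mat_deriv ^^ k) L)"
    and rk_BL: "\<forall>t. mrank (B * L t) = q" and qp: "q \<ge> p"
    \<comment> \<open>(P2)\<close>
    and r_pos: "r \<ge> 1"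
    and rd_L: "\<forall>k t. k + 2 \<le> r \<longrightarrow> C * A ^\<^sub>m k * B * L t = 0\<^sub>m p m"
    and rd_f: "\<forall>k t x u. k + 2 \<le> r \<longrightarrow> x \<in> carrier_vec n \<longrightarrow> u \<in> carrier_vec m \<longrightarrow>
                  C * A ^\<^sub>m k *\<^sub>v f t x u = 0\<^sub>v p"
    and rk_Gamma: "\<forall>t. mrank (\<Gamma> * L t) = p"
    \<comment> \<open>choice of V\<close>
    and V: "V \<in> carrier_mat n (n - mrank (calC n p r A C))"
    and V_im: "mat_im V = mat_kernel (calC n p r A C)"
    \<comment> \<open>U is a Lyapunov transformation\<close>
    and U_lyap: "lyapunov_transformation n U"
  shows "\<exists>R S P Q N fr feta.
     \<comment> \<open>regularity of the blocks\<close>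
     (\<forall>i \<in> {1..r}. smooth_matfun p p (R i) \<and> bounded_matfun (R i)) \<and>
     (\<forall>i \<in> {1..r}. smooth_matfun (n - p * r) p (P i) \<and> bounded_matfun (P i)) \<and>
     smooth_matfun p (n - p * r) S \<and> bounded_matfun S \<and>
     smooth_matfun (n - p * r) (n - p * r) Q \<and> bounded_matfun Q \<and>
     smooth_matfun (n - p * r) m N \<and> bounded_matfun N \<and>
     cont_vecfun n m p fr \<and> bounded_vecfun n m fr \<and>
     cont_vecfun n m (n - p * r) feta \<and> bounded_vecfun n m feta \<and>
     \<comment> \<open>structure of A hat = (U A + U') U^{-1}\<close>
     (\<forall>t. let Ah = (U t * A + mat_deriv U t) * minv (U t) in
        Ah \<in> carrier_mat n n \<and>
        (\<forall>k l. k + 1 < r \<longrightarrow> l < r \<longrightarrow>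
           blk Ah (k * p) (l * p) p p = (if l = k + 1 then 1\<^sub>m p else 0\<^sub>m p p)) \<and>
        (\<forall>k. k + 1 < r \<longrightarrow> blk Ah (k * p) (p * r) p (n - p * r) = 0\<^sub>m p (n - p * r)) \<and>
        (\<forall>l < r. blk Ah (p * (r - 1)) (l * p) p p = R (l + 1) t) \<and>
        blk Ah (p * (r - 1)) (p * r) p (n - p * r) = S t \<and>
        (\<forall>l < r. blk Ah (p * r) (l * p) (n - p * r) p = P (l + 1) t) \<and>
        blk Ah (p * r) (p * r) (n - p * r) (n - p * r) = Q t) \<and>
     \<comment> \<open>structure of B hat = U B L\<close>
     (\<forall>t. let Bh = U t * B * L t in
        Bh \<in> carrier_mat n m \<and>
        blk Bh 0 0 (p * (r - 1)) m = 0\<^sub>m (p * (r - 1)) m \<and>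
        blk Bh (p * (r - 1)) 0 p m = \<Gamma> * L t \<and>
        blk Bh (p * r) 0 (n - p * r) m = N t) \<and>
     \<comment> \<open>C hat = C U^{-1} = [I_p, 0]\<close>
     (\<forall>t. C * minv (U t) = mat p n (\<lambda>(i,j). if i = j then 1 else 0)) \<and>
     \<comment> \<open>f hat = U f(t, U^{-1} z, u) = (0,...,0, fr, feta)\<close>
     (\<forall>t z u. z \<in> carrier_vec n \<longrightarrow> u \<in> carrier_vec m \<longrightarrow>
        U t *\<^sub>v f t (minv (U t) *\<^sub>v z) u =
          vec n (\<lambda>i. if i < p * (r - 1) then 0
                     else if i < p * r then fr t z u $ (i - p * (r - 1))
                     else feta t z u $ (i - p * r))) \<and>
     \<comment> \<open>(i)\<close>
     ((\<exists>K. smooth_matfun m p K \<and>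
           (\<forall>t. \<Gamma> * L t * K t = 1\<^sub>m p \<and> N t * K t = 0\<^sub>m (n - p * r) p))
      \<longleftrightarrow> (\<forall>t. mat_im (calB n m r A B L t * pinv (calC n p r A C * calB n m r A B L t)
                       * E0I p r) \<subseteq> mat_im (B * L t))) \<and>
     ((\<forall>t. mat_im (calB n m r A B L t * pinv (calC n p r A C * calB n m r A B L t)
                       * E0I p r) \<subseteq> mat_im (B * L t)) \<longrightarrow>
      (let K = (\<lambda>t. pinv (B * L t) * calB n m r A B L t
                     * pinv (calC n p r A C * calB n m r A B L t) * E0I p r) in
         smooth_matfun m p K \<and>
         (\<forall>t. \<Gamma> * L t * K t = 1\<^sub>m p \<and> N t * K t = 0\<^sub>m (n - p * r) p))) \<and>
     \<comment> \<open>(ii)\<close>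
     (q = p \<longrightarrow> (\<forall>i \<in> {2..r}. \<forall>t. P i t = 0\<^sub>m (n - p * r) p) \<and>
                (\<forall>t. N t = 0\<^sub>m (n - p * r) m))"
proof -
  let ?U = "calU n m p r A B C L V"
  have F: "smooth_mat_on UNIV n m (\<lambda>s. B * L s)"
    by (rule smooth_mat_on_mult[OF open_UNIV smooth_mat_on_const[OF B] L_smooth[unfolded smooth_matfun_iff]])
  have cL: "L t \<in> carrier_mat m m" for t using L_smooth by (simp add: smooth_matfun_def)
  have CA: "C * A ^\<^sub>m k \<in> carrier_mat p n" for k
    by (rule mult_carrier_mat[OF C pow_carrier_mat[OF A]])
  have CABL: "C * A ^\<^sub>m k * B * L t = C * A ^\<^sub>m k * (B * L t)" for k t
    by (rule assoc_mult_mat[OF CA B cL])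
  interpret byrnes_isidori n p m r A C B L V
  proof
    show "C * A ^\<^sub>m i * (B * L t) = 0\<^sub>m p m" if "i + 2 \<le> r" for i t
      using rd_L that unfolding CABL by blast
    show "\<exists>J\<in>carrier_mat m p. C * A ^\<^sub>m (r - 1) * (B * L t) * J = 1\<^sub>m p" for t
      using mrank_full_row_right_inverse[OF mult_carrier_mat[OF CA mult_carrier_mat[OF B cL]]] rk_Gamma
      unfolding \<Gamma>_def CABL by blast
    show "smooth_mat_on UNIV m m L" using L_smooth unfolding smooth_matfun_iff .
    show "bounded_matfun L" using L_bdd[rule_format, of 0] by simp
    show "lyapunov_transformation n (calU n m p r A B C L V)" using U_lyap unfolding U_def .
  qed (rule A C F r_pos B V V_im)+
  \<comment> \<open>The statement writes block offsets as \<open>p * r\<close>, the locale as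
    \<open>r * p\<close>; unfolding \<open>pr\<close> in the goal aligns them.\<close>
  have pr: "p * r = r * p" "p * (r - 1) = (r - 1) * p" by (simp_all add: mult.commute)
  have rp: "(r - 1) * p + p = r * p" using r_pos by (cases r) auto
  have le1: "(r - 1) * p + p \<le> n" using rp dim_le by simp
  have le2: "r * p + d \<le> n" using dim_add by simp
  have lel: "(i - 1) * p + p \<le> n" if "i \<in> {1..r}" for i
    using block_bound[of "i - 1" r p] that dim_le by force
  \<comment> \<open>The whole transformed f. Its slices \<open>fr\<close> and \<open>feta\<close>
    inherit continuity and boundedness.\<close>
  define h where "h = (\<lambda>t z u. ?U t *\<^sub>v f t (minv (?U t) *\<^sub>v z) u)"
  have fc: "f t x u \<in> carrier_vec n" if "x \<in> carrier_vec n" "u \<in> carrier_vec m" for t x u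
    using f_cont that by (simp add: cont_vecfun_def)
  have hc: "h t z u \<in> carrier_vec n" if "z \<in> carrier_vec n" "u \<in> carrier_vec m" for t z u
    unfolding h_def minv_U
    by (rule mult_mat_vec_carrier[OF U_carrier fc[OF mult_mat_vec_carrier[OF W_carrier that(1)] that(2)]])
  have h_cont: "cont_vecfun n m n h"
    unfolding h_def minv_U
    by (rule cont_vecfun_transform[OF f_cont U_carrier smooth_mat_on_continuous[OF smooth_U]
          W_carrier smooth_mat_on_continuous[OF smooth_W]])
  obtain b where b: "b \<ge> 0" "\<And>t i j. i < n \<Longrightarrow> j < n \<Longrightarrow> \<bar>?U t $$ (i,j)\<bar> \<le> b"
    using bounded_matfunE[OF bounded_U U_carrier] by blast
  have h_bdd: "bounded_vecfun n m h"
    unfolding h_def minv_U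
    by (rule bounded_vecfun_transform[OF f_bdd fc U_carrier b(2) W_carrier])
  define fr where "fr = (\<lambda>t z u. vec p (\<lambda>i. h t z u $ ((r - 1) * p + i)))"
  define feta where "feta = (\<lambda>t z u. vec d (\<lambda>i. h t z u $ (r * p + i)))"
  \<comment> \<open>Blocks are numbered from 1 in the normal form and from 0 by the offsets of
    \<open>blk\<close>, hence \<open>i - 1\<close>.\<close>
  define R where "R = (\<lambda>i t. blk (Ah t) ((r - 1) * p) ((i - 1) * p) p p)"
  define S where "S = (\<lambda>t. blk (Ah t) ((r - 1) * p) (r * p) p d)"
  define P where "P = (\<lambda>i t. blk (Ah t) (r * p) ((i - 1) * p) d p)"
  define Q where "Q = (\<lambda>t. blk (Ah t) (r * p) (r * p) d d)"
  define N where "N = (\<lambda>t. blk (Bh t) (r * p) 0 d m)"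
  have feedback: "(C * A ^\<^sub>m (r - 1) * B * L t * X = 1\<^sub>m p \<and> N t * X = 0\<^sub>m d p) \<longleftrightarrow> B * L t * X = E_last t"
    if "X \<in> carrier_mat m p" for X t
    using feedback_iff[OF that, of t] unfolding CABL N_def Bh_lower .
  \<comment> \<open>The gain is given as a product nested to the left; regrouping exposes
    \<open>E t\<close> inside it.\<close>
  have K_eq: "pinv (B * L t) * calB n m r A B L t * pinv (CC * calB n m r A B L t) * E0I p r
      = pinv (B * L t) * E_last t" for t
  proof -
    have c1: "pinv (B * L t) \<in> carrier_mat m n" by (rule pinv_props(1)[OF BL_carrier])
    have c2: "calB n m r A B L t \<in> carrier_mat n (r * m)" by (simp add: calB_def)
    have c3: "pinv (CC * calB n m r A B L t) \<in> carrier_mat (r * m) (r * p)"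
      by (rule pinv_props(1)[OF mult_carrier_mat[OF calC_carrier c2]])
    have c4: "E0I p r \<in> carrier_mat (r * p) p" by (simp add: E0I_def)
    show ?thesis
      unfolding assoc_mult_mat[OF c1 c2 c3] calB_pinv by (rule assoc_mult_mat[OF c1 E_carrier c4])
  qed
  have witness: "smooth_mat_on UNIV m p (\<lambda>t. pinv (B * L t) * E_last t) \<and>
      (\<forall>t. C * A ^\<^sub>m (r - 1) * B * L t * (pinv (B * L t) * E_last t) = 1\<^sub>m p \<and>
        N t * (pinv (B * L t) * E_last t) = 0\<^sub>m d p)"
    if im: "\<forall>t. mat_im (E_last t) \<subseteq> mat_im (B * L t)"
  proof -
    note w = feedback_witness[OF rk_BL[rule_format] im[rule_format]]
    show ?thesis using w feedback[OF smooth_mat_on_carrier[OF w(1) UNIV_I]] by blast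
  qed
  show ?thesis
    unfolding U_def \<Gamma>_def Let_def pr calB_pinv K_eq smooth_matfun_iff
  proof (rule exI[of _ R], rule exI[of _ S], rule exI[of _ P], rule exI[of _ Q], rule exI[of _ N],
      rule exI[of _ fr], rule exI[of _ feta], intro conjI)
    note sA = smooth_matfun_blk[OF smooth_Ah, unfolded smooth_matfun_iff]
      and bA = bounded_matfun_blk[OF bounded_Ah Ah_carrier]
    show "\<forall>i\<in>{1..r}. smooth_mat_on UNIV p p (R i) \<and> bounded_matfun (R i)"
      unfolding R_def using sA[OF le1 lel] bA[OF le1 lel] by blast
    show "\<forall>i\<in>{1..r}. smooth_mat_on UNIV d p (P i) \<and> bounded_matfun (P i)"
      unfolding P_def using sA[OF le2 lel] bA[OF le2 lel] by blast
    show "smooth_mat_on UNIV p d S" "bounded_matfun S"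
      unfolding S_def using sA[OF le1 le2] bA[OF le1 le2] by blast+
    show "smooth_mat_on UNIV d d Q" "bounded_matfun Q"
      unfolding Q_def using sA[OF le2 le2] bA[OF le2 le2] by blast+
    have "0 + m \<le> m" by simp
    then show "smooth_mat_on UNIV d m N" "bounded_matfun N"
      unfolding N_def using smooth_matfun_blk[OF smooth_Bh le2, unfolded smooth_matfun_iff]
        bounded_matfun_blk[OF bounded_Bh Bh_carrier le2] by blast+
    show "cont_vecfun n m p fr" unfolding fr_def by (rule cont_vecfun_sub[OF h_cont le1])
    show "cont_vecfun n m d feta" unfolding feta_def by (rule cont_vecfun_sub[OF h_cont le2])
    show "bounded_vecfun n m fr" unfolding fr_def by (rule bounded_vecfun_sub[OF h_bdd hc le1])
    show "bounded_vecfun n m feta" unfolding feta_def by (rule bounded_vecfun_sub[OF h_bdd hc le2])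
    show "\<forall>t. Ah t \<in> carrier_mat n n \<and>
        (\<forall>k l. k + 1 < r \<longrightarrow> l < r \<longrightarrow>
           blk (Ah t) (k * p) (l * p) p p = (if l = k + 1 then 1\<^sub>m p else 0\<^sub>m p p)) \<and>
        (\<forall>k. k + 1 < r \<longrightarrow> blk (Ah t) (k * p) (r * p) p d = 0\<^sub>m p d) \<and>
        (\<forall>l < r. blk (Ah t) ((r - 1) * p) (l * p) p p = R (l + 1) t) \<and>
        blk (Ah t) ((r - 1) * p) (r * p) p d = S t \<and>
        (\<forall>l < r. blk (Ah t) (r * p) (l * p) d p = P (l + 1) t) \<and>
        blk (Ah t) (r * p) (r * p) d d = Q t"
      using Ah_carrier Ah_superdiagonal Ah_upper_right by (simp add: R_def S_def P_def Q_def)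
    have "r - 1 < r" using r by simp
    then show "\<forall>t. Bh t \<in> carrier_mat n m \<and>
        blk (Bh t) 0 0 ((r - 1) * p) m = 0\<^sub>m ((r - 1) * p) m \<and>
        blk (Bh t) ((r - 1) * p) 0 p m = C * A ^\<^sub>m (r - 1) * B * L t \<and>
        blk (Bh t) (r * p) 0 d m = N t"
      using Bh_carrier Bh_zero Bh_upper unfolding CABL N_def by blast
    show "\<forall>t. C * minv (?U t) = mat p n (\<lambda>(i,j). if i = j then 1 else 0)"
      using C_minv_U by blast
    show "\<forall>t z u. z \<in> carrier_vec n \<longrightarrow> u \<in> carrier_vec m \<longrightarrow>
        ?U t *\<^sub>v f t (minv (?U t) *\<^sub>v z) u =
          vec n (\<lambda>i. if i < (r - 1) * p then 0
                     else if i < r * p then fr t z u $ (i - (r - 1) * p)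
                     else feta t z u $ (i - r * p))"
    proof (intro allI impI)
      fix t :: real and z u :: "real vec"
      assume z: "z \<in> carrier_vec n" and u: "u \<in> carrier_vec m"
      have y: "minv (?U t) *\<^sub>v z \<in> carrier_vec n"
        unfolding minv_U by (rule mult_mat_vec_carrier[OF W_carrier z])
      have "h t z u = vec n (\<lambda>i. if i < (r - 1) * p then 0
                     else if i < r * p then fr t z u $ (i - (r - 1) * p)
                     else feta t z u $ (i - r * p))"
      proof (rule eq_vecI)
        fix i assume "i < dim_vec (vec n (\<lambda>i. if i < (r - 1) * p then 0
                     else if i < r * p then fr t z u $ (i - (r - 1) * p)
                     else feta t z u $ (i - r * p)))"
        then have i: "i < n" by simp
        consider "i < (r - 1) * p" | "(r - 1) * p \<le> i" "i < r * p" | "r * p \<le> i" by linarith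
        then show "h t z u $ i = vec n (\<lambda>i. if i < (r - 1) * p then 0
                     else if i < r * p then fr t z u $ (i - (r - 1) * p)
                     else feta t z u $ (i - r * p)) $ i"
        proof cases
          case 1
          have "h t z u $ i = 0"
            unfolding h_def by (rule U_mult_vec_zero[OF fc[OF y u] _ 1]) (use rd_f y u in blast)
          then show ?thesis using 1 i by simp
        next
          case 2
          then have "i - (r - 1) * p < p" using rp by linarith
          then show ?thesis using 2 i by (simp add: fr_def)
        next
          case 3
          then have "\<not> i < (r - 1) * p" "i - r * p < d" using i rp by linarith+
          then show ?thesis using 3 i by (simp add: feta_def)
        qed
      qed (use hc[OF z u, of t] in simp)
      then show "?U t *\<^sub>v f t (minv (?U t) *\<^sub>v z) u = vec n (\<lambda>i. if i < (r - 1) * p then 0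
                     else if i < r * p then fr t z u $ (i - (r - 1) * p)
                     else feta t z u $ (i - r * p))"
        unfolding h_def .
    qed
    show "(\<exists>K. smooth_mat_on UNIV m p K \<and>
           (\<forall>t. C * A ^\<^sub>m (r - 1) * B * L t * K t = 1\<^sub>m p \<and> N t * K t = 0\<^sub>m d p))
      \<longleftrightarrow> (\<forall>t. mat_im (E_last t) \<subseteq> mat_im (B * L t))"
    proof
      assume "\<exists>K. smooth_mat_on UNIV m p K \<and>
           (\<forall>t. C * A ^\<^sub>m (r - 1) * B * L t * K t = 1\<^sub>m p \<and> N t * K t = 0\<^sub>m d p)"
      then obtain K' where K': "smooth_mat_on UNIV m p K'"
        and e: "\<And>t. C * A ^\<^sub>m (r - 1) * B * L t * K' t = 1\<^sub>m p \<and> N t * K' t = 0\<^sub>m d p" by blast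
      note c = smooth_mat_on_carrier[OF K' UNIV_I]
      show "\<forall>t. mat_im (E_last t) \<subseteq> mat_im (B * L t)"
        using feedback_im[OF c] feedback[OF c] e by blast
    next
      assume "\<forall>t. mat_im (E_last t) \<subseteq> mat_im (B * L t)"
      from witness[OF this] show "\<exists>K. smooth_mat_on UNIV m p K \<and>
           (\<forall>t. C * A ^\<^sub>m (r - 1) * B * L t * K t = 1\<^sub>m p \<and> N t * K t = 0\<^sub>m d p)"
        by (intro exI[of _ "\<lambda>t. pinv (B * L t) * E_last t"])
    qed
    show "(\<forall>t. mat_im (E_last t) \<subseteq> mat_im (B * L t)) \<longrightarrow>
      smooth_mat_on UNIV m p (\<lambda>t. pinv (B * L t) * E_last t) \<and>
      (\<forall>t. C * A ^\<^sub>m (r - 1) * B * L t * (pinv (B * L t) * E_last t) = 1\<^sub>m p \<and>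
        N t * (pinv (B * L t) * E_last t) = 0\<^sub>m d p)"
      using witness by blast
    show "q = p \<longrightarrow> (\<forall>i\<in>{2..r}. \<forall>t. P i t = 0\<^sub>m d p) \<and> (\<forall>t. N t = 0\<^sub>m d m)"
    proof (intro impI conjI ballI allI)
      assume "q = p"
      then have rk: "mrank (B * L t) = p" for t using rk_BL by simp
      show "N t = 0\<^sub>m d m" for t unfolding N_def Bh_lower by (rule minimal_rank(1)[OF rk])
      show "P i t = 0\<^sub>m d p" if "i \<in> {2..r}" for i t
        unfolding P_def by (rule minimal_rank(2)[OF rk]) (use that in auto)
    qed
  qed
qed

end
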